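(* Let $\mu$ be the random measure with law $\mathcal{P}(d\mu|\rho,\eta)$ described in the context and assume that $\kappa_n(\rho|y)<\infty$ for each $n\ge1$ and each fixed $y\in\mathcal{Y}$. Let $n\ge1$ and let $g$ be a measurable function on $\mathcal{Y}^n\times\mathcal{M}$ that is non-negative, or integrable with respect to $\prod_{i=1}^n\mu(dY_i)\mathcal{P}(d\mu|\rho,\eta)$. Then $$\int_{\mathcal{M}\times\mathcal{Y}^n}g(\mathbf{Y},\mu)\prod_{i=1}^n\mu(dY_i)\,\mathcal{P}(d\mu|\rho,\eta)=\int_{\mathcal{M}\times\mathcal{Y}^n}g(\mathbf{Y},\mu)\,\mathcal{P}(d\mu|\rho,\eta,\mathbf{Y})\,M_\mu(d\mathbf{Y}|\rho,\eta),$$ and both expressions are equal to $$\sum_{\mathbf{p}}\int_{\mathcal{Y}^{n(\mathbf{p})}}\left[\int_{\mathcal{M}}g(\mathbf{Y}^*,\mathbf{p},\mu)\,\mathcal{P}(d\mu|\rho,\eta,\mathbf{Y})\right]\prod_{j=1}^{n(\mathbf{p})}\kappa_{e_{j,n}}(\rho|Y_j^* )\,\eta(dY_j^* ).$$ In particular $M_\mu(d\mathbf{Y}|\rho,\eta)=\prod_{j=1}^{n(\mathbf{p})}\kappa_{e_{j,n}}(\rho|Y_j^* )\,\eta(dY_j^* )$.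
   Context: $\mathcal{S},\mathcal{Y}$ are Polish spaces; $\eta$ is a $\sigma$-finite non-atomic measure on $\mathcal{Y}$; $\rho(ds|y)$ is a measurable kernel of ($\sigma$-finite, Lévy-type) measures on $\mathcal{S}$; $h:\mathcal{S}\to(0,\infty)$ is measurable; and $\int_B\int_{\mathcal{S}}\min(h(s),1)\rho(ds|y)\eta(dy)<\infty$ for each bounded $B\subset\mathcal{Y}$. $N$ is a Poisson random measure on $\mathcal{S}\times\mathcal{Y}$ with intensity $\rho(ds|y)\eta(dy)$ and $\mu(dy)=\int_{\mathcal{S}}h(s)N(ds,dy)$; $\mathcal{P}(d\mu|\rho,\eta)$ is its law, on the space $\mathcal{M}$ of boundedly finite measures on $\mathcal{Y}$. $\kappa_n(\rho|y)=\int_{\mathcal{S}}h(s)^n\rho(ds|y)$. $M_\mu(d\mathbf{Y}|\rho,\eta)=\int_{\mathcal{M}}\prod_{i=1}^n\mu(dY_i)\mathcal{P}(d\mu|\rho,\eta)$ is the joint moment measure. A point $\mathbf{Y}=(Y_1,\dots,Y_n)$ is encoded as $(\mathbf{Y}^*,\mathbf{p})$, where $Y_1^*,\dots,Y^*_{n(\mathbf{p})}$ are its distinct values, $\mathbf{p}=\{C_1,\dots,C_{n(\mathbf{p})}\}$ is the partition of $\{1,\dots,n\}$ with $Y_i=Y_j^*$ iff $i\in C_j$, and $e_{j,n}=|C_j|$; $\sum_{\mathbf{p}}$ is over all partitions of $\{1,\dots,n\}$. $\mathcal{P}(d\mu|\rho,\eta,\mathbf{Y})$ is the law of $\mu+\sum_{j=1}^{n(\mathbf{p})}h(J_{j,n})\delta_{Y_j^*}$,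 where $\mu\sim\mathcal{P}(d\mu|\rho,\eta)$ is independent of the independent random variables $J_{j,n}$, with $\Pr(J_{j,n}\in ds|\rho,Y_j^* )=h(s)^{e_{j,n}}\rho(ds|Y_j^* )/\kappa_{e_{j,n}}(\rho|Y_j^* )$. *)

theory Defs
  imports "HOL-Probability.Probability"
begin

definition non_atomic :: "'a measure \<Rightarrow> bool" where
  "non_atomic M \<longleftrightarrow>
    (\<forall>A\<in>sets M. 0 < emeasure M A \<longrightarrow>
      (\<exists>B\<in>sets M. B \<subseteq> A \<and> 0 < emeasure M B \<and> emeasure M B < emeasure M A))"

(* The measure K(x, dz) M(dx) on the product of the measurable spaces M and Z. *)
definition semidirect :: "'a measure \<Rightarrow> 'b measure \<Rightarrow> ('a \<Rightarrow> 'b measure) \<Rightarrow> ('a \<times> 'b) measure" where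
  "semidirect M Z K = measure_of (space M \<times> space Z) (sets (M \<Otimes>\<^sub>M Z))
    (\<lambda>A. \<integral>\<^sup>+x. emeasure (K x) (Pair x -` A) \<partial>M)"

definition measurable_kernel :: "('y::polish_space \<Rightarrow> 's::polish_space measure) \<Rightarrow> bool" where
  "measurable_kernel \<rho> \<longleftrightarrow>
    (\<forall>y. sets (\<rho> y) = sets borel) \<and>
    (\<forall>A\<in>sets borel. (\<lambda>y. emeasure (\<rho> y) A) \<in> borel_measurable borel)"

(* rho(ds|y) eta(dy), on S x Y *)
definition intensity ::
  "('y::polish_space \<Rightarrow> 's::polish_space measure) \<Rightarrow> 'y measure \<Rightarrow> ('s \<times> 'y) measure" where
  "intensity \<rho> \<eta> = distr (semidirect \<eta> borel \<rho>) (borel \<Otimes>\<^sub>M borel) prod.swap"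

definition poisson_random_measure :: "'w measure \<Rightarrow> 'x measure \<Rightarrow> ('w \<Rightarrow> 'x measure) \<Rightarrow> bool" where
  "poisson_random_measure P \<nu> N \<longleftrightarrow>
    prob_space P \<and>
    (\<forall>\<omega>\<in>space P. sets (N \<omega>) = sets \<nu>) \<and>
    (\<forall>A\<in>sets \<nu>. (\<lambda>\<omega>. emeasure (N \<omega>) A) \<in> borel_measurable P) \<and>
    (\<forall>A\<in>sets \<nu>. emeasure \<nu> A < \<infinity> \<longrightarrow>
      (\<forall>k::nat. measure P {\<omega>\<in>space P. emeasure (N \<omega>) A = of_nat k}
        = exp (- measure \<nu> A) * measure \<nu> A ^ k / fact k)) \<and>
    (\<forall>A\<in>sets \<nu>. emeasure \<nu> A = \<infinity> \<longrightarrow> (AE \<omega> in P. emeasure (N \<omega>) A = \<infinity>)) \<and>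
    (\<forall>(A :: nat \<Rightarrow> 'x set) m.
      (\<forall>i<m. A i \<in> sets \<nu>) \<and> disjoint_family_on A {..<m} \<longrightarrow>
      prob_space.indep_vars P (\<lambda>_. borel) (\<lambda>i \<omega>. emeasure (N \<omega>) (A i)) {..<m})"

(* The space of boundedly finite Borel measures. Its sigma-algebra is generated by the
   evaluations at Borel sets, which is also the Borel sigma-algebra of the weak-hash topology. *)
definition bf_measures :: "'y::polish_space measure measure" where
  "bf_measures = (SUP A \<in> sets borel. vimage_algebra
    {m. sets m = sets borel \<and> (\<forall>B\<in>sets borel. bounded B \<longrightarrow> emeasure m B < \<infinity>)}
    (\<lambda>m. emeasure m A) borel)"

(* mu(dy) = int_S h(s) N(ds, dy) *)
definition weighted_measure ::
  "('s::polish_space \<Rightarrow> real) \<Rightarrow> ('s \<times> 'y::polish_space) measure \<Rightarrow> 'y measure" where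
  "weighted_measure h N = distr (density N (\<lambda>(s, y). ennreal (h s))) borel snd"

(* The random measure is boundedly finite only almost surely;
   on the exceptional null set it is replaced by the zero measure. *)
definition crm_law ::
  "'w measure \<Rightarrow> ('s::polish_space \<Rightarrow> real) \<Rightarrow> ('w \<Rightarrow> ('s \<times> 'y::polish_space) measure)
    \<Rightarrow> 'y measure measure" where
  "crm_law P h N = distr P bf_measures
    (\<lambda>\<omega>. if weighted_measure h (N \<omega>) \<in> space bf_measures then weighted_measure h (N \<omega>)
         else null_measure borel)"

definition kappa ::
  "('s::polish_space \<Rightarrow> real) \<Rightarrow> ('y \<Rightarrow> 's measure) \<Rightarrow> nat \<Rightarrow> 'y \<Rightarrow> ennreal" where
  "kappa h \<rho> k y = (\<integral>\<^sup>+s. ennreal (h s ^ k) \<partial>\<rho> y)"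

(* Y^n is the space of extensional functions on {1..n} with the product sigma-algebra. *)
abbreviation tuples :: "nat \<Rightarrow> (nat \<Rightarrow> 'y::polish_space) measure" where
  "tuples n \<equiv> PiM {1..n} (\<lambda>_. borel)"

(* prod_i mu(dY_i) L(dmu), on M x Y^n *)
definition moment_joint :: "nat \<Rightarrow> 'y::polish_space measure measure
    \<Rightarrow> ('y measure \<times> (nat \<Rightarrow> 'y)) measure" where
  "moment_joint n L = semidirect L (tuples n) (\<lambda>\<mu>. PiM {1..n} (\<lambda>_. \<mu>))"

definition moment_measure :: "nat \<Rightarrow> 'y::polish_space measure measure \<Rightarrow> (nat \<Rightarrow> 'y) measure" where
  "moment_measure n L = measure_of (space (tuples n)) (sets (tuples n))
    (\<lambda>A. \<integral>\<^sup>+\<mu>. emeasure (PiM {1..n} (\<lambda>_. \<mu>)) A \<partial>L)"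

(* A tuple Y is encoded as (Y*, p). The blocks C of p themselves serve as the index j, so that
   Y* is a function on blocks, n(p) = card p and e_{j,n} = card C; the numbering of the blocks
   is immaterial. *)
definition tie_partition :: "nat \<Rightarrow> (nat \<Rightarrow> 'y) \<Rightarrow> nat set set" where
  "tie_partition n Y = (\<lambda>i. {j\<in>{1..n}. Y j = Y i}) ` {1..n}"

(* For a block C of the partition of Y, the image of C under Y is a singleton. *)
definition block_value :: "(nat \<Rightarrow> 'y) \<Rightarrow> nat set \<Rightarrow> 'y" where
  "block_value Y C = the_elem (Y ` C)"

definition decode :: "nat \<Rightarrow> nat set set \<Rightarrow> (nat set \<Rightarrow> 'y) \<Rightarrow> nat \<Rightarrow> 'y" where
  "decode n p y = (\<lambda>i\<in>{1..n}. y (THE C. C \<in> p \<and> i \<in> C))"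

(* This is the zero measure where kappa h rho k y = 0; such y carry no mass under the
   moment measure. *)
definition jump_law ::
  "('s::polish_space \<Rightarrow> real) \<Rightarrow> ('y \<Rightarrow> 's measure) \<Rightarrow> nat \<Rightarrow> 'y \<Rightarrow> 's measure" where
  "jump_law h \<rho> k y = density (\<rho> y) (\<lambda>s. ennreal (h s ^ k) / kappa h \<rho> k y)"

(* mu + sum_{C in p} h(J C) delta_{y C} *)
definition add_atoms ::
  "('s \<Rightarrow> real) \<Rightarrow> nat set set \<Rightarrow> (nat set \<Rightarrow> 'y::polish_space) \<Rightarrow> 'y measure
    \<Rightarrow> (nat set \<Rightarrow> 's) \<Rightarrow> 'y measure" where
  "add_atoms h p y \<mu> J = measure_of UNIV (sets borel)
    (\<lambda>B. emeasure \<mu> B + (\<Sum>C\<in>p. ennreal (h (J C)) * emeasure (return borel (y C)) B))"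

(* Independence of mu and the jumps is expressed by the product measure. *)
definition cond_law ::
  "('s::polish_space \<Rightarrow> real) \<Rightarrow> ('y::polish_space \<Rightarrow> 's measure) \<Rightarrow> 'y measure measure
    \<Rightarrow> nat \<Rightarrow> (nat \<Rightarrow> 'y) \<Rightarrow> 'y measure measure" where
  "cond_law h \<rho> L n Y =
    distr (L \<Otimes>\<^sub>M PiM (tie_partition n Y) (\<lambda>C. jump_law h \<rho> (card C) (block_value Y C)))
      bf_measures (\<lambda>(\<mu>, J). add_atoms h (tie_partition n Y) (block_value Y) \<mu> J)"

(* P(dmu|rho,eta,Y) M_mu(dY), on Y^n x M *)
definition disintegrated_joint ::
  "('s::polish_space \<Rightarrow> real) \<Rightarrow> ('y::polish_space \<Rightarrow> 's measure) \<Rightarrow> 'y measure measure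
    \<Rightarrow> nat \<Rightarrow> ((nat \<Rightarrow> 'y) \<times> 'y measure) measure" where
  "disintegrated_joint h \<rho> L n = semidirect (moment_measure n L) bf_measures (cond_law h \<rho> L n)"

(* prod_{C in p} kappa_{|C|}(rho|y C) eta(d(y C)) *)
definition block_measure ::
  "('s::polish_space \<Rightarrow> real) \<Rightarrow> ('y::polish_space \<Rightarrow> 's measure) \<Rightarrow> 'y measure
    \<Rightarrow> nat set set \<Rightarrow> (nat set \<Rightarrow> 'y) measure" where
  "block_measure h \<rho> \<eta> p = PiM p (\<lambda>C. density \<eta> (kappa h \<rho> (card C)))"

end

theory Submission
  imports Defs
begin

text \<open>
  The Mecke equation for a Poisson random measure follows, on cylinder events, from the identity
  \<open>k e\<^sup>-\<^sup>l l\<^sup>k / k! = l e\<^sup>-\<^sup>l l\<^sup>k\<^sup>-\<^sup>1 / (k - 1)!\<close> and the independence of the counts on disjoint sets.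
  Pushed forward to \<open>\<mu>\<close> it says that integrating against one factor \<open>\<mu>(dy)\<close> has the effect of adding
  an atom \<open>h(s) \<delta>\<^sub>y\<close> with intensity \<open>h(s) \<rho>(ds|y) \<eta>(dy)\<close>. By induction on the number of
  factors, the last one either creates a new atom (a new singleton block) or hits an
  atom created before (the block of that atom grows, which contributes another factor \<open>h(s)\<close>);
  this is the recursion for set partitions. Since \<open>\<eta>\<close> has no atoms, the atoms of distinct blocks almost surely
  sit at distinct points, so that the blocks are exactly the ties of \<open>\<^bold>Y\<close>. Normalising the jump
  measures by \<open>\<kappa>\<close> gives the stated form.
\<close>

section \<open>Kernels with a common sigma-finite exhaustion\<close>

text \<open>All measures involved are only sigma-finite: \<open>\<rho>\<close>,
  \<open>\<eta>\<close>, the random measure and its powers. Measurability of integrals in a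
  parameter is therefore organised around kernels with one exhausting sequence that serves all
  parameters at once. For marked points (s, y) this sequence is \<open>big k\<close> times a ball;
  it comes from bounding the indicator of h >= 1/(k+1) by (k+1) min(h, 1), together with the Levy
  condition. A second obstacle is that the Poisson hypotheses control each set only up to null sets,
  so \<open>N\<close> and the weighted measure are replaced by versions that lie in the required
  spaces for every outcome. The induction over the factors keeps each atom as a marked point with
  the unnormalised weight h(s)^k. In this form the growth of a block is a multiplication of
  densities, and no division by \<open>kappa\<close> occurs; jumps and locations are separated only
  afterwards. Atomlessness of \<open>\<eta>\<close> also enters only after the induction: the sum
  over partitions holds with coinciding locations allowed, and distinctness serves to read the
  partition off the decoded tuple.\<close>

definition locally_finite_measures :: "'a measure \<Rightarrow> 'a set set \<Rightarrow> 'a measure measure" where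
  "locally_finite_measures X \<F> = (SUP A \<in> sets X. vimage_algebra
    {m. sets m = sets X \<and> (\<forall>B\<in>\<F>. emeasure m B < \<infinity>)} (\<lambda>m. emeasure m A) borel)"

text \<open>One construction covers two spaces: bounded Borel sets give the space of the random
  measure, and the range of an exhausting sequence later gives the space of point configurations.
  Measurability into either is tested on evaluations.\<close>

lemma bf_measures_eq_locally_finite:
  "bf_measures = locally_finite_measures borel {B \<in> sets borel. bounded B}"
  unfolding bf_measures_def locally_finite_measures_def mem_Collect_eq Ball_def imp_conjL ..

lemma space_locally_finite_measures:
  "space (locally_finite_measures X \<F>) = {m. sets m = sets X \<and> (\<forall>B\<in>\<F>. emeasure m B < \<infinity>)}"
  unfolding locally_finite_measures_def by (subst space_Sup_eq_UN) auto

lemma space_bf_measures: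
  "space bf_measures = {m. sets m = sets borel \<and> (\<forall>B\<in>sets borel. bounded B \<longrightarrow> emeasure m B < \<infinity>)}"
  unfolding bf_measures_eq_locally_finite space_locally_finite_measures by auto

lemma measurable_emeasure_locally_finite [measurable]:
  "A \<in> sets X \<Longrightarrow> (\<lambda>m. emeasure m A) \<in> borel_measurable (locally_finite_measures X \<F>)"
  unfolding locally_finite_measures_def
  by (rule measurable_SUP1[where i=A]) (auto intro!: measurable_vimage_algebra1)

lemma measurable_locally_finiteI:
  assumes "\<And>x. x \<in> space M \<Longrightarrow> f x \<in> space (locally_finite_measures X \<F>)"
    and "\<And>A. A \<in> sets X \<Longrightarrow> (\<lambda>x. emeasure (f x) A) \<in> borel_measurable M"
  shows "f \<in> measurable M (locally_finite_measures X \<F>)"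
  unfolding locally_finite_measures_def
proof (rule measurable_SUP2)
  fix A assume "A \<in> sets X"
  show "f \<in> measurable M (vimage_algebra {m. sets m = sets X \<and> (\<forall>B\<in>\<F>. emeasure m B < \<infinity>)}
      (\<lambda>m. emeasure m A) borel)"
    using assms(1) assms(2)[OF \<open>A \<in> sets X\<close>]
    by (intro measurable_vimage_algebra2) (auto simp: space_locally_finite_measures)
qed auto

lemma measurable_emeasure_bf [measurable]:
  "A \<in> sets borel \<Longrightarrow> (\<lambda>m. emeasure m A) \<in> borel_measurable bf_measures"
  unfolding bf_measures_eq_locally_finite by (rule measurable_emeasure_locally_finite)

lemma measurable_bfI:
  assumes "\<And>x. x \<in> space M \<Longrightarrow> f x \<in> space bf_measures"
    and "\<And>A. A \<in> sets borel \<Longrightarrow> (\<lambda>x. emeasure (f x) A) \<in> borel_measurable M"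
  shows "f \<in> measurable M bf_measures"
  using assms unfolding bf_measures_eq_locally_finite by (intro measurable_locally_finiteI) auto

text \<open>The sequence \<open>F\<close> is chosen before x. This is stronger than sigma-finiteness
  of every \<open>K x\<close>, and it is what makes the normalised restrictions of
  \<open>K x\<close> to \<open>F i\<close> depend measurably on x.\<close>

definition sf_kernel :: "'a measure \<Rightarrow> 'b measure \<Rightarrow> ('a \<Rightarrow> 'b measure) \<Rightarrow> bool" where
  "sf_kernel M Z K \<longleftrightarrow> (\<forall>x\<in>space M. sets (K x) = sets Z) \<and>
    (\<forall>A\<in>sets Z. (\<lambda>x. emeasure (K x) A) \<in> borel_measurable M) \<and>
    (\<exists>F::nat \<Rightarrow> 'b set. incseq F \<and> range F \<subseteq> sets Z \<and> (\<Union>i. F i) = space Z \<and>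
      (\<forall>i. \<forall>x\<in>space M. emeasure (K x) (F i) < \<infinity>))"

lemma sf_kernelI:
  assumes "\<And>x. x \<in> space M \<Longrightarrow> sets (K x) = sets Z"
    and "\<And>A. A \<in> sets Z \<Longrightarrow> (\<lambda>x. emeasure (K x) A) \<in> borel_measurable M"
    and "incseq F" "\<And>i. F i \<in> sets Z" "(\<Union>i::nat. F i) = space Z"
    and "\<And>i x. x \<in> space M \<Longrightarrow> emeasure (K x) (F i) < \<infinity>"
  shows "sf_kernel M Z K"
  unfolding sf_kernel_def
proof (intro conjI ballI exI)
  show "range F \<subseteq> sets Z" using assms(4) by blast
  show "\<forall>i. \<forall>x\<in>space M. emeasure (K x) (F i) < \<infinity>" using assms(6) by simp
qed (simp_all add: assms(1-3,5))

lemma sf_kernel_sets: "sf_kernel M Z K \<Longrightarrow> x \<in> space M \<Longrightarrow> sets (K x) = sets Z"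
  unfolding sf_kernel_def by (drule conjunct1) (rule bspec)

lemma sf_kernel_space: "sf_kernel M Z K \<Longrightarrow> x \<in> space M \<Longrightarrow> space (K x) = space Z"
  by (rule sets_eq_imp_space_eq) (rule sf_kernel_sets)

lemma sf_kernel_emeasure:
  "sf_kernel M Z K \<Longrightarrow> A \<in> sets Z \<Longrightarrow> (\<lambda>x. emeasure (K x) A) \<in> borel_measurable M"
  unfolding sf_kernel_def by (drule conjunct2, drule conjunct1) (rule bspec)

lemma sf_kernelE:
  assumes "sf_kernel M Z K"
  obtains F :: "nat \<Rightarrow> _" where "incseq F" "\<And>i. F i \<in> sets Z" "(\<Union>i. F i) = space Z"
    "\<And>i x. x \<in> space M \<Longrightarrow> emeasure (K x) (F i) < \<infinity>"
proof -
  obtain F :: "nat \<Rightarrow> _" where F: "incseq F \<and> range F \<subseteq> sets Z \<and> (\<Union>i. F i) = space Z \<and>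
      (\<forall>i. \<forall>x\<in>space M. emeasure (K x) (F i) < \<infinity>)"
    using assms unfolding sf_kernel_def by (elim conjE exE) (rule that, intro conjI)
  show ?thesis by (rule that[of F]) (use F in auto)
qed

lemma sigma_finite_measureI_UN:
  assumes "range F \<subseteq> sets M" "(\<Union>i::nat. F i) = space M" "\<And>i. emeasure M (F i) < \<infinity>"
  shows "sigma_finite_measure M"
  by standard (rule exI[of _ "range F"], use assms in \<open>auto simp: less_top\<close>)

lemma sf_kernel_sigma_finite:
  assumes "sf_kernel M Z K" "x \<in> space M" shows "sigma_finite_measure (K x)"
proof -
  obtain F :: "nat \<Rightarrow> _" where F: "incseq F" "\<And>i. F i \<in> sets Z" "(\<Union>i. F i) = space Z"
    "\<And>i x. x \<in> space M \<Longrightarrow> emeasure (K x) (F i) < \<infinity>" by (rule sf_kernelE[OF assms(1)]) (rule that)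
  show ?thesis
  proof (rule sigma_finite_measureI_UN)
    show "range F \<subseteq> sets (K x)" using F(2) sf_kernel_sets[OF assms] by blast
    show "(\<Union>i. F i) = space (K x)" using F(3) sf_kernel_space[OF assms] by simp
  qed (rule F(4)[OF assms(2)])
qed

lemma sf_kernel_comp:
  assumes K: "sf_kernel M Z K" and f: "f \<in> measurable M' M" shows "sf_kernel M' Z (\<lambda>x. K (f x))"
proof -
  obtain F :: "nat \<Rightarrow> _" where F: "incseq F" "\<And>i. F i \<in> sets Z" "(\<Union>i. F i) = space Z"
    "\<And>i x. x \<in> space M \<Longrightarrow> emeasure (K x) (F i) < \<infinity>" by (rule sf_kernelE[OF K]) (rule that)
  show ?thesis
    by (rule sf_kernelI[where F=F])
      (simp_all add: F(1-3) F(4)[OF measurable_space[OF f], simplified] sf_kernel_sets[OF K measurable_space[OF f]]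
        measurable_compose[OF f sf_kernel_emeasure[OF K]])
qed

lemma sf_kernel_const:
  assumes "sigma_finite_measure Z'" "sets Z' = sets Z" shows "sf_kernel M Z (\<lambda>x. Z')"
proof -
  obtain F :: "nat \<Rightarrow> _" where F: "range F \<subseteq> sets Z'" "(\<Union>i. F i) = space Z'"
      "\<And>i. emeasure Z' (F i) \<noteq> \<infinity>" "incseq F"
    by (rule sigma_finite_measure.sigma_finite_incseq[OF assms(1)]) (rule that)
  show ?thesis
  proof (rule sf_kernelI[where F=F])
    show "F i \<in> sets Z" for i using F(1) assms(2) by blast
    show "(\<Union>i. F i) = space Z" using F(2) sets_eq_imp_space_eq[OF assms(2)] by simp
  qed (use F(3,4) in \<open>simp_all add: assms(2) less_top\<close>)
qed

lemma nn_integral_incseq_exhaust: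
  assumes "incseq F" "\<And>i. F i \<in> sets M" "(\<Union>i::nat. F i) = space M" "f \<in> borel_measurable M"
  shows "(\<integral>\<^sup>+x. f x \<partial>M) = (SUP i. \<integral>\<^sup>+x. f x * indicator (F i) x \<partial>M)"
proof -
  have "(\<integral>\<^sup>+x. f x \<partial>M) = (\<integral>\<^sup>+x. (SUP i. f x * indicator (F i) x) \<partial>M)"
  proof (rule nn_integral_cong)
    fix x assume "x \<in> space M"
    then obtain i where "x \<in> F i" using assms(3) by blast
    then show "f x = (SUP i. f x * indicator (F i) x)"
      by (intro antisym SUP_least SUP_upper2[of i]) (auto split: split_indicator)
  qed
  also have "\<dots> = (SUP i. \<integral>\<^sup>+x. f x * indicator (F i) x \<partial>M)"
    using assms by (intro nn_integral_monotone_convergence_SUP)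
      (auto simp: incseq_def le_fun_def split: split_indicator)
  finally show ?thesis .
qed

lemma measurable_Pair_section:
  "f \<in> measurable (M \<Otimes>\<^sub>M Z) N \<Longrightarrow> x \<in> space M \<Longrightarrow> sets Z' = sets Z \<Longrightarrow> (\<lambda>z. f (x, z)) \<in> measurable Z' N"
  by (simp cong: measurable_cong_sets)

text \<open>Restricting to the exhausting sets and normalising reduces this to subprobability kernels.\<close>

lemma measurable_nn_integral_sf_kernel:
  assumes K: "sf_kernel M Z K" and f [measurable]: "f \<in> borel_measurable (M \<Otimes>\<^sub>M Z)"
  shows "(\<lambda>x. \<integral>\<^sup>+z. f (x, z) \<partial>K x) \<in> borel_measurable M"
\<comment> \<open>A subprobability space is nonempty by definition, so the empty space is treated
  apart.\<close>
proof (cases "space Z = {}")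
  case True
  then have "(\<integral>\<^sup>+z. f (x, z) \<partial>K x) = 0" if "x \<in> space M" for x
    using sf_kernel_space[OF K that] by (intro nn_integral_empty) simp
  then show ?thesis by (subst measurable_cong[where g="\<lambda>_. 0"]) auto
next
  case ne: False
  obtain F :: "nat \<Rightarrow> _" where F: "incseq F" "\<And>i. F i \<in> sets Z" "(\<Union>i. F i) = space Z"
    "\<And>i x. x \<in> space M \<Longrightarrow> emeasure (K x) (F i) < \<infinity>" by (rule sf_kernelE[OF K]) (rule that)
  note [measurable] = F(2) sf_kernel_emeasure[OF K]
  \<comment> \<open>The summand 1 keeps the divisor away from 0, so that multiplying by
    \<open>c i x\<close> undoes the division for every x, while the mass of \<open>Q i x\<close>
    stays at most 1.\<close>
  define c where "c i x = 1 + emeasure (K x) (F i)" for i x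
  define Q where "Q i x = density (K x) (\<lambda>z. indicator (F i) z / c i x)" for i x
  have c: "c i x \<noteq> 0" "c i x \<noteq> \<top>" if "x \<in> space M" for i x
    using F(4)[OF that, of i] by (auto simp: c_def)
  have [measurable]: "c i \<in> borel_measurable M" for i unfolding c_def by measurable
  have sK: "sets (K x) = sets Z" "space (K x) = space Z" if "x \<in> space M" for x
    using sf_kernel_sets[OF K that] sf_kernel_space[OF K that] by auto
  have intQ: "(\<integral>\<^sup>+z. g z \<partial>Q i x) = (\<integral>\<^sup>+z. g z * indicator (F i) z \<partial>K x) / c i x"
    if "x \<in> space M" "g \<in> borel_measurable Z" for g i x
  proof -
    have [measurable]: "g \<in> borel_measurable (K x)" "F i \<in> sets (K x)"
      using that sK[OF that(1)] F(2) by (auto cong: measurable_cong_sets)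
    have "(\<integral>\<^sup>+z. g z \<partial>Q i x) = (\<integral>\<^sup>+z. (g z * indicator (F i) z) / c i x \<partial>K x)"
      unfolding Q_def by (subst nn_integral_density) (auto simp: ennreal_times_divide mult.commute)
    also have "\<dots> = (\<integral>\<^sup>+z. g z * indicator (F i) z \<partial>K x) / c i x"
      by (rule nn_integral_divide) measurable
    finally show ?thesis .
  qed
  have emQ: "emeasure (Q i x) A = emeasure (K x) (A \<inter> F i) / c i x" if "x \<in> space M" "A \<in> sets Z" for i x A
  proof -
    have "emeasure (Q i x) A = (\<integral>\<^sup>+z. indicator A z \<partial>Q i x)"
      using that sK[OF that(1)] by (subst nn_integral_indicator) (auto simp: Q_def)
    also have "\<dots> = (\<integral>\<^sup>+z. indicator (A \<inter> F i) z \<partial>K x) / c i x"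
      using that by (subst intQ) (auto simp: indicator_inter_arith[symmetric])
    also have "\<dots> = emeasure (K x) (A \<inter> F i) / c i x"
      using that sK[OF that(1)] F(2) by (subst nn_integral_indicator) auto
    finally show ?thesis .
  qed
  have Q [measurable]: "Q i \<in> measurable M (subprob_algebra Z)" for i
  proof (rule measurable_subprob_algebra)
    fix x assume x: "x \<in> space M"
    show sQ: "sets (Q i x) = sets Z" using sK[OF x] by (simp add: Q_def)
    have "emeasure (Q i x) (space (Q i x)) = emeasure (K x) (F i) / c i x"
      using emQ[OF x, of "space Z"] sets_eq_imp_space_eq[OF sQ] sets.sets_into_space[OF F(2)]
      by (simp add: Int_absorb1)
    also have "\<dots> \<le> 1"
      by (rule divide_le_posI_ennreal) (auto simp: c_def add_pos_nonneg)
    finally have "emeasure (Q i x) (space (Q i x)) \<le> 1" .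
    then show "subprob_space (Q i x)"
      using ne sets_eq_imp_space_eq[OF sQ] by (intro subprob_spaceI) auto
  next
    fix A assume A [measurable]: "A \<in> sets Z"
    show "(\<lambda>x. emeasure (Q i x) A) \<in> borel_measurable M"
      by (subst measurable_cong[OF emQ]) auto
  qed
  have [measurable]: "(\<lambda>x. \<integral>\<^sup>+z. f (x, z) \<partial>Q i x) \<in> borel_measurable M" for i
    by (rule nn_integral_measurable_subprob_algebra2[OF _ Q]) simp
  have "(\<lambda>x. SUP i. c i x * (\<integral>\<^sup>+z. f (x, z) \<partial>Q i x)) \<in> borel_measurable M"
    by measurable
  also have "?this \<longleftrightarrow> ?thesis"
  proof (rule measurable_cong)
    fix x assume x: "x \<in> space M"
    have [measurable]: "(\<lambda>z. f (x, z)) \<in> borel_measurable Z" using x by measurable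
    have "c i x * (\<integral>\<^sup>+z. f (x, z) \<partial>Q i x) = (\<integral>\<^sup>+z. f (x, z) * indicator (F i) z \<partial>K x)" for i
    proof -
      let ?a = "\<integral>\<^sup>+z. f (x, z) * indicator (F i) z \<partial>K x"
      have "c i x * (\<integral>\<^sup>+z. f (x, z) \<partial>Q i x) = c i x * (?a / c i x)"
        by (subst intQ[OF x]) auto
      also have "\<dots> = ?a * c i x / c i x"
        by (simp only: ennreal_times_divide mult.commute)
      also have "\<dots> = ?a" by (rule ennreal_mult_divide_eq[OF c[OF x]])
      finally show ?thesis .
    qed
    moreover have "(\<integral>\<^sup>+z. f (x, z) \<partial>K x) = (SUP i. \<integral>\<^sup>+z. f (x, z) * indicator (F i) z \<partial>K x)"
      using measurable_Pair_section[OF f x sK(1)[OF x]]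
      by (intro nn_integral_incseq_exhaust) (simp_all add: F(1-3) sK[OF x])
    ultimately show "(SUP i. c i x * (\<integral>\<^sup>+z. f (x, z) \<partial>Q i x)) = (\<integral>\<^sup>+z. f (x, z) \<partial>K x)"
      by simp
  qed
  finally show ?thesis .
qed


section \<open>Integration against a semidirect product\<close>

lemma space_semidirect: "space (semidirect M Z K) = space M \<times> space Z"
  using sets.space_closed[of "M \<Otimes>\<^sub>M Z"]
  unfolding semidirect_def space_pair_measure[symmetric] by (rule space_measure_of)

lemma sets_semidirect [simp, measurable_cong]: "sets (semidirect M Z K) = sets (M \<Otimes>\<^sub>M Z)"
  unfolding semidirect_def space_pair_measure[symmetric] by (rule sets.sets_measure_of_eq)

text \<open>\<open>measure_of\<close> yields the null measure when its set function is not countably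
  additive, so the defining formula has to be earned. Additivity passes through the outer integral
  because the mass of a section is measurable in x, which is where the kernel property
  enters.\<close>

lemma emeasure_semidirect:
  assumes K: "sf_kernel M Z K" and A: "A \<in> sets (M \<Otimes>\<^sub>M Z)"
  shows "emeasure (semidirect M Z K) A = (\<integral>\<^sup>+x. emeasure (K x) (Pair x -` A) \<partial>M)"
proof (rule emeasure_measure_of[OF semidirect_def])
  have sec: "Pair x -` B \<in> sets (K x)" if "x \<in> space M" "B \<in> sets (M \<Otimes>\<^sub>M Z)" for x B
    using sets_Pair1[OF that(2)] sf_kernel_sets[OF K that(1)] by simp
  have meas: "(\<lambda>x. emeasure (K x) (Pair x -` B)) \<in> borel_measurable M" if B: "B \<in> sets (M \<Otimes>\<^sub>M Z)" for B
  proof -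
    have "(\<lambda>x. \<integral>\<^sup>+z. indicator B (x, z) \<partial>K x) \<in> borel_measurable M"
      by (rule measurable_nn_integral_sf_kernel[OF K]) (use B in simp)
    also have "?this \<longleftrightarrow> ?thesis"
    proof (rule measurable_cong)
      fix x assume x: "x \<in> space M"
      have "(\<integral>\<^sup>+z. indicator B (x, z) \<partial>K x) = (\<integral>\<^sup>+z. indicator (Pair x -` B) z \<partial>K x)"
        by (rule nn_integral_cong) (simp split: split_indicator)
      then show "(\<integral>\<^sup>+z. indicator B (x, z) \<partial>K x) = emeasure (K x) (Pair x -` B)"
        by (simp add: nn_integral_indicator[OF sec[OF x B]])
    qed
    finally show ?thesis .
  qed
  show "sets (M \<Otimes>\<^sub>M Z) \<subseteq> Pow (space M \<times> space Z)"
    using sets.space_closed[of "M \<Otimes>\<^sub>M Z"] by (simp add: space_pair_measure)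
  show "A \<in> sets (semidirect M Z K)" using A by simp
  show "positive (sets (semidirect M Z K)) (\<lambda>A. \<integral>\<^sup>+x. emeasure (K x) (Pair x -` A) \<partial>M)"
    by (simp add: positive_def)
  show "countably_additive (sets (semidirect M Z K)) (\<lambda>A. \<integral>\<^sup>+x. emeasure (K x) (Pair x -` A) \<partial>M)"
  proof (rule countably_additiveI)
    fix B :: "nat \<Rightarrow> _" assume B: "range B \<subseteq> sets (semidirect M Z K)" "disjoint_family B"
    then have B': "B i \<in> sets (M \<Otimes>\<^sub>M Z)" for i by auto
    have "(\<Sum>i. \<integral>\<^sup>+x. emeasure (K x) (Pair x -` B i) \<partial>M) = (\<integral>\<^sup>+x. (\<Sum>i. emeasure (K x) (Pair x -` B i)) \<partial>M)"
      by (rule nn_integral_suminf[symmetric]) (rule meas[OF B'])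
    also have "\<dots> = (\<integral>\<^sup>+x. emeasure (K x) (Pair x -` (\<Union>i. B i)) \<partial>M)"
    proof (rule nn_integral_cong)
      fix x assume x: "x \<in> space M"
      have "disjoint_family (\<lambda>i. Pair x -` B i)"
        using B(2) by (auto simp: disjoint_family_on_def)
      then show "(\<Sum>i. emeasure (K x) (Pair x -` B i)) = emeasure (K x) (Pair x -` (\<Union>i. B i))"
        unfolding vimage_UN by (intro suminf_emeasure) (auto intro: sec[OF x B'])
    qed
    finally show "(\<Sum>i. \<integral>\<^sup>+x. emeasure (K x) (Pair x -` B i) \<partial>M) = (\<integral>\<^sup>+x. emeasure (K x) (Pair x -` (\<Union>i. B i)) \<partial>M)" .
  qed
qed

lemma nn_integral_semidirect:
  assumes K: "sf_kernel M Z K" and f: "f \<in> borel_measurable (M \<Otimes>\<^sub>M Z)"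
  shows "(\<integral>\<^sup>+p. f p \<partial>semidirect M Z K) = (\<integral>\<^sup>+x. (\<integral>\<^sup>+z. f (x, z) \<partial>K x) \<partial>M)"
  using f
proof (induction rule: borel_measurable_induct)
  case (cong f g)
  have "(\<integral>\<^sup>+p. f p \<partial>semidirect M Z K) = (\<integral>\<^sup>+p. g p \<partial>semidirect M Z K)"
    using cong(3) by (intro nn_integral_cong) (simp add: space_semidirect space_pair_measure)
  moreover have "(\<integral>\<^sup>+x. (\<integral>\<^sup>+z. f (x, z) \<partial>K x) \<partial>M) = (\<integral>\<^sup>+x. (\<integral>\<^sup>+z. g (x, z) \<partial>K x) \<partial>M)"
    using cong(3) by (intro nn_integral_cong) (simp add: space_pair_measure sf_kernel_space[OF K])
  ultimately show ?case using cong.IH by simp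
next
  case (set A)
  have "(\<integral>\<^sup>+z. indicator A (x, z) \<partial>K x) = emeasure (K x) (Pair x -` A)" if "x \<in> space M" for x
  proof -
    have "(\<integral>\<^sup>+z. indicator A (x, z) \<partial>K x) = (\<integral>\<^sup>+z. indicator (Pair x -` A) z \<partial>K x)"
      by (rule nn_integral_cong) (simp split: split_indicator)
    also have "\<dots> = emeasure (K x) (Pair x -` A)"
      using sets_Pair1[OF set] sf_kernel_sets[OF K that] by (intro nn_integral_indicator) simp
    finally show ?thesis .
  qed
  then show ?case using set by (simp add: emeasure_semidirect[OF K set] cong: nn_integral_cong)
next
  case (mult u c)
  have [measurable]: "u \<in> borel_measurable (M \<Otimes>\<^sub>M Z)" by fact
  have "(\<integral>\<^sup>+x. (\<integral>\<^sup>+z. c * u (x, z) \<partial>K x) \<partial>M) = (\<integral>\<^sup>+x. c * (\<integral>\<^sup>+z. u (x, z) \<partial>K x) \<partial>M)"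
    by (intro nn_integral_cong nn_integral_cmult measurable_Pair_section[where f=u]) (auto simp: sf_kernel_sets[OF K])
  also have "\<dots> = c * (\<integral>\<^sup>+x. (\<integral>\<^sup>+z. u (x, z) \<partial>K x) \<partial>M)"
    by (intro nn_integral_cmult measurable_nn_integral_sf_kernel[OF K]) measurable
  finally show ?case using mult by (simp add: nn_integral_cmult)
next
  case (add u v)
  have [measurable]: "u \<in> borel_measurable (M \<Otimes>\<^sub>M Z)" "v \<in> borel_measurable (M \<Otimes>\<^sub>M Z)" by fact+
  have "(\<integral>\<^sup>+x. (\<integral>\<^sup>+z. v (x, z) + u (x, z) \<partial>K x) \<partial>M) = (\<integral>\<^sup>+x. (\<integral>\<^sup>+z. v (x, z) \<partial>K x) + (\<integral>\<^sup>+z. u (x, z) \<partial>K x) \<partial>M)"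
    by (intro nn_integral_cong nn_integral_add measurable_Pair_section[where f=u] measurable_Pair_section[where f=v]) (auto simp: sf_kernel_sets[OF K])
  also have "\<dots> = (\<integral>\<^sup>+x. (\<integral>\<^sup>+z. v (x, z) \<partial>K x) \<partial>M) + (\<integral>\<^sup>+x. (\<integral>\<^sup>+z. u (x, z) \<partial>K x) \<partial>M)"
    by (intro nn_integral_add measurable_nn_integral_sf_kernel[OF K]) measurable
  finally show ?case using add by (simp add: nn_integral_add)
next
  case (seq U)
  note [measurable] = seq(1)
  have "(\<integral>\<^sup>+x. (\<integral>\<^sup>+z. (SUP i. U i (x, z)) \<partial>K x) \<partial>M) = (\<integral>\<^sup>+x. (SUP i. \<integral>\<^sup>+z. U i (x, z) \<partial>K x) \<partial>M)"
    using seq(3)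
    by (intro nn_integral_cong nn_integral_monotone_convergence_SUP measurable_Pair_section[where f="U _"])
      (auto simp: sf_kernel_sets[OF K] incseq_def le_fun_def)
  also have "\<dots> = (SUP i. \<integral>\<^sup>+x. (\<integral>\<^sup>+z. U i (x, z) \<partial>K x) \<partial>M)"
    using seq(3)
    by (intro nn_integral_monotone_convergence_SUP measurable_nn_integral_sf_kernel[OF K])
      (auto simp: incseq_def le_fun_def intro!: nn_integral_mono)
  moreover have "(\<integral>\<^sup>+p. (SUP i. U i p) \<partial>semidirect M Z K) = (SUP i. \<integral>\<^sup>+p. U i p \<partial>semidirect M Z K)"
    using seq(3) by (intro nn_integral_monotone_convergence_SUP) auto
  ultimately show ?case using seq(4) seq.IH by (simp add: image_comp)
qed

lemma measurable_integral_sf_kernel: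
  fixes f :: "_ \<Rightarrow> real"
  assumes K: "sf_kernel M Z K" and f [measurable]: "f \<in> borel_measurable (M \<Otimes>\<^sub>M Z)"
  shows "(\<lambda>x. \<integral>z. f (x, z) \<partial>K x) \<in> borel_measurable M"
proof -
  note [measurable] = measurable_nn_integral_sf_kernel[OF K]
  \<comment> \<open>The else branch is the value 0 that the Bochner integral takes at sections that
    are not integrable, so the two functions agree at every x and not only almost
    everywhere.\<close>
  have "(\<lambda>x. if (\<integral>\<^sup>+z. ennreal (norm (f (x, z))) \<partial>K x) < \<infinity> then
      enn2real (\<integral>\<^sup>+z. ennreal (f (x, z)) \<partial>K x) - enn2real (\<integral>\<^sup>+z. ennreal (- f (x, z)) \<partial>K x) else 0)
    \<in> borel_measurable M" (is "?g \<in> _")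
    by measurable
  also have "?this \<longleftrightarrow> ?thesis"
  proof (rule measurable_cong)
    fix x assume x: "x \<in> space M"
    have m: "(\<lambda>z. f (x, z)) \<in> borel_measurable (K x)"
      by (rule measurable_Pair_section[OF f x sf_kernel_sets[OF K x]])
    show "?g x = (\<integral>z. f (x, z) \<partial>K x)"
      using m by (auto simp: integrable_iff_bounded real_lebesgue_integral_def not_integrable_integral_eq)
  qed
  finally show ?thesis .
qed

lemma integral_semidirect:
  fixes f :: "_ \<Rightarrow> real"
  assumes K: "sf_kernel M Z K" and f: "integrable (semidirect M Z K) f"
  shows "AE x in M. integrable (K x) (\<lambda>z. f (x, z))"
    and "integrable M (\<lambda>x. \<integral>z. f (x, z) \<partial>K x)"
    and "(\<integral>p. f p \<partial>semidirect M Z K) = (\<integral>x. (\<integral>z. f (x, z) \<partial>K x) \<partial>M)"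
proof -
  have m [measurable]: "f \<in> borel_measurable (M \<Otimes>\<^sub>M Z)"
    using borel_measurable_integrable[OF f] by (simp cong: measurable_cong_sets)
  note [measurable] = measurable_nn_integral_sf_kernel[OF K] measurable_integral_sf_kernel[OF K]
  have mx: "(\<lambda>z. f (x, z)) \<in> borel_measurable (K x)" if "x \<in> space M" for x
    by (rule measurable_Pair_section[OF m that sf_kernel_sets[OF K that]])
  have fin: "(\<integral>\<^sup>+x. (\<integral>\<^sup>+z. ennreal (norm (f (x, z))) \<partial>K x) \<partial>M) < \<infinity>"
    using f by (subst nn_integral_semidirect[OF K, symmetric]) (auto simp: integrable_iff_bounded)
  have "AE x in M. (\<integral>\<^sup>+z. ennreal (norm (f (x, z))) \<partial>K x) \<noteq> \<infinity>"
    using fin by (intro nn_integral_PInf_AE) auto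
  then show ae: "AE x in M. integrable (K x) (\<lambda>z. f (x, z))"
  proof (rule AE_mp, intro AE_I2 impI)
    fix x assume "x \<in> space M" "(\<integral>\<^sup>+z. ennreal (norm (f (x, z))) \<partial>K x) \<noteq> \<infinity>"
    then show "integrable (K x) (\<lambda>z. f (x, z))"
      using mx by (simp add: integrable_iff_bounded less_top)
  qed
  show int: "integrable M (\<lambda>x. \<integral>z. f (x, z) \<partial>K x)"
  proof (rule integrableI_bounded)
    have "(\<integral>\<^sup>+x. ennreal (norm (\<integral>z. f (x, z) \<partial>K x)) \<partial>M) \<le> (\<integral>\<^sup>+x. (\<integral>\<^sup>+z. ennreal (norm (f (x, z))) \<partial>K x) \<partial>M)"
      using ae by (intro nn_integral_mono_AE) (auto elim!: eventually_mono dest: integral_norm_bound_ennreal)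
    then show "(\<integral>\<^sup>+x. ennreal (norm (\<integral>z. f (x, z) \<partial>K x)) \<partial>M) < \<infinity>" using fin by order
  qed measurable
  \<comment> \<open>The section integrals of the positive and of the negative part. Both are
    dominated by that of the norm, hence finite almost everywhere, so \<open>enn2real\<close> loses
    nothing under the outer integral.\<close>
  define u where "u x = (\<integral>\<^sup>+z. ennreal (f (x, z)) \<partial>K x)" for x
  define v where "v x = (\<integral>\<^sup>+z. ennreal (- f (x, z)) \<partial>K x)" for x
  have [measurable]: "u \<in> borel_measurable M" "v \<in> borel_measurable M"
    unfolding u_def v_def by measurable
  have uv: "(\<integral>\<^sup>+x. u x \<partial>M) < \<infinity>" "(\<integral>\<^sup>+x. v x \<partial>M) < \<infinity>"
    unfolding u_def v_def
    by (rule le_less_trans[OF _ fin], intro nn_integral_mono, simp add: ennreal_leI)+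
  have fu: "AE x in M. u x \<noteq> \<infinity>" "AE x in M. v x \<noteq> \<infinity>"
    using uv nn_integral_PInf_AE[of u M] nn_integral_PInf_AE[of v M] by auto
  have "(\<integral>\<^sup>+x. ennreal (enn2real (w x)) \<partial>M) = (\<integral>\<^sup>+x. w x \<partial>M)" if "AE x in M. w x \<noteq> \<infinity>" for w
    using that by (auto intro!: nn_integral_cong_AE elim!: eventually_mono simp: less_top)
  then have e: "(\<integral>\<^sup>+x. ennreal (enn2real (u x)) \<partial>M) = (\<integral>\<^sup>+x. u x \<partial>M)"
     "(\<integral>\<^sup>+x. ennreal (enn2real (v x)) \<partial>M) = (\<integral>\<^sup>+x. v x \<partial>M)"
    using fu by auto
  have i: "integrable M (\<lambda>x. enn2real (u x))" "integrable M (\<lambda>x. enn2real (v x))"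
    using uv e by (auto simp: integrable_iff_bounded)
  have "(\<integral>x. (\<integral>z. f (x, z) \<partial>K x) \<partial>M) = (\<integral>x. enn2real (u x) - enn2real (v x) \<partial>M)"
    using ae by (intro integral_cong_AE) (auto elim!: eventually_mono simp: u_def v_def real_lebesgue_integral_def)
  also have "\<dots> = enn2real (\<integral>\<^sup>+x. u x \<partial>M) - enn2real (\<integral>\<^sup>+x. v x \<partial>M)"
    using i by (simp add: integral_eq_nn_integral e)
  also have "\<dots> = (\<integral>p. f p \<partial>semidirect M Z K)"
    unfolding real_lebesgue_integral_def[OF f] u_def v_def
    by (subst (1 2) nn_integral_semidirect[OF K]) auto
  finally show "(\<integral>p. f p \<partial>semidirect M Z K) = (\<integral>x. (\<integral>z. f (x, z) \<partial>K x) \<partial>M)" ..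
qed

lemma sf_kernel_locally_finite:
  assumes "incseq F" "\<And>i. F i \<in> sets X" "(\<Union>i::nat. F i) = space X"
  shows "sf_kernel (locally_finite_measures X (range F)) X (\<lambda>m. m)"
  by (rule sf_kernelI[where F=F]) (auto simp: assms space_locally_finite_measures)

lemma UN_ball_UNIV: "(\<Union>k::nat. ball (x::'y::metric_space) (real k)) = UNIV"
proof (intro set_eqI iffI UNIV_I)
  fix y obtain k where "dist x y < real k" using reals_Archimedean2 by blast
  then show "y \<in> (\<Union>k::nat. ball x (real k))" by auto
qed

lemma incseq_ball: "incseq (\<lambda>k::nat. ball (x::'y::metric_space) (real k))"
  by (auto simp: incseq_def)

text \<open>A random measure, seen as the identity map, is itself a kernel: balls with integer radii
  about any fixed point are bounded and therefore have finite mass under all boundedly finite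
  measures simultaneously.\<close>

lemma sf_kernel_bf: "sf_kernel (bf_measures :: 'y::polish_space measure measure) borel (\<lambda>m. m)"
  by (rule sf_kernelI[where F="\<lambda>k. ball undefined (real k)"])
    (auto simp: space_bf_measures incseq_ball UN_ball_UNIV)

section \<open>Finite products of sigma-finite measures and kernels\<close>

text \<open>The locale \<open>product_sigma_finite\<close> constrains all components, also those outside the index set.\<close>

definition null_outside :: "'i set \<Rightarrow> ('i \<Rightarrow> 'a measure) \<Rightarrow> 'i \<Rightarrow> 'a measure" where
  "null_outside I M i = (if i \<in> I then M i else null_measure (M i))"

lemma product_sigma_finite_null_outside:
  "(\<And>i. i \<in> I \<Longrightarrow> sigma_finite_measure (M i)) \<Longrightarrow> product_sigma_finite (null_outside I M)"
  unfolding product_sigma_finite_def null_outside_def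
  by (auto intro!: finite_measure.sigma_finite_measure finite_measureI)

lemma PiM_null_outside: "J \<subseteq> I \<Longrightarrow> PiM J (null_outside I M) = PiM J M"
  by (rule PiM_cong) (auto simp: null_outside_def)

lemma emeasure_PiM_PiE:
  assumes "finite I" "\<And>i. i \<in> I \<Longrightarrow> sigma_finite_measure (M i)" "\<And>i. i \<in> I \<Longrightarrow> A i \<in> sets (M i)"
  shows "emeasure (PiM I M) (Pi\<^sub>E I A) = (\<Prod>i\<in>I. emeasure (M i) (A i))"
proof -
  interpret product_sigma_finite "null_outside I M" by (rule product_sigma_finite_null_outside) fact
  have "emeasure (PiM I (null_outside I M)) (Pi\<^sub>E I A) = (\<Prod>i\<in>I. emeasure (null_outside I M i) (A i))"
    using assms by (intro emeasure_PiM) (auto simp: null_outside_def)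
  then show ?thesis by (simp add: PiM_null_outside) (simp add: null_outside_def)
qed

lemma sigma_finite_PiM_finite:
  assumes "finite I" "\<And>i. i \<in> I \<Longrightarrow> sigma_finite_measure (M i)"
  shows "sigma_finite_measure (PiM I M)"
proof -
  interpret product_sigma_finite "null_outside I M" by (rule product_sigma_finite_null_outside) fact
  show ?thesis using sigma_finite[OF assms(1)] by (simp add: PiM_null_outside)
qed

lemma nn_integral_PiM_insert:
  assumes "finite I" "i \<notin> I" "\<And>j. j \<in> insert i I \<Longrightarrow> sigma_finite_measure (M j)"
    and f: "f \<in> borel_measurable (PiM (insert i I) M)"
  shows "(\<integral>\<^sup>+x. f x \<partial>PiM (insert i I) M) = (\<integral>\<^sup>+x. (\<integral>\<^sup>+y. f (x(i := y)) \<partial>M i) \<partial>PiM I M)"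
proof -
  interpret product_sigma_finite "null_outside (insert i I) M"
    by (rule product_sigma_finite_null_outside) (rule assms(3))
  have "(\<integral>\<^sup>+x. f x \<partial>PiM (insert i I) (null_outside (insert i I) M))
      = (\<integral>\<^sup>+x. (\<integral>\<^sup>+y. f (x(i := y)) \<partial>null_outside (insert i I) M i) \<partial>PiM I (null_outside (insert i I) M))"
    using f by (intro product_nn_integral_insert assms) (simp add: PiM_null_outside)
  then show ?thesis by (simp add: PiM_null_outside subset_insertI) (simp add: null_outside_def)
qed

text \<open>Products of the individual exhausting sets exhaust the product space. Measurability in
  the parameter follows by integrating out one coordinate at a time.\<close>

lemma sf_kernel_PiM:
  assumes "finite I" "\<And>i. i \<in> I \<Longrightarrow> sf_kernel M (Z i) (K i)"
  shows "sf_kernel M (PiM I Z) (\<lambda>x. PiM I (\<lambda>i. K i x))"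
proof -
  have "\<forall>i\<in>I. \<exists>F::nat \<Rightarrow> _. incseq F \<and> (\<forall>n. F n \<in> sets (Z i)) \<and> (\<Union>n. F n) = space (Z i) \<and>
    (\<forall>n. \<forall>x\<in>space M. emeasure (K i x) (F n) < \<infinity>)"
  proof
    fix i assume "i \<in> I"
    obtain F :: "nat \<Rightarrow> _" where F: "incseq F" "\<And>n. F n \<in> sets (Z i)" "(\<Union>n. F n) = space (Z i)"
      "\<And>n x. x \<in> space M \<Longrightarrow> emeasure (K i x) (F n) < \<infinity>"
      by (rule sf_kernelE[OF assms(2)[OF \<open>i \<in> I\<close>]]) (rule that)
    then show "\<exists>F::nat \<Rightarrow> _. incseq F \<and> (\<forall>n. F n \<in> sets (Z i)) \<and> (\<Union>n. F n) = space (Z i) \<and>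
      (\<forall>n. \<forall>x\<in>space M. emeasure (K i x) (F n) < \<infinity>)" by (intro exI[of _ F]) simp
  qed
  then obtain F :: "_ \<Rightarrow> nat \<Rightarrow> _" where "\<forall>i\<in>I. incseq (F i) \<and> (\<forall>n. F i n \<in> sets (Z i)) \<and>
    (\<Union>n. F i n) = space (Z i) \<and> (\<forall>n. \<forall>x\<in>space M. emeasure (K i x) (F i n) < \<infinity>)"
    unfolding bchoice_iff ..
  then have F: "incseq (F i)" "F i n \<in> sets (Z i)" "(\<Union>n. F i n) = space (Z i)"
    "x \<in> space M \<Longrightarrow> emeasure (K i x) (F i n) < \<infinity>" if "i \<in> I" for i n x
    using that by auto
  have sPi: "sets (PiM J (\<lambda>i. K i x)) = sets (PiM J Z)" if "x \<in> space M" "J \<subseteq> I" for x J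
    using that sf_kernel_sets[OF assms(2)] by (intro sets_PiM_cong) auto
  show ?thesis
  proof (rule sf_kernelI[where F="\<lambda>n. Pi\<^sub>E I (\<lambda>i. F i n)"])
    show "incseq (\<lambda>n. Pi\<^sub>E I (\<lambda>i. F i n))"
      using F(1) unfolding incseq_def by (intro allI impI PiE_mono) blast
    show "Pi\<^sub>E I (\<lambda>i. F i n) \<in> sets (PiM I Z)" for n
      using F(2) assms(1) by (intro sets_PiM_I_finite) auto
    show "(\<Union>n. Pi\<^sub>E I (\<lambda>i. F i n)) = space (PiM I Z)"
    proof (intro equalityI subsetI)
      fix x assume "x \<in> (\<Union>n. Pi\<^sub>E I (\<lambda>i. F i n))"
      then show "x \<in> space (PiM I Z)"
        using sets.sets_into_space[OF F(2)] by (fastforce simp: space_PiM PiE_iff)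
    next
      fix x assume x: "x \<in> space (PiM I Z)"
      then have "\<forall>i\<in>I. \<exists>n. x i \<in> F i n" using F(3)[symmetric] by (auto simp: space_PiM PiE_iff)
      then obtain n where n: "\<And>i. i \<in> I \<Longrightarrow> x i \<in> F i (n i)" by metis
      \<comment> \<open>The sequences increase and there are finitely many coordinates, so the
        largest of the individual indices serves all of them.\<close>
      have "x i \<in> F i (Max (n ` I))" if "i \<in> I" for i
        using n[OF that] incseqD[OF F(1)[OF that], of "n i" "Max (n ` I)"] that assms(1) by auto
      then show "x \<in> (\<Union>n. Pi\<^sub>E I (\<lambda>i. F i n))" using x by (auto simp: space_PiM PiE_iff)
    qed
    show "sets (PiM I (\<lambda>i. K i x)) = sets (PiM I Z)" if "x \<in> space M" for x using sPi that by blast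
    show "emeasure (PiM I (\<lambda>i. K i x)) (Pi\<^sub>E I (\<lambda>i. F i n)) < \<infinity>" if x: "x \<in> space M" for n x
    proof -
      have "emeasure (PiM I (\<lambda>i. K i x)) (Pi\<^sub>E I (\<lambda>i. F i n)) = (\<Prod>i\<in>I. emeasure (K i x) (F i n))"
        using assms(1) sf_kernel_sigma_finite[OF assms(2) x] sf_kernel_sets[OF assms(2) x] F(2)
        by (intro emeasure_PiM_PiE) auto
      then show ?thesis using F(4)[OF _ x] by (simp add: ennreal_prod_eq_top less_top[symmetric])
    qed
    fix A assume A: "A \<in> sets (PiM I Z)"
    \<comment> \<open>The integrand has to depend on x as well: integrating one coordinate against
      \<open>K i x\<close> leaves a function of x and the remaining coordinates, and this is what
      the induction hypothesis must accept.\<close>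
    have "(\<lambda>x. \<integral>\<^sup>+z. f (x, z) \<partial>PiM J (\<lambda>i. K i x)) \<in> borel_measurable M"
      if "J \<subseteq> I" "f \<in> borel_measurable (M \<Otimes>\<^sub>M PiM J Z)" for J and f
      using finite_subset[OF that(1) assms(1)] that
    proof (induction J arbitrary: f rule: finite_induct)
      case empty
      then have [measurable]: "f \<in> borel_measurable (M \<Otimes>\<^sub>M PiM {} Z)" by simp
      have "(\<lambda>x. f (x, \<lambda>i. undefined)) \<in> borel_measurable M"
        by (rule measurable_compose[OF _ empty(2)]) (auto simp: space_PiM intro!: measurable_Pair)
      then show ?case by (simp add: PiM_empty nn_integral_count_space_finite)
    next
      case (insert i J)
      note [measurable] = insert.prems(2)
      have i: "sf_kernel M (Z i) (K i)" using insert.prems assms(2) by blast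
      have upd: "(\<lambda>p. (fst (fst p), (snd (fst p))(i := snd p)))
          \<in> measurable ((M \<Otimes>\<^sub>M PiM J Z) \<Otimes>\<^sub>M Z i) (M \<Otimes>\<^sub>M PiM (insert i J) Z)"
        by (intro measurable_Pair measurable_fun_upd[where J=J]) auto
      have "(\<lambda>q. \<integral>\<^sup>+y. f (fst q, (snd q)(i := y)) \<partial>K i (fst q)) \<in> borel_measurable (M \<Otimes>\<^sub>M PiM J Z)"
        using measurable_nn_integral_sf_kernel[OF sf_kernel_comp[OF i measurable_fst]
           measurable_compose[OF upd insert.prems(2)]] by simp
      from insert.IH[OF _ this]
      have "(\<lambda>x. \<integral>\<^sup>+z. (\<integral>\<^sup>+y. f (x, z(i := y)) \<partial>K i x) \<partial>PiM J (\<lambda>i. K i x)) \<in> borel_measurable M"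
        using insert.prems by simp
      also have "?this \<longleftrightarrow> ?case"
      proof (rule measurable_cong)
        fix x assume x: "x \<in> space M"
        have "(\<lambda>z. f (x, z)) \<in> borel_measurable (PiM (insert i J) (\<lambda>i. K i x))"
          by (rule measurable_Pair_section[OF insert.prems(2) x sPi[OF x insert.prems(1)]])
        then show "(\<integral>\<^sup>+z. (\<integral>\<^sup>+y. f (x, z(i := y)) \<partial>K i x) \<partial>PiM J (\<lambda>i. K i x))
            = (\<integral>\<^sup>+z. f (x, z) \<partial>PiM (insert i J) (\<lambda>i. K i x))"
          using insert.hyps insert.prems(1) sf_kernel_sigma_finite[OF assms(2) x]
          by (intro nn_integral_PiM_insert[symmetric]) auto
      qed
      finally show ?case .
    qed
    from this[of I "\<lambda>p. indicator A (snd p)"] A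
    have "(\<lambda>x. \<integral>\<^sup>+z. indicator A z \<partial>PiM I (\<lambda>i. K i x)) \<in> borel_measurable M" by simp
    also have "?this \<longleftrightarrow> (\<lambda>x. emeasure (PiM I (\<lambda>i. K i x)) A) \<in> borel_measurable M"
      using A by (intro measurable_cong nn_integral_indicator) (simp add: sPi)
    finally show "(\<lambda>x. emeasure (PiM I (\<lambda>i. K i x)) A) \<in> borel_measurable M" .
  qed
qed

text \<open>A cylinder over a null set is null: one zero factor annihilates the product even if
  other factors are infinite.\<close>

lemma AE_PiM_coordinate:
  assumes "finite I" "\<And>i. i \<in> I \<Longrightarrow> sigma_finite_measure (M i)" "i \<in> I" "AE y in M i. Q y"
  shows "AE x in PiM I M. Q (x i)"
proof -
  obtain A where A: "A \<in> sets (M i)" "emeasure (M i) A = 0" "{y \<in> space (M i). \<not> Q y} \<subseteq> A"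
    using assms(4) by (auto elim!: AE_E)
  define B where "B j = (if j = i then A else space (M j))" for j
  have "emeasure (PiM I M) (Pi\<^sub>E I B) = (\<Prod>j\<in>I. emeasure (M j) (B j))"
    using assms A by (intro emeasure_PiM_PiE) (auto simp: B_def)
  also have "\<dots> = 0" using assms(1,3) A(2) by (intro prod_zero) (auto simp: B_def)
  finally have "emeasure (PiM I M) (Pi\<^sub>E I B) = 0" .
  moreover have "Pi\<^sub>E I B \<in> sets (PiM I M)"
    using A(1) assms(1) by (intro sets_PiM_I_finite) (auto simp: B_def)
  moreover have "{x \<in> space (PiM I M). \<not> Q (x i)} \<subseteq> Pi\<^sub>E I B"
    using A(3) assms(3) by (auto simp: B_def space_PiM PiE_iff extensional_def)
  ultimately show ?thesis by (intro AE_I[where N="Pi\<^sub>E I B"])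
qed

text \<open>Coordinate i is integrated first. With the other coordinates fixed, the diagonal leaves
  it only the single value \<open>x j\<close>, and points are null under \<open>M i\<close>.\<close>

lemma AE_PiM_coordinates_neq:
  fixes M :: "'i \<Rightarrow> 'y::polish_space measure"
  assumes "finite I" "\<And>i. i \<in> I \<Longrightarrow> sigma_finite_measure (M i)" "\<And>i. i \<in> I \<Longrightarrow> sets (M i) = sets borel"
    and "i \<in> I" "j \<in> I" "i \<noteq> j" "\<And>y. emeasure (M i) {y} = 0"
  shows "AE x in PiM I M. x i \<noteq> x j"
proof -
  have c [measurable]: "(\<lambda>x. x l) \<in> borel_measurable (PiM I M)" if "l \<in> I" for l
    using measurable_component_singleton[OF that, of M]
    by (simp add: measurable_cong_sets[OF refl assms(3)[OF that]])
  have S [measurable]: "Measurable.pred (PiM I M) (\<lambda>x. x i = x j)"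
    unfolding pred_def by (intro measurable_equality_set c assms)
  define I' where "I' = I - {i}"
  have I': "insert i I' = I" "finite I'" "i \<notin> I'" using assms(1,4) by (auto simp: I'_def)
  have "(\<integral>\<^sup>+x. indicator {x\<in>space (PiM I M). x i = x j} x \<partial>PiM I M)
      = (\<integral>\<^sup>+x. (\<integral>\<^sup>+y. indicator {x\<in>space (PiM I M). x i = x j} (x(i := y)) \<partial>M i) \<partial>PiM I' M)"
    using nn_integral_PiM_insert[of I' i M "indicator {x\<in>space (PiM I M). x i = x j}"] I' assms(2)
    by simp
  also have "\<dots> \<le> (\<integral>\<^sup>+x. (\<integral>\<^sup>+y. indicator {x j} y \<partial>M i) \<partial>PiM I' M)"
    using assms(6) by (intro nn_integral_mono) (auto split: split_indicator)
  also have "\<dots> = 0" using assms by simp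
  finally have "emeasure (PiM I M) {x\<in>space (PiM I M). x i = x j} = 0" by simp
  then show ?thesis by (intro AE_I[where N="{x\<in>space (PiM I M). x i = x j}"]) auto
qed


lemma pair_sigma_finiteI: "sigma_finite_measure A \<Longrightarrow> sigma_finite_measure B \<Longrightarrow> pair_sigma_finite A B"
  by (simp add: pair_sigma_finite_def)

text \<open>If every \<open>\<nu> i\<close> draws a location from \<open>\<alpha> i\<close> and then
  a mark from \<open>K i\<close>, their product draws all locations first and then, given these,
  independent marks. This later turns the marked points of all blocks into locations with
  conditionally independent jumps.\<close>

lemma nn_integral_PiM_disintegrate:
  assumes "finite I"
    and \<alpha>: "\<And>i. i \<in> I \<Longrightarrow> sigma_finite_measure (\<alpha> i)" "\<And>i. i \<in> I \<Longrightarrow> sets (\<alpha> i) = sets Y"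
    and K: "\<And>i. i \<in> I \<Longrightarrow> sf_kernel Y Z (K i)"
    and \<nu>: "\<And>i. i \<in> I \<Longrightarrow> sigma_finite_measure (\<nu> i)" "\<And>i. i \<in> I \<Longrightarrow> sets (\<nu> i) = sets (Z \<Otimes>\<^sub>M Y)"
    and dis: "\<And>i f. i \<in> I \<Longrightarrow> f \<in> borel_measurable (Z \<Otimes>\<^sub>M Y) \<Longrightarrow>
      (\<integral>\<^sup>+x. f x \<partial>\<nu> i) = (\<integral>\<^sup>+a. (\<integral>\<^sup>+s. f (s, a) \<partial>K i a) \<partial>\<alpha> i)"
    and f: "f \<in> borel_measurable (PiM I (\<lambda>_. Z) \<Otimes>\<^sub>M PiM I (\<lambda>_. Y))"
  shows "(\<integral>\<^sup>+x. f (\<lambda>i\<in>I. fst (x i), \<lambda>i\<in>I. snd (x i)) \<partial>PiM I \<nu>)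
    = (\<integral>\<^sup>+y. (\<integral>\<^sup>+J. f (J, y) \<partial>PiM I (\<lambda>i. K i (y i))) \<partial>PiM I \<alpha>)"
  using assms
proof (induction I arbitrary: f rule: finite_induct)
  case empty
  then show ?case
    by (simp add: PiM_empty nn_integral_count_space_finite restrict_def)
next
  case (insert i I)
  note \<alpha> = insert.prems(1,2) and K = insert.prems(3) and \<nu> = insert.prems(4,5)
    and dis = insert.prems(6) and f = insert.prems(7)
  note [measurable] = f
  define S where "S J = PiM J (\<lambda>_. Z)" for J :: "'a set"
  define T where "T J = PiM J (\<lambda>_. Y)" for J :: "'a set"
  define f1 where "f1 J y s a = f (J(i := s), y(i := a))" for J y s a
  have [measurable]: "f \<in> borel_measurable (S (insert i I) \<Otimes>\<^sub>M T (insert i I))"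
    using f unfolding S_def T_def .
  have upd: "(\<lambda>p. (a p)(i := b p)) \<in> measurable Q (S (insert i I))"
    if "a \<in> measurable Q (S I)" "b \<in> measurable Q Z" for a b and Q :: "'q measure"
    using that unfolding S_def by (intro measurable_fun_upd[where J=I]) auto
  have updT: "(\<lambda>p. (a p)(i := b p)) \<in> measurable Q (T (insert i I))"
    if "a \<in> measurable Q (T I)" "b \<in> measurable Q Y" for a b and Q :: "'q measure"
    using that unfolding T_def by (intro measurable_fun_upd[where J=I]) auto
  have f1: "(\<lambda>p. f1 (a p) (b p) (c p) (d p)) \<in> borel_measurable Q"
    if "a \<in> measurable Q (S I)" "b \<in> measurable Q (T I)" "c \<in> measurable Q Z" "d \<in> measurable Q Y"
    for a b c d and Q :: "'q measure"
    unfolding f1_def by (intro measurable_compose[OF _ f] measurable_Pair)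
      (use upd[OF that(1,3)] updT[OF that(2,4)] in \<open>simp_all add: S_def T_def\<close>)
  define g where "g p = (\<integral>\<^sup>+a. (\<integral>\<^sup>+s. f1 (fst p) (snd p) s a \<partial>K i a) \<partial>\<alpha> i)" for p
  have Ki: "sf_kernel Y Z (K i)" using K by simp
  have ai: "sf_kernel Q Y (\<lambda>_. \<alpha> i)" for Q :: "'q measure"
    using \<alpha> by (intro sf_kernel_const) auto
  have inner: "(\<lambda>q. \<integral>\<^sup>+s. f1 (a q) (b q) s (c q) \<partial>K i (c q)) \<in> borel_measurable Q"
    if [measurable]: "a \<in> measurable Q (S I)" "b \<in> measurable Q (T I)" "c \<in> measurable Q Y"
    for a b c and Q :: "'q measure"
  proof -
    have "(\<lambda>(q, s). f1 (a q) (b q) s (c q)) \<in> borel_measurable (Q \<Otimes>\<^sub>M Z)"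
      unfolding case_prod_beta by (rule f1) measurable
    from measurable_nn_integral_sf_kernel[OF sf_kernel_comp[OF Ki that(3)] this]
    show ?thesis by simp
  qed
  have g: "g \<in> borel_measurable (PiM I (\<lambda>_. Z) \<Otimes>\<^sub>M PiM I (\<lambda>_. Y))"
  proof -
    have "(\<lambda>(p, a). \<integral>\<^sup>+s. f1 (fst p) (snd p) s a \<partial>K i a) \<in> borel_measurable ((S I \<Otimes>\<^sub>M T I) \<Otimes>\<^sub>M Y)"
      unfolding case_prod_beta by (rule inner) measurable
    from measurable_nn_integral_sf_kernel[OF ai this]
    show ?thesis unfolding g_def S_def T_def by simp
  qed
  have sI: "sets (PiM J \<nu>) = sets (PiM J (\<lambda>_. Z \<Otimes>\<^sub>M Y))" "sets (PiM J \<alpha>) = sets (T J)" if "J \<subseteq> insert i I" for J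
    unfolding T_def using that \<nu> \<alpha> by (auto intro!: sets_PiM_cong)
  have KJ: "sf_kernel (T J) (S J) (\<lambda>y. PiM J (\<lambda>i. K i (y i)))" if "J \<subseteq> insert i I" for J
    unfolding S_def
  proof (rule sf_kernel_PiM)
    show "finite J" using that insert.hyps finite_subset by blast
    show "sf_kernel (T J) Z (\<lambda>y. K j (y j))" if "j \<in> J" for j
      using that \<open>J \<subseteq> insert i I\<close> unfolding T_def
      by (intro sf_kernel_comp[OF K, where f="\<lambda>y. y j"] measurable_component_singleton) auto
  qed
  have "(\<integral>\<^sup>+x. f (\<lambda>i\<in>insert i I. fst (x i), \<lambda>i\<in>insert i I. snd (x i)) \<partial>PiM (insert i I) \<nu>)
    = (\<integral>\<^sup>+x. (\<integral>\<^sup>+z. f (\<lambda>j\<in>insert i I. fst ((x(i := z)) j), \<lambda>j\<in>insert i I. snd ((x(i := z)) j)) \<partial>\<nu> i) \<partial>PiM I \<nu>)"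
  proof (rule nn_integral_PiM_insert)
    have "(\<lambda>x. f (\<lambda>j\<in>insert i I. fst (x j), \<lambda>j\<in>insert i I. snd (x j)))
        \<in> borel_measurable (PiM (insert i I) (\<lambda>_. Z \<Otimes>\<^sub>M Y))"
      by (intro measurable_compose[OF _ f] measurable_Pair measurable_restrict) measurable
    then show "(\<lambda>x. f (\<lambda>j\<in>insert i I. fst (x j), \<lambda>j\<in>insert i I. snd (x j)))
        \<in> borel_measurable (PiM (insert i I) \<nu>)"
      by (simp only: measurable_cong_sets[OF sI(1)[OF order_refl] refl])
  qed (use insert.hyps \<nu> in auto)
  also have "\<dots> = (\<integral>\<^sup>+x. g (\<lambda>j\<in>I. fst (x j), \<lambda>j\<in>I. snd (x j)) \<partial>PiM I \<nu>)"
  proof (rule nn_integral_cong)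
    fix x assume x: "x \<in> space (PiM I \<nu>)"
    then have "x \<in> space (PiM I (\<lambda>_. Z \<Otimes>\<^sub>M Y))"
      using sets_eq_imp_space_eq[OF sI(1)[OF subset_insertI]] by simp
    then have xs: "(\<lambda>j\<in>I. fst (x j)) \<in> space (S I)" "(\<lambda>j\<in>I. snd (x j)) \<in> space (T I)"
      by (auto simp: S_def T_def space_PiM PiE_iff space_pair_measure mem_Times_iff)
    have "(\<lambda>j\<in>insert i I. fst ((x(i := z)) j)) = (\<lambda>j\<in>I. fst (x j))(i := fst z)"
       "(\<lambda>j\<in>insert i I. snd ((x(i := z)) j)) = (\<lambda>j\<in>I. snd (x j))(i := snd z)" for z
      using insert.hyps(2) by (auto simp: fun_eq_iff)
    then have "(\<integral>\<^sup>+z. f (\<lambda>j\<in>insert i I. fst ((x(i := z)) j), \<lambda>j\<in>insert i I. snd ((x(i := z)) j)) \<partial>\<nu> i)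
      = (\<integral>\<^sup>+z. (\<lambda>z. f1 (\<lambda>j\<in>I. fst (x j)) (\<lambda>j\<in>I. snd (x j)) (fst z) (snd z)) z \<partial>\<nu> i)"
      unfolding f1_def by simp
    also have "\<dots> = g (\<lambda>j\<in>I. fst (x j), \<lambda>j\<in>I. snd (x j))"
      unfolding g_def by (subst dis) (auto intro!: f1 measurable_const xs)
    finally show "(\<integral>\<^sup>+z. f (\<lambda>j\<in>insert i I. fst ((x(i := z)) j), \<lambda>j\<in>insert i I. snd ((x(i := z)) j)) \<partial>\<nu> i)
      = g (\<lambda>j\<in>I. fst (x j), \<lambda>j\<in>I. snd (x j))" .
  qed
  also have "\<dots> = (\<integral>\<^sup>+y. (\<integral>\<^sup>+J. g (J, y) \<partial>PiM I (\<lambda>i. K i (y i))) \<partial>PiM I \<alpha>)"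
    using insert.prems by (intro insert.IH g) auto
  \<comment> \<open>Fubini moves the location of the new index outside the marks of the old ones;
    their law involves only the old locations, so it does not change.\<close>
  also have "\<dots> = (\<integral>\<^sup>+y. (\<integral>\<^sup>+a. (\<integral>\<^sup>+J. (\<integral>\<^sup>+s. f1 J y s a \<partial>K i a) \<partial>PiM I (\<lambda>i. K i (y i))) \<partial>\<alpha> i) \<partial>PiM I \<alpha>)"
  proof (rule nn_integral_cong)
    fix y assume "y \<in> space (PiM I \<alpha>)"
    then have y: "y \<in> space (T I)" using sets_eq_imp_space_eq[OF sI(2)[of I]] by auto
    interpret pair_sigma_finite "PiM I (\<lambda>i. K i (y i))" "\<alpha> i"
      using sf_kernel_sigma_finite[OF KJ y] \<alpha> by (intro pair_sigma_finiteI) auto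
    have [measurable_cong]: "sets (PiM I (\<lambda>i. K i (y i))) = sets (S I)" "sets (\<alpha> i) = sets Y"
      using sf_kernel_sets[OF KJ y] \<alpha> by auto
    have "(\<lambda>(J, a). \<integral>\<^sup>+s. f1 J y s a \<partial>K i a) \<in> borel_measurable (PiM I (\<lambda>i. K i (y i)) \<Otimes>\<^sub>M \<alpha> i)"
      unfolding case_prod_beta by (rule inner) (use y in measurable)
    from Fubini'[OF this]
    show "(\<integral>\<^sup>+J. g (J, y) \<partial>PiM I (\<lambda>i. K i (y i)))
        = (\<integral>\<^sup>+a. (\<integral>\<^sup>+J. (\<integral>\<^sup>+s. f1 J y s a \<partial>K i a) \<partial>PiM I (\<lambda>i. K i (y i))) \<partial>\<alpha> i)"
      unfolding g_def by simp
  qed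
  also have "\<dots> = (\<integral>\<^sup>+y. (\<integral>\<^sup>+a. (\<integral>\<^sup>+J. f (J, y(i := a)) \<partial>PiM (insert i I) (\<lambda>j. K j ((y(i := a)) j))) \<partial>\<alpha> i) \<partial>PiM I \<alpha>)"
  proof (intro nn_integral_cong)
    fix y a assume "y \<in> space (PiM I \<alpha>)" "a \<in> space (\<alpha> i)"
    then have y: "y(i := a) \<in> space (T (insert i I))" 
      using sets_eq_imp_space_eq[OF sI(2)[of I]] sets_eq_imp_space_eq[OF \<alpha>(2)[of i]]
      by (auto simp: T_def space_PiM PiE_iff extensional_def)
    have sj: "sigma_finite_measure (K j ((y(i := a)) j))" if "j \<in> insert i I" for j
      using y that by (intro sf_kernel_sigma_finite[OF K]) (auto simp: T_def space_PiM PiE_iff)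
    have eq: "PiM I (\<lambda>j. K j ((y(i := a)) j)) = PiM I (\<lambda>j. K j (y j))"
      using insert.hyps(2) by (intro PiM_cong) auto
    have "(\<integral>\<^sup>+J. f (J, y(i := a)) \<partial>PiM (insert i I) (\<lambda>j. K j ((y(i := a)) j)))
      = (\<integral>\<^sup>+J. (\<integral>\<^sup>+s. f (J(i := s), y(i := a)) \<partial>K i ((y(i := a)) i)) \<partial>PiM I (\<lambda>j. K j ((y(i := a)) j)))"
    proof (rule nn_integral_PiM_insert[OF insert.hyps sj])
      have "(\<lambda>J. f (J, y(i := a))) \<in> borel_measurable (S (insert i I))"
        using y by measurable
      then show "(\<lambda>J. f (J, y(i := a))) \<in> borel_measurable (PiM (insert i I) (\<lambda>j. K j ((y(i := a)) j)))"
        by (simp only: measurable_cong_sets[OF sf_kernel_sets[OF KJ[OF order_refl] y] refl])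
    qed
    then show "(\<integral>\<^sup>+J. (\<integral>\<^sup>+s. f1 J y s a \<partial>K i a) \<partial>PiM I (\<lambda>i. K i (y i)))
      = (\<integral>\<^sup>+J. f (J, y(i := a)) \<partial>PiM (insert i I) (\<lambda>j. K j ((y(i := a)) j)))"
      unfolding eq by (simp add: f1_def)
  qed
  also have "\<dots> = (\<integral>\<^sup>+y. (\<integral>\<^sup>+J. f (J, y) \<partial>PiM (insert i I) (\<lambda>i. K i (y i))) \<partial>PiM (insert i I) \<alpha>)"
  proof (rule nn_integral_PiM_insert[symmetric, OF insert.hyps])
    have "(\<lambda>(y, J). f (J, y)) \<in> borel_measurable (T (insert i I) \<Otimes>\<^sub>M S (insert i I))" by measurable
    from measurable_nn_integral_sf_kernel[OF KJ[OF order_refl] this]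
    show "(\<lambda>y. \<integral>\<^sup>+J. f (J, y) \<partial>PiM (insert i I) (\<lambda>i. K i (y i))) \<in> borel_measurable (PiM (insert i I) \<alpha>)"
      by (simp add: measurable_cong_sets[OF sI(2)[OF order_refl] refl])
  qed (use \<alpha> in auto)
  finally show ?case .
qed

section \<open>The Mecke equation\<close>

text \<open>The mass c is arbitrary because two cases occur: mass 1 for a further point of a
  configuration, and mass h(s) for the atom that this point produces in the random measure.\<close>

definition add_point :: "'a measure \<Rightarrow> ennreal \<Rightarrow> 'a \<Rightarrow> 'a measure" where
  "add_point m c x = measure_of (space m) (sets m) (\<lambda>A. emeasure m A + c * indicator A x)"

lemma sets_add_point [simp]: "sets (add_point m c x) = sets m"
  unfolding add_point_def by (rule sets.sets_measure_of_eq)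

lemma space_add_point [simp]: "space (add_point m c x) = space m"
  by (rule sets_eq_imp_space_eq) simp

lemma emeasure_add_point:
  assumes "A \<in> sets m"
  shows "emeasure (add_point m c x) A = emeasure m A + c * indicator A x"
proof (rule emeasure_measure_of[OF add_point_def])
  show "countably_additive (sets (add_point m c x)) (\<lambda>A. emeasure m A + c * indicator A x)"
  proof (rule countably_additiveI)
    fix B :: "nat \<Rightarrow> _" assume "range B \<subseteq> sets (add_point m c x)" and d: "disjoint_family B"
    then have B: "range B \<subseteq> sets m" by simp
    have "(\<Sum>i. emeasure m (B i) + c * indicator (B i) x) = (\<Sum>i. emeasure m (B i)) + (\<Sum>i. c * indicator (B i) x)"
      by (rule suminf_add[symmetric]) auto
    then show "(\<Sum>i. emeasure m (B i) + c * indicator (B i) x) = emeasure m (\<Union>i. B i) + c * indicator (\<Union>i. B i) x"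
      by (simp add: suminf_emeasure[OF B d] suminf_indicator[OF d])
  qed
qed (use assms sets.space_closed in \<open>auto simp: positive_def\<close>)

lemma nn_integral_add_point:
  assumes "f \<in> borel_measurable m" "x \<in> space m"
  shows "(\<integral>\<^sup>+z. f z \<partial>add_point m c x) = (\<integral>\<^sup>+z. f z \<partial>m) + c * f x"
  using assms(1)
proof (induction rule: borel_measurable_induct)
  case (cong f g)
  have "(\<integral>\<^sup>+z. f z \<partial>add_point m c x) = (\<integral>\<^sup>+z. g z \<partial>add_point m c x)"
    "(\<integral>\<^sup>+z. f z \<partial>m) = (\<integral>\<^sup>+z. g z \<partial>m)"
    using cong(3) by (auto intro!: nn_integral_cong)
  then show ?case using cong assms(2) by simp
next
  case (set A) then show ?case by (simp add: emeasure_add_point)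
next
  case (mult u a) then show ?case
    by (simp add: nn_integral_cmult measurable_cong_sets[OF sets_add_point refl] distrib_left mult_ac)
next
  case (add u v) then show ?case
    by (simp add: nn_integral_add measurable_cong_sets[OF sets_add_point refl] distrib_left add_ac)
next
  case (seq U)
  have "(\<integral>\<^sup>+z. (SUP i. U i z) \<partial>add_point m c x) = (SUP i. \<integral>\<^sup>+z. U i z \<partial>add_point m c x)"
    using seq(1,3) by (intro nn_integral_monotone_convergence_SUP) (auto simp: measurable_cong_sets[OF sets_add_point refl])
  also have "\<dots> = (SUP i. (\<integral>\<^sup>+z. U i z \<partial>m) + c * U i x)" using seq.IH by simp
  also have "\<dots> = (SUP i. \<integral>\<^sup>+z. U i z \<partial>m) + (SUP i. c * U i x)"
    using seq(3) by (intro ennreal_SUP_add)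
      (auto simp: incseq_def le_fun_def intro!: nn_integral_mono mult_left_mono)
  also have "\<dots> = (\<integral>\<^sup>+z. (SUP i. U i z) \<partial>m) + c * (SUP i. U i x)"
    using seq(1,3) by (simp add: nn_integral_monotone_convergence_SUP SUP_mult_left_ennreal)
  finally show ?case unfolding seq(4) by (simp add: image_comp)
qed

lemma measurable_add_point_locally_finite:
  assumes a: "a \<in> measurable Q (locally_finite_measures X \<F>)" and b [measurable]: "b \<in> measurable Q X"
    and c [measurable]: "c \<in> borel_measurable Q" and fin: "\<And>q. q \<in> space Q \<Longrightarrow> c q < \<infinity>" and \<F>: "\<F> \<subseteq> sets X"
  shows "(\<lambda>q. add_point (a q) (c q) (b q)) \<in> measurable Q (locally_finite_measures X \<F>)"
proof (rule measurable_locally_finiteI)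
  have sa: "sets (a q) = sets X" "\<And>B. B \<in> \<F> \<Longrightarrow> emeasure (a q) B < \<infinity>" if "q \<in> space Q" for q
    using measurable_space[OF a that] by (auto simp: space_locally_finite_measures)
  show "add_point (a q) (c q) (b q) \<in> space (locally_finite_measures X \<F>)" if q: "q \<in> space Q" for q
    using sa[OF q] fin[OF q] \<F>
    by (auto simp: space_locally_finite_measures emeasure_add_point subset_iff split: split_indicator)
  fix A assume A [measurable]: "A \<in> sets X"
  note [measurable] = measurable_compose[OF a measurable_emeasure_locally_finite[OF A]]
  have "(\<lambda>q. emeasure (a q) A + c q * indicator A (b q)) \<in> borel_measurable Q" by measurable
  also have "?this \<longleftrightarrow> (\<lambda>q. emeasure (add_point (a q) (c q) (b q)) A) \<in> borel_measurable Q"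
    by (rule measurable_cong) (simp add: emeasure_add_point sa)
  finally show "(\<lambda>q. emeasure (add_point (a q) (c q) (b q)) A) \<in> borel_measurable Q" .
qed

section \<open>Counts of a Poisson random measure\<close>

lemma poisson_weights_sums: "(\<lambda>k. exp (- l) * l ^ k / fact k) sums (1 :: real)"
proof -
  have "(\<lambda>k. exp (- l) * (l ^ k /\<^sub>R fact k)) sums (exp (- l) * exp l)"
    by (intro sums_mult exp_converges)
  then show ?thesis by (simp add: exp_minus divide_inverse mult_ac)
qed

text \<open>The prescribed probabilities of the values 0, 1, 2, ... already sum to 1, so nothing is
  left for other values, in particular for infinity.\<close>

lemma poisson_count_AE:
  assumes prm: "poisson_random_measure P \<nu> N" and A: "A \<in> sets \<nu>" "emeasure \<nu> A < \<infinity>"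
  shows "AE \<omega> in P. \<exists>k::nat. emeasure (N \<omega>) A = of_nat k"
proof -
  interpret prob_space P using prm by (simp add: poisson_random_measure_def)
  have [measurable]: "(\<lambda>\<omega>. emeasure (N \<omega>) A) \<in> borel_measurable P"
    using prm A by (simp add: poisson_random_measure_def)
  define E where "E k = {\<omega>\<in>space P. emeasure (N \<omega>) A = of_nat k}" for k :: nat
  have E [measurable]: "E k \<in> sets P" for k unfolding E_def by measurable
  have "(\<lambda>k. prob (E k)) sums prob (\<Union>k. E k)"
    by (intro finite_measure_UNION) (auto simp: disjoint_family_on_def E_def)
  moreover have "prob (E k) = exp (- measure \<nu> A) * measure \<nu> A ^ k / fact k" for k
    using prm A unfolding E_def poisson_random_measure_def by blast
  ultimately have "prob (\<Union>k. E k) = 1"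
    using poisson_weights_sums[of "measure \<nu> A"] by (metis (no_types, lifting) sums_cong sums_unique2)
  then have "AE \<omega> in P. \<omega> \<in> (\<Union>k. E k)" by (intro AE_prob_1) auto
  then show ?thesis by (auto elim!: eventually_mono simp: E_def)
qed

lemma poisson_count_nn_integral:
  fixes f :: "ennreal \<Rightarrow> ennreal"
  assumes prm: "poisson_random_measure P \<nu> N" and A: "A \<in> sets \<nu>" "emeasure \<nu> A < \<infinity>"
    and [measurable]: "f \<in> borel_measurable borel"
  shows "(\<integral>\<^sup>+\<omega>. f (emeasure (N \<omega>) A) \<partial>P)
    = (\<Sum>k. f (of_nat k) * ennreal (exp (- measure \<nu> A) * measure \<nu> A ^ k / fact k))"
proof -
  interpret prob_space P using prm by (simp add: poisson_random_measure_def)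
  have [measurable]: "(\<lambda>\<omega>. emeasure (N \<omega>) A) \<in> borel_measurable P"
    using prm A by (simp add: poisson_random_measure_def)
  define E where "E k = {\<omega>\<in>space P. emeasure (N \<omega>) A = of_nat k}" for k :: nat
  have E [measurable]: "E k \<in> sets P" for k unfolding E_def by measurable
  have pE: "emeasure P (E k) = ennreal (exp (- measure \<nu> A) * measure \<nu> A ^ k / fact k)" for k
  proof -
    have "prob (E k) = exp (- measure \<nu> A) * measure \<nu> A ^ k / fact k"
      using prm A unfolding E_def poisson_random_measure_def by blast
    then show ?thesis by (simp add: emeasure_eq_measure)
  qed
  have d: "disjoint_family E" by (auto simp: disjoint_family_on_def E_def)
  have "(\<integral>\<^sup>+\<omega>. f (emeasure (N \<omega>) A) \<partial>P) = (\<integral>\<^sup>+\<omega>. (\<Sum>k. f (of_nat k) * indicator (E k) \<omega>) \<partial>P)"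
  proof (rule nn_integral_cong_AE)
    show "AE \<omega> in P. f (emeasure (N \<omega>) A) = (\<Sum>k. f (of_nat k) * indicator (E k) \<omega>)"
      using poisson_count_AE[OF prm A] AE_space
    proof eventually_elim
      case (elim \<omega>)
      then obtain k :: nat where k: "emeasure (N \<omega>) A = of_nat k" "\<omega> \<in> E k" by (auto simp: E_def)
      show ?case using suminf_cmult_indicator[OF d k(2), of "\<lambda>k. f (of_nat k)"] k(1) by simp
    qed
  qed
  also have "\<dots> = (\<Sum>k. \<integral>\<^sup>+\<omega>. f (of_nat k) * indicator (E k) \<omega> \<partial>P)"
    by (intro nn_integral_suminf) measurable
  also have "\<dots> = (\<Sum>k. f (of_nat k) * emeasure P (E k))" by (simp add: nn_integral_cmult_indicator)
  finally show ?thesis by (simp add: pE)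
qed

text \<open>The Chen-Stein identity of the Poisson distribution: weighting a count by its own value
  has the effect of raising it by one. It is the Mecke equation for a single set.\<close>

lemma poisson_count_shift:
  fixes f :: "ennreal \<Rightarrow> ennreal"
  assumes prm: "poisson_random_measure P \<nu> N" and A: "A \<in> sets \<nu>" "emeasure \<nu> A < \<infinity>"
    and [measurable]: "f \<in> borel_measurable borel"
  shows "(\<integral>\<^sup>+\<omega>. emeasure (N \<omega>) A * f (emeasure (N \<omega>) A) \<partial>P)
    = emeasure \<nu> A * (\<integral>\<^sup>+\<omega>. f (emeasure (N \<omega>) A + 1) \<partial>P)"
proof -
  define l where "l = measure \<nu> A"
  have l: "emeasure \<nu> A = ennreal l" "0 \<le> l"
    using A by (auto simp: l_def emeasure_eq_ennreal_measure)
  define w where "w k = ennreal (exp (- l) * l ^ k / fact k)" for k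
  have shift: "of_nat (Suc k) * w (Suc k) = ennreal l * w k" for k
  proof -
    have "real (Suc k) * (exp (- l) * l ^ Suc k / fact (Suc k)) = l * (exp (- l) * l ^ k / fact k)"
      by (simp del: of_nat_Suc)
    then show ?thesis using l(2) unfolding w_def
      by (simp add: ennreal_of_nat_eq_real_of_nat ennreal_mult'[symmetric] del: of_nat_Suc fact_Suc power_Suc)
  qed
  let ?g = "\<lambda>k. of_nat k * f (of_nat k) * w k"
  have "(\<integral>\<^sup>+\<omega>. emeasure (N \<omega>) A * f (emeasure (N \<omega>) A) \<partial>P) = (\<Sum>k. ?g k)"
    using poisson_count_nn_integral[OF prm A, of "\<lambda>t. t * f t"] by (simp add: w_def l_def)
  \<comment> \<open>The term for k = 0 carries the factor 0, so the series may start at 1.\<close>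
  also have "\<dots> = (\<Sum>k. ?g (Suc k))"
  proof -
    have "(\<lambda>k. ?g (Suc k)) sums (\<Sum>k. ?g (Suc k))" by (intro summable_sums) auto
    from sums_Suc[OF this] show ?thesis by (simp add: sums_iff)
  qed
  also have "\<dots> = (\<Sum>k. ennreal l * (f (of_nat k + 1) * w k))"
  proof (rule suminf_cong)
    fix k
    have "?g (Suc k) = f (of_nat (Suc k)) * (of_nat (Suc k) * w (Suc k))" by (simp only: mult_ac)
    then show "?g (Suc k) = ennreal l * (f (of_nat k + 1) * w k)"
      unfolding shift by (simp add: mult_ac add.commute)
  qed
  also have "\<dots> = ennreal l * (\<Sum>k. f (of_nat k + 1) * w k)" by (rule ennreal_suminf_cmult)
  also have "(\<Sum>k. f (of_nat k + 1) * w k) = (\<integral>\<^sup>+\<omega>. f (emeasure (N \<omega>) A + 1) \<partial>P)"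
    using poisson_count_nn_integral[OF prm A, of "\<lambda>t. f (t + 1)"] by (simp add: w_def l_def)
  finally show ?thesis by (simp add: l)
qed

text \<open>By independence the joint law of the counts is a product measure, so the one-dimensional
  identity applies to the i-th coordinate with all other counts frozen.\<close>

lemma poisson_counts_shift:
  fixes D :: "nat \<Rightarrow> 'x set"
  assumes prm: "poisson_random_measure P \<nu> N" and D: "\<And>j. j < m \<Longrightarrow> D j \<in> sets \<nu>"
    "\<And>j. j < m \<Longrightarrow> emeasure \<nu> (D j) < \<infinity>" "disjoint_family_on D {..<m}" and i: "i < m"
    and \<Phi> [measurable]: "\<Phi> \<in> borel_measurable (PiM {..<m} (\<lambda>_. borel))"
  shows "(\<integral>\<^sup>+\<omega>. emeasure (N \<omega>) (D i) * \<Phi> (\<lambda>j\<in>{..<m}. emeasure (N \<omega>) (D j)) \<partial>P)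
    = emeasure \<nu> (D i) * (\<integral>\<^sup>+\<omega>. \<Phi> (\<lambda>j\<in>{..<m}. emeasure (N \<omega>) (D j) + (if j = i then 1 else 0)) \<partial>P)"
proof -
  interpret prob_space P using prm by (simp add: poisson_random_measure_def)
  define X where "X j \<omega> = emeasure (N \<omega>) (D j)" for j \<omega>
  have X [measurable]: "X j \<in> borel_measurable P" if "j < m" for j
    using prm D(1)[OF that] by (simp add: poisson_random_measure_def X_def[abs_def])
  define Q where "Q j = distr P borel (X j)" for j
  have sQ [measurable_cong, simp]: "sets (Q j) = sets borel" for j by (simp add: Q_def)
  have pQ: "prob_space (Q j)" if "j < m" for j unfolding Q_def by (rule prob_space_distr) (rule X[OF that])
  then have sfQ: "sigma_finite_measure (Q j)" if "j < m" for j
    using that by (simp add: finite_measure.sigma_finite_measure prob_space.finite_measure)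
  have sPi [simp, measurable_cong]: "sets (PiM I Q) = sets (PiM I (\<lambda>_. borel))" for I by (intro sets_PiM_cong) auto
  have "indep_vars (\<lambda>_. borel) X {..<m}"
    using prm D(1,3) unfolding poisson_random_measure_def X_def[abs_def] by blast
  then have law: "distr P (PiM {..<m} (\<lambda>_. borel)) (\<lambda>\<omega>. \<lambda>j\<in>{..<m}. X j \<omega>) = PiM {..<m} Q"
    using i unfolding Q_def by (subst (asm) indep_vars_iff_distr_eq_PiM') auto
  have toQ: "(\<integral>\<^sup>+\<omega>. \<Psi> (\<lambda>j\<in>{..<m}. X j \<omega>) \<partial>P) = (\<integral>\<^sup>+x. \<Psi> x \<partial>PiM {..<m} Q)"
    if "\<Psi> \<in> borel_measurable (PiM {..<m} (\<lambda>_. borel))" for \<Psi>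
    unfolding law[symmetric] using that by (subst nn_integral_distr) (auto intro!: measurable_restrict)
  define I where "I = {..<m} - {i}"
  have I: "insert i I = {..<m}" "i \<notin> I" "finite I" using i by (auto simp: I_def)
  have Iu: "{..<m} = I \<union> {i}" using i by (auto simp: I_def)
  have upd [measurable]: "(\<lambda>x. x(i := f x)) \<in> measurable (PiM {..<m} (\<lambda>_. borel)) (PiM {..<m} (\<lambda>_. borel))"
    if "f \<in> borel_measurable (PiM {..<m} (\<lambda>_. borel))" for f :: "_ \<Rightarrow> ennreal"
    using that i by (intro measurable_fun_upd[where J="{..<m}"]) auto
  have upd' [measurable]: "(\<lambda>t. x(i := t)) \<in> measurable borel (PiM {..<m} (\<lambda>_. borel))"
    if "x \<in> space (PiM I Q)" for x
    using that[unfolded sets_eq_imp_space_eq[OF sPi]]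
    by (intro measurable_fun_upd[OF Iu]) (auto intro: measurable_const)
  have ci [measurable]: "(\<lambda>x. x i) \<in> borel_measurable (PiM {..<m} (\<lambda>_. borel :: ennreal measure))"
    using i by (intro measurable_component_singleton) auto
  have "(\<integral>\<^sup>+\<omega>. X i \<omega> * \<Phi> (\<lambda>j\<in>{..<m}. X j \<omega>) \<partial>P) = (\<integral>\<^sup>+x. x i * \<Phi> x \<partial>PiM {..<m} Q)"
    using i by (subst toQ[symmetric]) auto
  also have "\<dots> = (\<integral>\<^sup>+x. (\<integral>\<^sup>+t. t * \<Phi> (x(i := t)) \<partial>Q i) \<partial>PiM I Q)"
    using nn_integral_PiM_insert[of I i Q "\<lambda>x. x i * \<Phi> x"] I sfQ by simp
  also have "\<dots> = (\<integral>\<^sup>+x. emeasure \<nu> (D i) * (\<integral>\<^sup>+t. \<Phi> (x(i := t + 1)) \<partial>Q i) \<partial>PiM I Q)"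
  proof (rule nn_integral_cong)
    fix x assume x: "x \<in> space (PiM I Q)"
    have m: "(\<lambda>t. \<Phi> (x(i := t))) \<in> borel_measurable borel"
      by (rule measurable_compose[OF upd'[OF x] \<Phi>])
    have m1: "(\<lambda>t. \<Phi> (x(i := t + 1))) \<in> borel_measurable borel"
      by (rule measurable_compose[OF _ m]) measurable
    have "(\<integral>\<^sup>+t. t * \<Phi> (x(i := t)) \<partial>Q i) = (\<integral>\<^sup>+\<omega>. X i \<omega> * \<Phi> (x(i := X i \<omega>)) \<partial>P)"
      unfolding Q_def using m X[OF i] by (subst nn_integral_distr) auto
    also have "\<dots> = emeasure \<nu> (D i) * (\<integral>\<^sup>+\<omega>. \<Phi> (x(i := X i \<omega> + 1)) \<partial>P)"
      unfolding X_def using poisson_count_shift[OF prm D(1,2)[OF i] m] .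
    also have "(\<integral>\<^sup>+\<omega>. \<Phi> (x(i := X i \<omega> + 1)) \<partial>P) = (\<integral>\<^sup>+t. \<Phi> (x(i := t + 1)) \<partial>Q i)"
      unfolding Q_def using m1 X[OF i] by (subst nn_integral_distr) auto
    finally show "(\<integral>\<^sup>+t. t * \<Phi> (x(i := t)) \<partial>Q i) = emeasure \<nu> (D i) * (\<integral>\<^sup>+t. \<Phi> (x(i := t + 1)) \<partial>Q i)" .
  qed
  also have "\<dots> = emeasure \<nu> (D i) * (\<integral>\<^sup>+x. (\<integral>\<^sup>+t. \<Phi> (x(i := t + 1)) \<partial>Q i) \<partial>PiM I Q)"
  proof (rule nn_integral_cmult)
    have [measurable]: "(\<lambda>p. (fst p)(i := snd p + 1)) \<in> measurable (PiM I Q \<Otimes>\<^sub>M Q i) (PiM {..<m} (\<lambda>_. borel))"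
      by (intro measurable_fun_upd[OF Iu]) measurable
    have "(\<lambda>(x, t). \<Phi> (x(i := t + 1))) \<in> borel_measurable (PiM I Q \<Otimes>\<^sub>M Q i)"
      unfolding case_prod_beta by measurable
    from sigma_finite_measure.borel_measurable_nn_integral[OF sfQ[OF i] this]
    show "(\<lambda>x. \<integral>\<^sup>+t. \<Phi> (x(i := t + 1)) \<partial>Q i) \<in> borel_measurable (PiM I Q)" .
  qed
  also have "(\<integral>\<^sup>+x. (\<integral>\<^sup>+t. \<Phi> (x(i := t + 1)) \<partial>Q i) \<partial>PiM I Q) = (\<integral>\<^sup>+x. \<Phi> (x(i := x i + 1)) \<partial>PiM {..<m} Q)"
    using nn_integral_PiM_insert[of I i Q "\<lambda>x. \<Phi> (x(i := x i + 1))"] I sfQ by simp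
  also have "\<dots> = (\<integral>\<^sup>+\<omega>. \<Phi> ((\<lambda>j\<in>{..<m}. X j \<omega>)(i := (\<lambda>j\<in>{..<m}. X j \<omega>) i + 1)) \<partial>P)"
    by (rule toQ[symmetric]) measurable
  also have "\<dots> = (\<integral>\<^sup>+\<omega>. \<Phi> (\<lambda>j\<in>{..<m}. X j \<omega> + (if j = i then 1 else 0)) \<partial>P)"
    using i by (intro nn_integral_cong arg_cong[where f=\<Phi>]) auto
  finally show ?thesis by (simp only: X_def)
qed

text \<open>The pieces are the atoms of the generated field: for a subfamily v, the points that lie
  in exactly the members of v. The empty v is left out; its piece is the complement of the union,
  which lies in no member and may have infinite mass.\<close>

lemma finite_disjoint_refinement:
  assumes "finite \<B>" "\<B> \<subseteq> sets X"
  obtains m and D :: "nat \<Rightarrow> 'x set" and I where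
    "\<And>i. i < m \<Longrightarrow> D i \<in> sets X" "disjoint_family_on D {..<m}" "\<And>i. i < m \<Longrightarrow> \<exists>B\<in>\<B>. D i \<subseteq> B"
    "\<And>B. B \<in> \<B> \<Longrightarrow> I B \<subseteq> {..<m}" "\<And>B. B \<in> \<B> \<Longrightarrow> B = (\<Union>i\<in>I B. D i)"
proof -
  define S where "S = Pow \<B> - {{}}"
  define E where "E v = \<Inter>v - \<Union>(\<B> - v)" for v
  have "finite S" using assms(1) by (simp add: S_def)
  then obtain e where e: "bij_betw e {0..<card S} S" using ex_bij_betw_nat_finite by blast
  have eS: "e i \<in> S" if "i < card S" for i using e that by (auto simp: bij_betw_def)
  show thesis
  proof (rule that[of "card S" "\<lambda>i. E (e i)" "\<lambda>B. {i\<in>{..<card S}. B \<in> e i}"])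
    fix i assume i: "i < card S"
    have "e i \<noteq> {}" "e i \<subseteq> \<B>" using eS[OF i] by (auto simp: S_def)
    then show "E (e i) \<in> sets X" unfolding E_def
      using assms finite_subset[of "e i" \<B>] sets.finite_INT[of "e i" "\<lambda>B. B" X]
      by (intro sets.Diff sets.finite_Union) auto
    show "\<exists>B\<in>\<B>. E (e i) \<subseteq> B" using \<open>e i \<noteq> {}\<close> \<open>e i \<subseteq> \<B>\<close> unfolding E_def by blast
  next
    show "disjoint_family_on (\<lambda>i. E (e i)) {..<card S}"
      unfolding disjoint_family_on_def
    proof (intro ballI impI)
      fix i j assume ij: "i \<in> {..<card S}" "j \<in> {..<card S}" "i \<noteq> j"
      then have "e i \<noteq> e j" using e by (auto simp: bij_betw_def inj_on_def)
      moreover have "e i \<subseteq> \<B>" "e j \<subseteq> \<B>" using eS ij by (auto simp: S_def)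
      ultimately show "E (e i) \<inter> E (e j) = {}" unfolding E_def by blast
    qed
  next
    fix B assume B: "B \<in> \<B>"
    show "B = (\<Union>i\<in>{i\<in>{..<card S}. B \<in> e i}. E (e i))"
    proof (intro equalityI subsetI)
      fix x assume "x \<in> B"
      define v where "v = {B\<in>\<B>. x \<in> B}"
      have "v \<in> S" "B \<in> v" "x \<in> E v" using \<open>x \<in> B\<close> B by (auto simp: v_def S_def E_def)
      moreover obtain i where "i \<in> {0..<card S}" "v = e i"
        using bij_betw_imp_surj_on[OF e] \<open>v \<in> S\<close> by blast
      ultimately show "x \<in> (\<Union>i\<in>{i\<in>{..<card S}. B \<in> e i}. E (e i))" by auto
    qed (auto simp: E_def)
  qed auto
qed


text \<open>This permits testing the Mecke equation only on sets of finite intensity, the sets whose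
  counts are Poisson variables.\<close>

lemma incseq_exhaust_finite_generates:
  assumes "incseq F" "\<And>k. F k \<in> sets X" "(\<Union>k::nat. F k) = space X" "\<And>k. emeasure X (F k) < \<infinity>"
  shows "sets X = sigma_sets (space X) {A\<in>sets X. emeasure X A < \<infinity>}"
proof (intro equalityI subsetI)
  fix A assume A: "A \<in> sets X"
  have "A \<inter> F k \<in> sigma_sets (space X) {A\<in>sets X. emeasure X A < \<infinity>}" for k
    using A assms(2) le_less_trans[OF emeasure_mono assms(4)[of k], of "A \<inter> F k"] by auto
  then have "(\<Union>k. A \<inter> F k) \<in> sigma_sets (space X) {A\<in>sets X. emeasure X A < \<infinity>}"
    by (rule sigma_sets.Union)
  moreover have "(\<Union>k. A \<inter> F k) = A" using assms(3) sets.sets_into_space[OF A] by blast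
  ultimately show "A \<in> sigma_sets (space X) {A\<in>sets X. emeasure X A < \<infinity>}" by simp
qed (use sets.sigma_sets_subset[of "{A\<in>sets X. emeasure X A < \<infinity>}" X] in auto)

section \<open>The Poisson process as a random element of a configuration space\<close>

locale poisson_process =
  fixes P :: "'w measure" and \<nu> :: "'x measure" and N :: "'w \<Rightarrow> 'x measure" and F :: "nat \<Rightarrow> 'x set"
  assumes prm: "poisson_random_measure P \<nu> N"
    and F: "incseq F" "\<And>k. F k \<in> sets \<nu>" "(\<Union>k. F k) = space \<nu>" "\<And>k. emeasure \<nu> (F k) < \<infinity>"
begin

sublocale P: prob_space P using prm by (simp add: poisson_random_measure_def)

lemma sigma_finite_intensity: "sigma_finite_measure \<nu>"
  using F by (intro sigma_finite_measureI_UN[of F]) auto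

abbreviation config :: "'x measure measure" where
  "config \<equiv> locally_finite_measures \<nu> (range F)"

text \<open>Finiteness on \<open>F k\<close> follows from the Poisson laws only almost surely. The
  modification lies in \<open>config\<close> for every outcome, so it is a measurable map into that
  space and a kernel with a common exhaustion.\<close>

definition N' :: "'w \<Rightarrow> 'x measure" where
  "N' \<omega> = (if \<forall>k. emeasure (N \<omega>) (F k) < \<infinity> then N \<omega> else null_measure \<nu>)"

lemma sets_N: "\<omega> \<in> space P \<Longrightarrow> sets (N \<omega>) = sets \<nu>"
  using prm by (simp add: poisson_random_measure_def)

lemma measurable_N: "A \<in> sets \<nu> \<Longrightarrow> (\<lambda>\<omega>. emeasure (N \<omega>) A) \<in> borel_measurable P"
  using prm by (simp add: poisson_random_measure_def)

lemma sets_N': "\<omega> \<in> space P \<Longrightarrow> sets (N' \<omega>) = sets \<nu>"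
  using sets_N by (simp add: N'_def)

lemma measurable_N' [measurable]: "N' \<in> measurable P config"
proof (rule measurable_locally_finiteI)
  show "N' \<omega> \<in> space config" if "\<omega> \<in> space P" for \<omega>
    using sets_N[OF that] by (auto simp: N'_def space_locally_finite_measures)
  fix A assume A: "A \<in> sets \<nu>"
  note [measurable] = measurable_N[OF A] measurable_N[OF F(2)]
  have "(\<lambda>\<omega>. if \<forall>k. emeasure (N \<omega>) (F k) < \<infinity> then emeasure (N \<omega>) A else 0) \<in> borel_measurable P"
    by measurable
  then show "(\<lambda>\<omega>. emeasure (N' \<omega>) A) \<in> borel_measurable P"
    unfolding N'_def by (simp add: if_distrib[of "\<lambda>m. emeasure m A"] cong: if_cong)
qed

lemma AE_N': "AE \<omega> in P. N' \<omega> = N \<omega>"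
proof -
  have "AE \<omega> in P. \<forall>k. \<exists>j::nat. emeasure (N \<omega>) (F k) = of_nat j"
    unfolding AE_all_countable using poisson_count_AE[OF prm F(2,4)] ..
  then show ?thesis
    by (rule eventually_mono) (metis N'_def infinity_ennreal_def of_nat_less_top)
qed

lemma measurable_add_point_config:
  "(\<lambda>(x, \<omega>). add_point (N' \<omega>) 1 x) \<in> measurable (\<nu> \<Otimes>\<^sub>M P) config"
  unfolding case_prod_beta
  using F(2) by (intro measurable_add_point_locally_finite) auto

definition cylinder :: "'x set set \<Rightarrow> ('x set \<Rightarrow> ennreal set) \<Rightarrow> 'x measure set" where
  "cylinder J V = {m\<in>space config. \<forall>B\<in>J. emeasure m B \<in> V B}"

text \<open>Only sets of finite intensity are tested, because the shift identity for counts is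
  available exactly there.\<close>

definition cylinders :: "'x measure set set" where
  "cylinders = {cylinder J V | J V. finite J \<and> J \<subseteq> {A\<in>sets \<nu>. emeasure \<nu> A < \<infinity>} \<and> (\<forall>B. V B \<in> sets borel)}"

lemma cylinders_subset: "cylinders \<subseteq> Pow (space config)"
  by (auto simp: cylinders_def cylinder_def)

lemma cylinder_sets:
  assumes "finite J" "J \<subseteq> sets \<nu>" "\<And>B. V B \<in> sets borel"
  shows "cylinder J V \<in> sets config"
proof -
  have [measurable]: "V B \<in> sets borel" "B \<in> J \<Longrightarrow> B \<in> sets \<nu>" for B using assms by auto
  show ?thesis unfolding cylinder_def using assms(1) by measurable
qed

lemma space_config_in_cylinders: "space config \<in> cylinders"
  unfolding cylinders_def
  by (intro CollectI exI[of _ "{}"] exI[of _ "\<lambda>_. UNIV"]) (auto simp: cylinder_def)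

lemma Int_stable_cylinders: "Int_stable cylinders"
proof (rule Int_stableI)
  fix G G' assume "G \<in> cylinders" "G' \<in> cylinders"
  then obtain J V J' V' where *: "G = cylinder J V" "G' = cylinder J' V'" "finite J" "finite J'"
    "J \<subseteq> {A\<in>sets \<nu>. emeasure \<nu> A < \<infinity>}" "J' \<subseteq> {A\<in>sets \<nu>. emeasure \<nu> A < \<infinity>}"
    "\<And>B. V B \<in> sets borel" "\<And>B. V' B \<in> sets borel"
    unfolding cylinders_def by auto
  define W where "W B = (if B \<in> J then V B else UNIV) \<inter> (if B \<in> J' then V' B else UNIV)" for B
  have "G \<inter> G' = cylinder (J \<union> J') W" unfolding * by (auto simp: cylinder_def W_def)
  then show "G \<inter> G' \<in> cylinders" unfolding cylinders_def
    using * by (intro CollectI exI[of _ "J \<union> J'"] exI[of _ W]) (auto simp: W_def)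
qed

text \<open>The evaluation at any A is the increasing limit of the evaluations at
  \<open>A \<inter> F k\<close>, which have finite intensity, so the cylinders generate all
  evaluations.\<close>

lemma sets_config: "sets config = sigma_sets (space config) cylinders"
proof
  let ?S = "sigma (space config) cylinders"
  have sp: "space ?S = space config" by (rule space_measure_of[OF cylinders_subset])
  have fin: "(\<lambda>m. emeasure m B) \<in> borel_measurable ?S" if B: "B \<in> sets \<nu>" "emeasure \<nu> B < \<infinity>" for B
  proof (rule measurableI)
    fix V :: "ennreal set" assume "V \<in> sets borel"
    then have "cylinder {B} (\<lambda>_. V) \<in> cylinders" using B unfolding cylinders_def by blast
    moreover have "(\<lambda>m. emeasure m B) -` V \<inter> space ?S = cylinder {B} (\<lambda>_. V)"
      unfolding sp by (auto simp: cylinder_def)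
    ultimately show "(\<lambda>m. emeasure m B) -` V \<inter> space ?S \<in> sets ?S"
      by (simp add: sets_measure_of[OF cylinders_subset] sigma_sets.Basic)
  qed simp
  have "(\<lambda>m. m) \<in> measurable ?S config"
  proof (rule measurable_locally_finiteI)
    fix A assume A: "A \<in> sets \<nu>"
    have [measurable]: "(\<lambda>m. emeasure m (A \<inter> F k)) \<in> borel_measurable ?S" for k
      using A F(2) le_less_trans[OF emeasure_mono F(4)[of k], of "A \<inter> F k"] by (intro fin) auto
    have "(\<lambda>m. SUP k. emeasure m (A \<inter> F k)) \<in> borel_measurable ?S" by measurable
    also have "?this \<longleftrightarrow> (\<lambda>m. emeasure m A) \<in> borel_measurable ?S"
    proof (rule measurable_cong)
      fix m assume "m \<in> space ?S"
      then have m: "sets m = sets \<nu>" unfolding sp by (simp add: space_locally_finite_measures)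
      have "(SUP k. emeasure m (A \<inter> F k)) = emeasure m (\<Union>k. A \<inter> F k)"
        using A F(1,2) m by (intro SUP_emeasure_incseq) (auto simp: incseq_def)
      also have "(\<Union>k. A \<inter> F k) = A" using F(3) sets.sets_into_space[OF A] by blast
      finally show "(SUP k. emeasure m (A \<inter> F k)) = emeasure m A" .
    qed
    finally show "(\<lambda>m. emeasure m A) \<in> borel_measurable ?S" .
  qed (simp add: sp)
  then show "sets config \<subseteq> sigma_sets (space config) cylinders"
    using sets_measure_of[OF cylinders_subset] sets.sets_into_space sp
    by (fastforce dest!: measurable_sets simp: Int_absorb2)
  show "sigma_sets (space config) cylinders \<subseteq> sets config"
    by (rule sets.sigma_sets_subset) (auto simp: cylinders_def intro!: cylinder_sets)
qed

text \<open>A and the sets tested by the cylinder G are cut into common disjoint pieces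
  \<open>D i\<close>. Then the count of A is a sum of counts of pieces, G depends on the counts of
  pieces alone, and a new point in \<open>D i\<close> raises precisely the i-th count by one, which
  matches \<open>poisson_counts_shift\<close>.\<close>

lemma mecke_box:
  assumes A: "A \<in> sets \<nu>" "emeasure \<nu> A < \<infinity>" and G: "G \<in> cylinders"
  shows "(\<integral>\<^sup>+\<omega>. emeasure (N' \<omega>) A * indicator G (N' \<omega>) \<partial>P)
    = (\<integral>\<^sup>+x. indicator A x * (\<integral>\<^sup>+\<omega>. indicator G (add_point (N' \<omega>) 1 x) \<partial>P) \<partial>\<nu>)"
proof -
  obtain J V where GJ: "G = cylinder J V" and J: "finite J" "J \<subseteq> {A\<in>sets \<nu>. emeasure \<nu> A < \<infinity>}"
    and V [measurable]: "\<And>B. V B \<in> sets borel" using G unfolding cylinders_def by auto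
  define \<B> where "\<B> = insert A J"
  have \<B>: "finite \<B>" "\<B> \<subseteq> sets \<nu>" "\<And>B. B \<in> \<B> \<Longrightarrow> emeasure \<nu> B < \<infinity>" using A J by (auto simp: \<B>_def)
  obtain m and D :: "nat \<Rightarrow> 'x set" and I where D: "\<And>i. i < m \<Longrightarrow> D i \<in> sets \<nu>"
    "disjoint_family_on D {..<m}" "\<And>i. i < m \<Longrightarrow> \<exists>B\<in>\<B>. D i \<subseteq> B"
    and I: "\<And>B. B \<in> \<B> \<Longrightarrow> I B \<subseteq> {..<m}" "\<And>B. B \<in> \<B> \<Longrightarrow> B = (\<Union>i\<in>I B. D i)"
    by (rule finite_disjoint_refinement[OF \<B>(1,2)]) (rule that)
  have Dfin: "emeasure \<nu> (D i) < \<infinity>" if i: "i < m" for i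
  proof -
    obtain B where "B \<in> \<B>" "D i \<subseteq> B" using D(3)[OF i] by blast
    then show ?thesis using \<B> by (intro le_less_trans[OF emeasure_mono \<B>(3)]) auto
  qed
  have finI: "finite (I B)" if "B \<in> \<B>" for B using I(1)[OF that] finite_subset by blast
  have dI: "disjoint_family_on D (I B)" if "B \<in> \<B>" for B
    using D(2) I(1)[OF that] by (rule disjoint_family_on_mono[rotated])
  have mB: "emeasure M B = (\<Sum>i\<in>I B. emeasure M (D i))" if "B \<in> \<B>" "sets M = sets \<nu>" for B M
    using that D(1) I(1)[OF that(1)] by (subst I(2)[OF that(1)])
      (intro sum_emeasure[symmetric] finI dI, auto)
  have ind: "indicator B x = (\<Sum>i\<in>I B. indicator (D i) x :: ennreal)" if "B \<in> \<B>" for B x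
    by (subst I(2)[OF that]) (rule indicator_UN_disjoint[OF finI[OF that] dI[OF that]])
  \<comment> \<open>The indicator of G as a function of the vector of counts; each tested set is
    recovered by summing over the pieces in \<open>I B\<close>.\<close>
  define \<Phi> :: "(nat \<Rightarrow> ennreal) \<Rightarrow> ennreal"
    where "\<Phi> z = (if \<forall>B\<in>J. (\<Sum>i\<in>I B. z i) \<in> V B then 1 else 0)" for z
  have JB: "B \<in> \<B>" if "B \<in> J" for B using that by (simp add: \<B>_def)
  have [measurable]: "(\<lambda>z. \<Sum>i\<in>I B. z i) \<in> borel_measurable (PiM {..<m} (\<lambda>_. borel :: ennreal measure))" if "B \<in> J" for B
    using I(1)[OF JB[OF that]] by (intro borel_measurable_sum measurable_component_singleton) auto
  have \<Phi> [measurable]: "\<Phi> \<in> borel_measurable (PiM {..<m} (\<lambda>_. borel))"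
    unfolding \<Phi>_def using J(1) by measurable
  have \<Phi>_cong: "\<Phi> z = \<Phi> z'" if "\<And>i. i < m \<Longrightarrow> z i = z' i" for z z'
  proof -
    have "(\<Sum>i\<in>I B. z i) = (\<Sum>i\<in>I B. z' i)" if "B \<in> J" for B
      using I(1)[OF JB[OF that]] \<open>\<And>i. i < m \<Longrightarrow> z i = z' i\<close> by (intro sum.cong) auto
    then show ?thesis by (simp add: \<Phi>_def)
  qed
  have G\<Phi>: "indicator G M = \<Phi> (\<lambda>i\<in>{..<m}. emeasure M (D i))" if "M \<in> space config" for M
  proof -
    have "sets M = sets \<nu>" using that by (simp add: space_locally_finite_measures)
    then have "indicator G M = \<Phi> (\<lambda>i. emeasure M (D i))"
      using that mB[OF JB] by (auto simp: GJ cylinder_def \<Phi>_def split: split_indicator)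
    also have "\<dots> = \<Phi> (\<lambda>i\<in>{..<m}. emeasure M (D i))" by (rule \<Phi>_cong) simp
    finally show ?thesis .
  qed
  \<comment> \<open>The probability of G after a point has been added anywhere in
    \<open>D i\<close>. It depends only on the piece and not on the point, which is why the integral
    over A becomes a finite sum.\<close>
  define c where "c i = (\<integral>\<^sup>+\<omega>. \<Phi> (\<lambda>j\<in>{..<m}. emeasure (N \<omega>) (D j) + (if j = i then 1 else 0)) \<partial>P)" for i
  have AB: "A \<in> \<B>" by (simp add: \<B>_def)
  note [measurable] = measurable_N[OF D(1)]
  have "(\<integral>\<^sup>+\<omega>. emeasure (N' \<omega>) A * indicator G (N' \<omega>) \<partial>P)
    = (\<integral>\<^sup>+\<omega>. (\<Sum>i\<in>I A. emeasure (N \<omega>) (D i) * \<Phi> (\<lambda>j\<in>{..<m}. emeasure (N \<omega>) (D j))) \<partial>P)"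
  proof (rule nn_integral_cong_AE)
    show "AE \<omega> in P. emeasure (N' \<omega>) A * indicator G (N' \<omega>)
      = (\<Sum>i\<in>I A. emeasure (N \<omega>) (D i) * \<Phi> (\<lambda>j\<in>{..<m}. emeasure (N \<omega>) (D j)))"
      using AE_N' AE_space
    proof eventually_elim
      case (elim \<omega>)
      have "N \<omega> \<in> space config" using measurable_space[OF measurable_N' elim(2)] elim(1) by simp
      from G\<Phi>[OF this] show ?case
        using mB[OF AB sets_N[OF elim(2)]] elim(1) by (simp add: sum_distrib_right)
    qed
  qed
  also have "\<dots> = (\<Sum>i\<in>I A. (\<integral>\<^sup>+\<omega>. emeasure (N \<omega>) (D i) * \<Phi> (\<lambda>j\<in>{..<m}. emeasure (N \<omega>) (D j)) \<partial>P))"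
    using I(1)[OF AB] by (intro nn_integral_sum) (auto intro!: borel_measurable_times measurable_compose[OF _ \<Phi>] measurable_restrict)
  also have "\<dots> = (\<Sum>i\<in>I A. emeasure \<nu> (D i) * c i)"
    using I(1)[OF AB] unfolding c_def
    by (intro sum.cong refl poisson_counts_shift[OF prm D(1) Dfin D(2) _ \<Phi>]) auto
  also have "\<dots> = (\<Sum>i\<in>I A. (\<integral>\<^sup>+x. c i * indicator (D i) x \<partial>\<nu>))"
    using I(1)[OF AB] D(1) by (intro sum.cong refl) (auto simp: nn_integral_cmult_indicator mult.commute)
  also have "\<dots> = (\<integral>\<^sup>+x. (\<Sum>i\<in>I A. c i * indicator (D i) x) \<partial>\<nu>)"
    using I(1)[OF AB] D(1) by (intro nn_integral_sum[symmetric]) (auto intro!: borel_measurable_times)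
  also have "\<dots> = (\<integral>\<^sup>+x. indicator A x * (\<integral>\<^sup>+\<omega>. indicator G (add_point (N' \<omega>) 1 x) \<partial>P) \<partial>\<nu>)"
  proof (rule nn_integral_cong)
    fix x assume x: "x \<in> space \<nu>"
    have ci: "(\<integral>\<^sup>+\<omega>. indicator G (add_point (N' \<omega>) 1 x) \<partial>P) = c i" if i: "i < m" "x \<in> D i" for i
      unfolding c_def
    proof (rule nn_integral_cong_AE)
      show "AE \<omega> in P. indicator G (add_point (N' \<omega>) 1 x)
        = \<Phi> (\<lambda>j\<in>{..<m}. emeasure (N \<omega>) (D j) + (if j = i then 1 else 0))"
        using AE_N' AE_space
      proof eventually_elim
        case (elim \<omega>)
        have "add_point (N' \<omega>) 1 x \<in> space config"
          using measurable_space[OF measurable_add_point_config, of "(x, \<omega>)"] x elim(2)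
          by (simp add: space_pair_measure)
        moreover have "emeasure (add_point (N \<omega>) 1 x) (D j) = emeasure (N \<omega>) (D j) + (if j = i then 1 else 0)"
          if "j < m" for j
        proof -
          have "x \<in> D j \<longleftrightarrow> j = i" using D(2) i that by (auto simp: disjoint_family_on_def)
          then show ?thesis using D(1)[OF that] sets_N[OF elim(2)]
            by (auto simp: emeasure_add_point split: split_indicator)
        qed
        ultimately show ?case using elim(1) by (simp add: G\<Phi> cong: restrict_cong)
      qed
    qed
    have "(\<Sum>i\<in>I A. c i * indicator (D i) x) = (\<Sum>i\<in>I A. indicator (D i) x * (\<integral>\<^sup>+\<omega>. indicator G (add_point (N' \<omega>) 1 x) \<partial>P))"
      using I(1)[OF AB] ci by (intro sum.cong refl) (auto split: split_indicator)
    then show "(\<Sum>i\<in>I A. c i * indicator (D i) x) = indicator A x * (\<integral>\<^sup>+\<omega>. indicator G (add_point (N' \<omega>) 1 x) \<partial>P)"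
      by (simp add: ind[OF AB, of x] sum_distrib_right)
  qed
  finally show ?thesis .
qed

lemma sf_kernel_N': "sf_kernel P \<nu> N'"
  by (rule sf_kernel_comp[OF sf_kernel_locally_finite[OF F(1-3)] measurable_N'])

text \<open>Both sides are integrals of g with respect to measures on points and configurations. It
  suffices that these agree on boxes, which form an intersection-stable generator, and are finite on
  an exhausting sequence of boxes.\<close>

theorem mecke:
  assumes g: "g \<in> borel_measurable (\<nu> \<Otimes>\<^sub>M config)"
  shows "(\<integral>\<^sup>+\<omega>. (\<integral>\<^sup>+x. g (x, N' \<omega>) \<partial>N' \<omega>) \<partial>P) = (\<integral>\<^sup>+x. (\<integral>\<^sup>+\<omega>. g (x, add_point (N' \<omega>) 1 x) \<partial>P) \<partial>\<nu>)"
proof -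
  \<comment> \<open>\<open>M1\<close> is the Campbell measure, which pairs a configuration with one
    of its own points; \<open>M2\<close> pairs an independent point, distributed by the intensity,
    with the configuration enlarged by it.\<close>
  define M1 where "M1 = distr (semidirect P \<nu> N') (\<nu> \<Otimes>\<^sub>M config) (\<lambda>p. (snd p, N' (fst p)))"
  define M2 where "M2 = distr (\<nu> \<Otimes>\<^sub>M P) (\<nu> \<Otimes>\<^sub>M config) (\<lambda>p. (fst p, case p of (x, \<omega>) \<Rightarrow> add_point (N' \<omega>) 1 x))"
  have m1 [measurable]: "(\<lambda>p. (snd p, N' (fst p))) \<in> measurable (semidirect P \<nu> N') (\<nu> \<Otimes>\<^sub>M config)"
    by measurable
  have m2 [measurable]: "(\<lambda>p. (fst p, case p of (x, \<omega>) \<Rightarrow> add_point (N' \<omega>) 1 x)) \<in> measurable (\<nu> \<Otimes>\<^sub>M P) (\<nu> \<Otimes>\<^sub>M config)"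
    by (intro measurable_Pair measurable_fst measurable_add_point_config)
  have i1: "(\<integral>\<^sup>+p. f p \<partial>M1) = (\<integral>\<^sup>+\<omega>. (\<integral>\<^sup>+x. f (x, N' \<omega>) \<partial>N' \<omega>) \<partial>P)"
    if f [measurable]: "f \<in> borel_measurable (\<nu> \<Otimes>\<^sub>M config)" for f
  proof -
    have "(\<lambda>p. f (snd p, N' (fst p))) \<in> borel_measurable (P \<Otimes>\<^sub>M \<nu>)" by measurable
    then show ?thesis unfolding M1_def
      by (subst nn_integral_distr[OF m1]) (simp_all add: nn_integral_semidirect[OF sf_kernel_N'])
  qed
  have i2: "(\<integral>\<^sup>+p. f p \<partial>M2) = (\<integral>\<^sup>+x. (\<integral>\<^sup>+\<omega>. f (x, add_point (N' \<omega>) 1 x) \<partial>P) \<partial>\<nu>)"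
    if f: "f \<in> borel_measurable (\<nu> \<Otimes>\<^sub>M config)" for f
    unfolding M2_def
    using P.nn_integral_fst[OF measurable_compose[OF m2 f]] f by (subst nn_integral_distr[OF m2]) simp_all
  let ?Fin = "{A\<in>sets \<nu>. emeasure \<nu> A < \<infinity>}"
  let ?E = "{a \<times> b | a b. a \<in> ?Fin \<and> b \<in> cylinders}"
  have sE: "sets (\<nu> \<Otimes>\<^sub>M config) = sigma_sets (space \<nu> \<times> space config) ?E"
  proof -
    have "sets (\<nu> \<Otimes>\<^sub>M config) = sets (sigma (space \<nu> \<times> space config) ?E)"
    proof (rule sets_pair_eq)
      show "?Fin \<subseteq> Pow (space \<nu>)" using sets.sets_into_space by auto
      show "countable (range F)" "range F \<subseteq> ?Fin" "\<Union> (range F) = space \<nu>" using F by auto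
      show "countable {space config}" "{space config} \<subseteq> cylinders" "\<Union> {space config} = space config"
        using space_config_in_cylinders by auto
    qed (use cylinders_subset sets_config incseq_exhaust_finite_generates[OF F] in auto)
    also have "\<dots> = sigma_sets (space \<nu> \<times> space config) ?E"
      using cylinders_subset sets.sets_into_space by (intro sets_measure_of) fastforce
    finally show ?thesis .
  qed
  have box: "emeasure M1 (A \<times> G) = (\<integral>\<^sup>+\<omega>. emeasure (N' \<omega>) A * indicator G (N' \<omega>) \<partial>P)"
     "emeasure M2 (A \<times> G) = (\<integral>\<^sup>+x. indicator A x * (\<integral>\<^sup>+\<omega>. indicator G (add_point (N' \<omega>) 1 x) \<partial>P) \<partial>\<nu>)"
    if A: "A \<in> sets \<nu>" and G: "G \<in> sets config" for A G
  proof -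
    have AG: "A \<times> G \<in> sets (\<nu> \<Otimes>\<^sub>M config)" using A G by simp
    have "emeasure M1 (A \<times> G) = (\<integral>\<^sup>+p. indicator (A \<times> G) p \<partial>M1)" using AG by (simp add: M1_def)
    also have "\<dots> = (\<integral>\<^sup>+\<omega>. (\<integral>\<^sup>+x. indicator G (N' \<omega>) * indicator A x \<partial>N' \<omega>) \<partial>P)"
      using AG by (subst i1) (auto simp: indicator_times mult.commute)
    also have "\<dots> = (\<integral>\<^sup>+\<omega>. emeasure (N' \<omega>) A * indicator G (N' \<omega>) \<partial>P)"
      using A by (intro nn_integral_cong) (subst nn_integral_cmult_indicator, simp_all add: sets_N' mult.commute)
    finally show "emeasure M1 (A \<times> G) = (\<integral>\<^sup>+\<omega>. emeasure (N' \<omega>) A * indicator G (N' \<omega>) \<partial>P)" .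
    have "emeasure M2 (A \<times> G) = (\<integral>\<^sup>+p. indicator (A \<times> G) p \<partial>M2)" using AG by (simp add: M2_def)
    also have "\<dots> = (\<integral>\<^sup>+x. (\<integral>\<^sup>+\<omega>. indicator A x * indicator G (add_point (N' \<omega>) 1 x) \<partial>P) \<partial>\<nu>)"
      using AG by (subst i2) (auto simp: indicator_times)
    also have "\<dots> = (\<integral>\<^sup>+x. indicator A x * (\<integral>\<^sup>+\<omega>. indicator G (add_point (N' \<omega>) 1 x) \<partial>P) \<partial>\<nu>)"
      by (intro nn_integral_cong) (auto split: split_indicator)
    finally show "emeasure M2 (A \<times> G) = (\<integral>\<^sup>+x. indicator A x * (\<integral>\<^sup>+\<omega>. indicator G (add_point (N' \<omega>) 1 x) \<partial>P) \<partial>\<nu>)" .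
  qed
  have cyl: "G \<in> sets config" if "G \<in> cylinders" for G
    unfolding sets_config using that by (rule sigma_sets.Basic)
  have "M1 = M2"
  proof (rule measure_eqI_generator_eq)
    show "Int_stable ?E"
    proof (rule Int_stableI)
      fix u v assume "u \<in> ?E" "v \<in> ?E"
      then obtain a b a' b' where *: "u = a \<times> b" "v = a' \<times> b'" "a \<in> ?Fin" "a' \<in> ?Fin" "b \<in> cylinders" "b' \<in> cylinders"
        by blast
      have "u \<inter> v = (a \<inter> a') \<times> (b \<inter> b')" unfolding * by auto
      moreover have "a \<inter> a' \<in> ?Fin"
        using * le_less_trans[OF emeasure_mono[of "a \<inter> a'" a \<nu>], of \<infinity>] by auto
      moreover have "b \<inter> b' \<in> cylinders" using Int_stable_cylinders * by (auto simp: Int_stable_def)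
      ultimately show "u \<inter> v \<in> ?E" by blast
    qed
    show "?E \<subseteq> Pow (space \<nu> \<times> space config)" using cylinders_subset sets.sets_into_space by fastforce
    show "emeasure M1 X = emeasure M2 X" if "X \<in> ?E" for X
      using that box cyl mecke_box by auto
    show "sets M1 = sigma_sets (space \<nu> \<times> space config) ?E" "sets M2 = sigma_sets (space \<nu> \<times> space config) ?E"
      using sE by (simp_all add: M1_def M2_def)
    show "range (\<lambda>k. F k \<times> space config) \<subseteq> ?E" using F(2,4) space_config_in_cylinders by auto
    show "(\<Union>k. F k \<times> space config) = space \<nu> \<times> space config" using F(3) by auto
    \<comment> \<open>Through the equality on boxes the bound may be read off \<open>M2\<close>,
      where the inner integral is at most 1 and the mass is at most the intensity of
      \<open>F k\<close>.\<close>
    show "emeasure M1 (F k \<times> space config) \<noteq> \<infinity>" for k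
    proof -
      have "emeasure M1 (F k \<times> space config) = emeasure M2 (F k \<times> space config)"
        using box[OF F(2) sets.top] mecke_box[OF F(2,4) space_config_in_cylinders] by simp
      also have "\<dots> \<le> (\<integral>\<^sup>+x. indicator (F k) x * 1 \<partial>\<nu>)"
        unfolding box(2)[OF F(2) sets.top]
      proof (intro nn_integral_mono mult_left_mono)
        fix x
        have "(\<integral>\<^sup>+\<omega>. indicator (space config) (add_point (N' \<omega>) 1 x) \<partial>P) \<le> (\<integral>\<^sup>+\<omega>. 1 \<partial>P)"
          by (intro nn_integral_mono) (simp split: split_indicator)
        then show "(\<integral>\<^sup>+\<omega>. indicator (space config) (add_point (N' \<omega>) 1 x) \<partial>P) \<le> 1"
          by (simp add: P.emeasure_space_1)
      qed simp
      also have "\<dots> < \<infinity>" using F(2,4) by simp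
      finally show ?thesis by simp
    qed
  qed
  then show ?thesis using i1[OF g] i2[OF g] by simp
qed

end

section \<open>Weighted Poisson random measures\<close>

text \<open>For an integrand without parameter, measurability of all evaluations suffices. This
  version is applied to \<open>N\<close> itself, which, in contrast to \<open>N'\<close>, may be
  infinite on some \<open>F k\<close> at exceptional outcomes.\<close>

lemma measurable_nn_integral_const_integrand:
  assumes "f \<in> borel_measurable Z" "\<And>\<omega>. \<omega> \<in> space M \<Longrightarrow> sets (K \<omega>) = sets Z"
    and "\<And>A. A \<in> sets Z \<Longrightarrow> (\<lambda>\<omega>. emeasure (K \<omega>) A) \<in> borel_measurable M"
  shows "(\<lambda>\<omega>. \<integral>\<^sup>+z. f z \<partial>K \<omega>) \<in> borel_measurable M"
  using assms(1)
proof (induction rule: borel_measurable_induct)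
  case (cong f g)
  have eq: "(\<integral>\<^sup>+z. f z \<partial>K \<omega>) = (\<integral>\<^sup>+z. g z \<partial>K \<omega>)" if "\<omega> \<in> space M" for \<omega>
    using cong(3) sets_eq_imp_space_eq[OF assms(2)[OF that]] by (intro nn_integral_cong) simp
  show ?case using cong.IH by (simp only: measurable_cong[OF eq])
next
  case (set A)
  have eq: "(\<integral>\<^sup>+z. indicator A z \<partial>K \<omega>) = emeasure (K \<omega>) A" if "\<omega> \<in> space M" for \<omega>
    using set assms(2)[OF that] by simp
  show ?case using assms(3)[OF set] by (simp only: measurable_cong[OF eq])
next
  case (mult u c)
  have eq: "(\<integral>\<^sup>+z. c * u z \<partial>K \<omega>) = c * (\<integral>\<^sup>+z. u z \<partial>K \<omega>)" if "\<omega> \<in> space M" for \<omega>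
    using mult assms(2)[OF that] by (intro nn_integral_cmult) (simp cong: measurable_cong_sets)
  have "(\<lambda>\<omega>. c * (\<integral>\<^sup>+z. u z \<partial>K \<omega>)) \<in> borel_measurable M"
    by (rule measurable_compose[OF mult.IH]) measurable
  then show ?case by (simp only: measurable_cong[OF eq])
next
  case (add u v)
  have eq: "(\<integral>\<^sup>+z. v z + u z \<partial>K \<omega>) = (\<integral>\<^sup>+z. v z \<partial>K \<omega>) + (\<integral>\<^sup>+z. u z \<partial>K \<omega>)" if "\<omega> \<in> space M" for \<omega>
    using add assms(2)[OF that] by (intro nn_integral_add) (simp_all cong: measurable_cong_sets)
  note [measurable] = add.IH
  have "(\<lambda>\<omega>. (\<integral>\<^sup>+z. v z \<partial>K \<omega>) + (\<integral>\<^sup>+z. u z \<partial>K \<omega>)) \<in> borel_measurable M" by measurable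
  then show ?case by (simp only: measurable_cong[OF eq])
next
  case (seq U)
  have eq: "(\<integral>\<^sup>+z. (SUP i. U i z) \<partial>K \<omega>) = (SUP i. \<integral>\<^sup>+z. U i z \<partial>K \<omega>)" if "\<omega> \<in> space M" for \<omega>
    using seq(1,3) by (intro nn_integral_monotone_convergence_SUP) (simp_all add: measurable_cong_sets[OF assms(2)[OF that] refl])
  have [measurable]: "(\<lambda>\<omega>. \<integral>\<^sup>+z. U i z \<partial>K \<omega>) \<in> borel_measurable M" for i by (rule seq.IH)
  have "(\<lambda>\<omega>. SUP i. \<integral>\<^sup>+z. U i z \<partial>K \<omega>) \<in> borel_measurable M" by measurable
  then have "(\<lambda>\<omega>. \<integral>\<^sup>+z. (SUP i. U i z) \<partial>K \<omega>) \<in> borel_measurable M"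
    by (simp only: measurable_cong[OF eq])
  then show ?case unfolding seq(4) by (simp add: image_comp)
qed

lemma sf_kernel_cong_sets: "sets M = sets M' \<Longrightarrow> sf_kernel M Z K = sf_kernel M' Z K"
  by (simp only: sf_kernel_def sets_eq_imp_space_eq[of M M'] measurable_cong_sets[of M M' borel borel])

text \<open>Bounded finiteness reduces to countably many conditions. Hence it is a measurable event,
  and it holds almost surely as soon as each condition does.\<close>

lemma bf_measures_iff_ball:
  fixes m :: "'y::polish_space measure"
  assumes "sets m = sets borel"
  shows "m \<in> space bf_measures \<longleftrightarrow> (\<forall>k::nat. emeasure m (ball c (real k)) < \<infinity>)"
proof
  assume *: "\<forall>k::nat. emeasure m (ball c (real k)) < \<infinity>"
  have "emeasure m B < \<infinity>" if B: "bounded B" for B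
  proof -
    obtain r where "B \<subseteq> ball c r" using bounded_subset_ballD[OF B, of c] by blast
    moreover obtain k :: nat where "r \<le> real k" using real_arch_simple by blast
    ultimately have "B \<subseteq> ball c (real k)" by (meson order_trans subset_ball)
    then have "emeasure m B \<le> emeasure m (ball c (real k))" using assms by (intro emeasure_mono) auto
    with * show ?thesis by (meson le_less_trans)
  qed
  then show "m \<in> space bf_measures" using assms by (simp add: space_bf_measures)
qed (simp add: space_bf_measures)

lemma measurable_add_point_bf:
  fixes a :: "'q \<Rightarrow> 'y::polish_space measure"
  assumes "a \<in> measurable Q bf_measures" "b \<in> borel_measurable Q" "c \<in> borel_measurable Q"
    and "\<And>q. q \<in> space Q \<Longrightarrow> c q < \<infinity>"
  shows "(\<lambda>q. add_point (a q) (c q) (b q)) \<in> measurable Q bf_measures"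
  using assms unfolding bf_measures_eq_locally_finite
  by (intro measurable_add_point_locally_finite) auto

lemma sets_weighted_measure [simp]: "sets (weighted_measure h m) = sets borel"
  by (simp add: weighted_measure_def)

lemma nn_integral_weighted_measure:
  fixes h :: "'s::polish_space \<Rightarrow> real" and m :: "('s \<times> 'y::polish_space) measure"
  assumes [measurable]: "h \<in> borel_measurable borel" "f \<in> borel_measurable borel"
    and m: "sets m = sets (borel \<Otimes>\<^sub>M borel)"
  shows "(\<integral>\<^sup>+y. f y \<partial>weighted_measure h m) = (\<integral>\<^sup>+x. ennreal (h (fst x)) * f (snd x) \<partial>m)"
proof -
  note [measurable_cong] = m
  show ?thesis unfolding weighted_measure_def
    by (subst nn_integral_distr) (auto simp: nn_integral_density case_prod_beta)
qed

lemma emeasure_weighted_measure: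
  fixes h :: "'s::polish_space \<Rightarrow> real" and m :: "('s \<times> 'y::polish_space) measure"
  assumes "h \<in> borel_measurable borel" "sets m = sets (borel \<Otimes>\<^sub>M borel)" "B \<in> sets borel"
  shows "emeasure (weighted_measure h m) B = (\<integral>\<^sup>+x. ennreal (h (fst x)) * indicator B (snd x) \<partial>m)"
  using nn_integral_weighted_measure[OF assms(1) _ assms(2), of "indicator B"] assms(3) by simp

lemma weighted_measure_add_point:
  fixes h :: "'s::polish_space \<Rightarrow> real" and m :: "('s \<times> 'y::polish_space) measure"
  assumes h [measurable]: "h \<in> borel_measurable borel" and m: "sets m = sets (borel \<Otimes>\<^sub>M borel)"
  shows "weighted_measure h (add_point m 1 x) = add_point (weighted_measure h m) (ennreal (h (fst x))) (snd x)"
proof (rule measure_eqI)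
  note [measurable_cong] = m
  fix B assume "B \<in> sets (weighted_measure h (add_point m 1 x))"
  then have [measurable]: "B \<in> sets borel" by simp
  have "x \<in> space m" using sets_eq_imp_space_eq[OF m] by (simp add: space_pair_measure)
  then have "(\<integral>\<^sup>+x. ennreal (h (fst x)) * indicator B (snd x) \<partial>add_point m 1 x)
    = (\<integral>\<^sup>+x. ennreal (h (fst x)) * indicator B (snd x) \<partial>m) + 1 * (ennreal (h (fst x)) * indicator B (snd x))"
    by (intro nn_integral_add_point) measurable
  then show "emeasure (weighted_measure h (add_point m 1 x)) B
    = emeasure (add_point (weighted_measure h m) (ennreal (h (fst x))) (snd x)) B"
    using m by (simp add: emeasure_weighted_measure emeasure_add_point)
qed simp

section \<open>The completely random measure and its Palm formula\<close>

locale crm =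
  fixes \<eta> :: "'y::polish_space measure" and \<rho> :: "'y \<Rightarrow> 's::polish_space measure" and h :: "'s \<Rightarrow> real"
    and P :: "'w measure" and N :: "'w \<Rightarrow> ('s \<times> 'y) measure"
  assumes sets_\<eta> [simp, measurable_cong]: "sets \<eta> = sets borel" and sigma_finite_\<eta>: "sigma_finite_measure \<eta>"
    and non_atomic: "non_atomic \<eta>" and kernel: "measurable_kernel \<rho>"
    and h [measurable]: "h \<in> borel_measurable borel" and h_pos: "\<And>s. 0 < h s"
    and levy: "\<And>B. B \<in> sets borel \<Longrightarrow> bounded B \<Longrightarrow>
      (\<integral>\<^sup>+y\<in>B. (\<integral>\<^sup>+s. ennreal (min (h s) 1) \<partial>\<rho> y) \<partial>\<eta>) < \<infinity>"
    and prm: "poisson_random_measure P (intensity \<rho> \<eta>) N"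
    and kappa_finite: "\<And>k y. 1 \<le> k \<Longrightarrow> kappa h \<rho> k y < \<infinity>"
begin

lemma sets_\<rho> [simp, measurable_cong]: "sets (\<rho> y) = sets borel"
  using kernel by (simp add: measurable_kernel_def)

text \<open>These sets increase to the whole space because h is positive, and on
  \<open>big k\<close> the function min(h, 1) is at least 1/(k+1). So their
  \<open>\<rho>\<close>-mass is controlled by the integral of min(h, 1), even where
  \<open>\<rho>\<close> is infinite because of many small jumps.\<close>

definition big :: "nat \<Rightarrow> 's set" where
  "big k = {s. 1 / real (Suc k) \<le> h s}"

lemma sets_big [measurable]: "big k \<in> sets borel"
proof -
  have "{s \<in> space borel. 1 / real (Suc k) \<le> h s} \<in> sets borel" by measurable
  then show ?thesis by (simp add: big_def)
qed

lemma incseq_big: "incseq big"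
proof (rule incseq_SucI)
  fix k
  have "1 / real (Suc (Suc k)) \<le> 1 / real (Suc k)" by (simp add: frac_le)
  then show "big k \<subseteq> big (Suc k)" unfolding big_def by (auto intro: order_trans)
qed

lemma UN_big: "(\<Union>k. big k) = UNIV"
proof (intro set_eqI iffI UNIV_I)
  fix s
  obtain k where "inverse (real (Suc k)) < h s" using reals_Archimedean[OF h_pos] by blast
  then show "s \<in> (\<Union>k. big k)" by (auto simp: big_def inverse_eq_divide intro: less_imp_le)
qed

lemma indicator_big_le_min: "indicator (big k) s \<le> ennreal (real (Suc k)) * ennreal (min (h s) 1)"
proof (cases "s \<in> big k")
  case True
  then have "1 \<le> real (Suc k) * h s" by (simp add: big_def field_simps)
  then have "1 \<le> real (Suc k) * min (h s) 1" by (auto simp: min_def)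
  then have "ennreal 1 \<le> ennreal (real (Suc k) * min (h s) 1)" by (rule ennreal_leI)
  then show ?thesis using h_pos[of s] True by (simp add: ennreal_mult del: of_nat_Suc)
qed simp

text \<open>A kernel needs finiteness at every y, whereas the Levy condition gives it only almost
  everywhere. The bound min(h, 1) <= h and the finiteness of \<open>kappa\<close> with exponent 1
  provide it everywhere.\<close>

lemma nn_integral_min_finite: "(\<integral>\<^sup>+s. ennreal (min (h s) 1) \<partial>\<rho> y) < \<infinity>"
proof -
  have "(\<integral>\<^sup>+s. ennreal (min (h s) 1) \<partial>\<rho> y) \<le> kappa h \<rho> 1 y"
    unfolding kappa_def by (intro nn_integral_mono ennreal_leI) simp
  also have "\<dots> < \<infinity>" by (rule kappa_finite) simp
  finally show ?thesis .
qed

lemma emeasure_big_le: "emeasure (\<rho> y) (big k) \<le> ennreal (real (Suc k)) * (\<integral>\<^sup>+s. ennreal (min (h s) 1) \<partial>\<rho> y)"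
proof -
  have "emeasure (\<rho> y) (big k) = (\<integral>\<^sup>+s. indicator (big k) s \<partial>\<rho> y)" by simp
  also have "\<dots> \<le> (\<integral>\<^sup>+s. ennreal (real (Suc k)) * ennreal (min (h s) 1) \<partial>\<rho> y)"
    by (intro nn_integral_mono indicator_big_le_min)
  also have "\<dots> = ennreal (real (Suc k)) * (\<integral>\<^sup>+s. ennreal (min (h s) 1) \<partial>\<rho> y)"
    by (intro nn_integral_cmult) measurable
  finally show ?thesis .
qed

lemma sf_kernel_\<rho>: "sf_kernel borel borel \<rho>"
proof (rule sf_kernelI[where F=big])
  show "(\<lambda>y. emeasure (\<rho> y) A) \<in> borel_measurable borel" if "A \<in> sets borel" for A
    using that kernel by (simp add: measurable_kernel_def)
  show "emeasure (\<rho> y) (big k) < \<infinity>" for k y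
    using nn_integral_min_finite[of y]
    by (intro le_less_trans[OF emeasure_big_le]) (simp add: ennreal_mult_less_top)
qed (auto simp: incseq_big UN_big)

lemma sf_kernel_\<eta>_\<rho>: "sf_kernel \<eta> borel \<rho>"
  using sf_kernel_\<rho> by (simp add: sf_kernel_cong_sets[OF sets_\<eta>])

abbreviation \<nu> :: "('s \<times> 'y) measure" where "\<nu> \<equiv> intensity \<rho> \<eta>"

lemma sets_\<nu> [simp, measurable_cong]: "sets \<nu> = sets (borel \<Otimes>\<^sub>M borel)"
  by (simp add: intensity_def)

lemma space_\<nu> [simp]: "space \<nu> = UNIV"
  using sets_eq_imp_space_eq[OF sets_\<nu>] by (simp add: space_pair_measure)

lemma nn_integral_\<nu>:
  assumes f [measurable]: "f \<in> borel_measurable (borel \<Otimes>\<^sub>M borel)"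
  shows "(\<integral>\<^sup>+x. f x \<partial>\<nu>) = (\<integral>\<^sup>+y. (\<integral>\<^sup>+s. f (s, y) \<partial>\<rho> y) \<partial>\<eta>)"
proof -
  have [measurable]: "prod.swap \<in> measurable (semidirect \<eta> borel \<rho>) (borel \<Otimes>\<^sub>M borel)"
    unfolding prod.swap_def by measurable
  have "(\<integral>\<^sup>+x. f x \<partial>\<nu>) = (\<integral>\<^sup>+p. f (prod.swap p) \<partial>semidirect \<eta> borel \<rho>)"
    unfolding intensity_def by (rule nn_integral_distr) measurable
  also have "\<dots> = (\<integral>\<^sup>+y. (\<integral>\<^sup>+s. f (prod.swap (y, s)) \<partial>\<rho> y) \<partial>\<eta>)"
    by (intro nn_integral_semidirect[OF sf_kernel_\<eta>_\<rho>] measurable_compose[OF _ f])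
      (simp add: prod.swap_def)
  finally show ?thesis by simp
qed

definition F :: "nat \<Rightarrow> ('s \<times> 'y) set" where
  "F k = big k \<times> ball undefined (real k)"

lemma nn_integral_\<nu>_bounded:
  assumes f [measurable]: "f \<in> borel_measurable borel" and B: "B \<in> sets borel" "bounded B"
    and le: "\<And>s. f s \<le> ennreal c * ennreal (min (h s) 1)"
  shows "(\<integral>\<^sup>+x. f (fst x) * indicator B (snd x) \<partial>\<nu>) < \<infinity>"
proof -
  note [measurable] = B(1)
  have [measurable]: "(\<lambda>y. \<integral>\<^sup>+s. ennreal (min (h s) 1) \<partial>\<rho> y) \<in> borel_measurable borel"
    using measurable_nn_integral_sf_kernel[OF sf_kernel_\<rho>, of "\<lambda>p. ennreal (min (h (snd p)) 1)"] by simp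
  have m: "(\<lambda>y. (\<integral>\<^sup>+s. ennreal (min (h s) 1) \<partial>\<rho> y) * indicator B y) \<in> borel_measurable \<eta>"
    unfolding measurable_cong_sets[OF sets_\<eta> refl] using B(1) by measurable
  have "(\<integral>\<^sup>+x. f (fst x) * indicator B (snd x) \<partial>\<nu>) = (\<integral>\<^sup>+y. (\<integral>\<^sup>+s. f s * indicator B y \<partial>\<rho> y) \<partial>\<eta>)"
    by (subst nn_integral_\<nu>) auto
  also have "\<dots> \<le> (\<integral>\<^sup>+y. ennreal c * ((\<integral>\<^sup>+s. ennreal (min (h s) 1) \<partial>\<rho> y) * indicator B y) \<partial>\<eta>)"
  proof (rule nn_integral_mono)
    fix y
    have "(\<integral>\<^sup>+s. f s * indicator B y \<partial>\<rho> y) \<le> (\<integral>\<^sup>+s. (ennreal c * indicator B y) * ennreal (min (h s) 1) \<partial>\<rho> y)"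
      using le by (intro nn_integral_mono) (auto split: split_indicator)
    also have "\<dots> = (ennreal c * indicator B y) * (\<integral>\<^sup>+s. ennreal (min (h s) 1) \<partial>\<rho> y)"
      by (intro nn_integral_cmult) measurable
    finally show "(\<integral>\<^sup>+s. f s * indicator B y \<partial>\<rho> y)
        \<le> ennreal c * ((\<integral>\<^sup>+s. ennreal (min (h s) 1) \<partial>\<rho> y) * indicator B y)" by (simp add: mult_ac)
  qed
  also have "\<dots> = ennreal c * (\<integral>\<^sup>+y\<in>B. (\<integral>\<^sup>+s. ennreal (min (h s) 1) \<partial>\<rho> y) \<partial>\<eta>)"
    by (rule nn_integral_cmult[OF m])
  also have "\<dots> < \<infinity>" using levy[OF B] by (simp add: ennreal_mult_less_top)
  finally show ?thesis .
qed

lemma emeasure_\<nu>_box_finite: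
  assumes "A \<in> sets borel" "B \<in> sets borel" "bounded B" "\<And>s. indicator A s \<le> ennreal c * ennreal (min (h s) 1)"
  shows "emeasure \<nu> (A \<times> B) < \<infinity>"
proof -
  have "emeasure \<nu> (A \<times> B) = (\<integral>\<^sup>+x. indicator (A \<times> B) x \<partial>\<nu>)" using assms by simp
  also have "\<dots> = (\<integral>\<^sup>+x. indicator A (fst x) * indicator B (snd x) \<partial>\<nu>)"
    by (intro nn_integral_cong) (auto simp: indicator_times)
  also have "\<dots> < \<infinity>" using assms by (intro nn_integral_\<nu>_bounded[where c=c]) auto
  finally show ?thesis .
qed

sublocale poisson_process P \<nu> N F
proof
  show "poisson_random_measure P \<nu> N" by (rule prm)
  show "incseq F" using incseq_big incseq_ball[of "undefined::'y"]
    unfolding F_def incseq_def by (intro allI impI Sigma_mono) auto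
  show "F k \<in> sets \<nu>" for k unfolding F_def by simp
  show "(\<Union>k. F k) = space \<nu>"
  proof (intro equalityI subsetI)
    fix x :: "'s \<times> 'y"
    obtain i where i: "fst x \<in> big i" using UN_big by blast
    obtain j :: nat where j: "snd x \<in> ball undefined (real j)" using UN_ball_UNIV by blast
    have "fst x \<in> big (max i j)" using i incseqD[OF incseq_big, of i "max i j"] by auto
    moreover have "snd x \<in> ball undefined (real (max i j))" using j by auto
    ultimately have "x \<in> F (max i j)" by (simp add: F_def mem_Times_iff)
    then show "x \<in> (\<Union>k. F k)" by blast
  qed simp
  show "emeasure \<nu> (F k) < \<infinity>" for k
    unfolding F_def by (rule emeasure_\<nu>_box_finite[OF _ _ _ indicator_big_le_min]) auto
qed

text \<open>Campbell's formula: the Mecke equation for an integrand that ignores the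
  configuration.\<close>

lemma nn_integral_campbell:
  assumes f: "f \<in> borel_measurable (borel \<Otimes>\<^sub>M borel)"
  shows "(\<integral>\<^sup>+\<omega>. (\<integral>\<^sup>+x. f x \<partial>N' \<omega>) \<partial>P) = (\<integral>\<^sup>+x. f x \<partial>\<nu>)"
proof -
  have [measurable]: "f \<in> borel_measurable \<nu>" using f by (simp cong: measurable_cong_sets)
  have "(\<lambda>p. f (fst p)) \<in> borel_measurable (\<nu> \<Otimes>\<^sub>M config)" by measurable
  from mecke[OF this] show ?thesis by (simp add: P.emeasure_space_1)
qed

text \<open>
  The numbers of jumps exceeding \<open>1, 2, \<dots>\<close> are finite integers decreasing to \<open>0\<close>, hence eventually
  \<open>0\<close>: the jumps are bounded. (Their mean may be infinite.)
\<close>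

lemma AE_large_jumps_finite:
  assumes B: "B \<in> sets borel" "bounded B"
  shows "AE \<omega> in P. (\<integral>\<^sup>+x. ennreal (h (fst x)) * indicator {s. 1 < h s} (fst x) * indicator B (snd x) \<partial>N' \<omega>) < \<infinity>"
proof -
  note [measurable] = B(1)
  define A where "A j = {s. real (Suc j) < h s} \<times> B" for j :: nat
  have [measurable]: "{s. real (Suc j) < h s} \<in> sets borel" for j
  proof -
    have "{s\<in>space borel. real (Suc j) < h s} \<in> sets borel" by measurable
    then show ?thesis by simp
  qed
  have [measurable]: "{s. 1 < h s} \<in> sets borel"
  proof -
    have "{s\<in>space borel. 1 < h s} \<in> sets borel" by measurable
    then show ?thesis by simp
  qed
  have A: "A j \<in> sets \<nu>" "emeasure \<nu> (A j) < \<infinity>" for j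
  proof -
    show "A j \<in> sets \<nu>" unfolding A_def by simp
    have "indicator {s. real (Suc j) < h s} s \<le> ennreal 1 * ennreal (min (h s) 1)" for s
      by (auto simp: min_def split: split_indicator)
    then show "emeasure \<nu> (A j) < \<infinity>" unfolding A_def by (intro emeasure_\<nu>_box_finite[where c=1]) (use B in auto)
  qed
  have "AE \<omega> in P. \<forall>j. \<exists>k::nat. emeasure (N \<omega>) (A j) = of_nat k"
    unfolding AE_all_countable using poisson_count_AE[OF prm A] ..
  then show ?thesis using AE_N' AE_space
  proof eventually_elim
    case (elim \<omega>)
    note sN = sets_N'[OF elim(3)]
    have int: "\<exists>k::nat. emeasure (N' \<omega>) (A j) = of_nat k" for j using elim by simp
    have "(\<lambda>j. emeasure (N' \<omega>) (A j)) \<longlonglongrightarrow> emeasure (N' \<omega>) (\<Inter>j. A j)"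
    proof (rule Lim_emeasure_decseq)
      show "range A \<subseteq> sets (N' \<omega>)" using A(1) sN by auto
      show "decseq A" unfolding A_def decseq_def by (auto intro: order.strict_trans1[rotated])
      show "emeasure (N' \<omega>) (A j) \<noteq> \<infinity>" for j using int[of j] by auto
    qed
    moreover have "(\<Inter>j. A j) = {}"
    proof -
      have "\<exists>j. h s \<le> real (Suc j)" for s using real_arch_simple[of "h s"] by (metis le_SucI of_nat_le_iff order_trans lessI less_imp_le)
      then show ?thesis unfolding A_def by (fastforce simp: not_less[symmetric])
    qed
    ultimately have "(\<lambda>j. emeasure (N' \<omega>) (A j)) \<longlonglongrightarrow> 0" by simp
    then have "eventually (\<lambda>j. emeasure (N' \<omega>) (A j) < 1) sequentially" by (rule order_tendstoD) simp
    then obtain j where j: "emeasure (N' \<omega>) (A j) < 1" by (auto simp: eventually_sequentially)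
    then have j0: "emeasure (N' \<omega>) (A j) = 0"
    proof -
      obtain k :: nat where k: "emeasure (N' \<omega>) (A j) = of_nat k" using int by blast
      have "k = 0" using j unfolding k by (cases k) auto
      then show ?thesis using k by simp
    qed
    \<comment> \<open>Almost no point lies in \<open>A j\<close>, so over B the function h is
      bounded by j + 1. The set \<open>A 0\<close> has threshold 1, thus it contains exactly the
      large jumps over B, and its count is finite.\<close>
    have "(\<integral>\<^sup>+x. ennreal (h (fst x)) * indicator {s. 1 < h s} (fst x) * indicator B (snd x) \<partial>N' \<omega>)
      \<le> (\<integral>\<^sup>+x. ennreal (real (Suc j)) * indicator (A 0) x \<partial>N' \<omega>)"
    proof (rule nn_integral_mono_AE)
      have "AE x in N' \<omega>. x \<notin> A j" using j0 A(1)[of j] sN by (intro AE_not_in) auto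
      then show "AE x in N' \<omega>. ennreal (h (fst x)) * indicator {s. 1 < h s} (fst x) * indicator B (snd x)
        \<le> ennreal (real (Suc j)) * indicator (A 0) x"
        by (rule eventually_mono) (auto simp: A_def not_less split: split_indicator intro!: ennreal_leI simp del: of_nat_Suc)
    qed
    also have "\<dots> = ennreal (real (Suc j)) * emeasure (N' \<omega>) (A 0)"
      using A(1) sN by (intro nn_integral_cmult_indicator) auto
    also have "\<dots> < \<infinity>" using int[of 0] by (auto simp: ennreal_mult_less_top of_nat_less_top)
    finally show ?case .
  qed
qed

text \<open>The jumps are split at size 1. The small ones have finite mean over bounded sets by
  Campbell's formula and the Levy condition; the large ones contribute a finite amount by the
  preceding lemma. Countably many balls suffice, so the null sets can be united.\<close>

lemma AE_weighted_measure_bf: "AE \<omega> in P. weighted_measure h (N' \<omega>) \<in> space bf_measures"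
proof -
  have fin: "AE \<omega> in P. emeasure (weighted_measure h (N' \<omega>)) (ball undefined (real k)) < \<infinity>" for k :: nat
  proof -
    define B where "B = ball (undefined::'y) (real k)"
    have B: "B \<in> sets borel" "bounded B" by (auto simp: B_def)
    note [measurable] = B(1)
    have [measurable]: "{s. h s \<le> 1} \<in> sets borel" "{s. 1 < h s} \<in> sets borel"
    proof -
      have "{s\<in>space borel. h s \<le> 1} \<in> sets borel" "{s\<in>space borel. 1 < h s} \<in> sets borel" by measurable
      then show "{s. h s \<le> 1} \<in> sets borel" "{s. 1 < h s} \<in> sets borel" by simp_all
    qed
    define f where "f s = ennreal (h s) * indicator {s. h s \<le> 1} s" for s
    have [measurable]: "f \<in> borel_measurable borel" unfolding f_def by measurable
    have "f s \<le> ennreal 1 * ennreal (min (h s) 1)" for s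
      by (auto simp: f_def min_def split: split_indicator)
    then have "(\<integral>\<^sup>+x. f (fst x) * indicator B (snd x) \<partial>\<nu>) < \<infinity>"
      by (intro nn_integral_\<nu>_bounded[where c=1]) (use B in auto)
    then have "(\<integral>\<^sup>+\<omega>. (\<integral>\<^sup>+x. f (fst x) * indicator B (snd x) \<partial>N' \<omega>) \<partial>P) \<noteq> \<infinity>"
      by (subst nn_integral_campbell) auto
    moreover have "(\<lambda>\<omega>. \<integral>\<^sup>+x. f (fst x) * indicator B (snd x) \<partial>N' \<omega>) \<in> borel_measurable P"
      by (rule measurable_nn_integral_sf_kernel[OF sf_kernel_N', of "\<lambda>p. f (fst (snd p)) * indicator B (snd (snd p))", simplified])
    ultimately have "AE \<omega> in P. (\<integral>\<^sup>+x. f (fst x) * indicator B (snd x) \<partial>N' \<omega>) \<noteq> \<infinity>"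
      by (intro nn_integral_PInf_AE) auto
    then show ?thesis using AE_large_jumps_finite[OF B] AE_space
    proof eventually_elim
      case (elim \<omega>)
      have sN [measurable_cong]: "sets (N' \<omega>) = sets (borel \<Otimes>\<^sub>M borel)" using sets_N'[OF elim(3)] by simp
      have "emeasure (weighted_measure h (N' \<omega>)) B = (\<integral>\<^sup>+x. ennreal (h (fst x)) * indicator B (snd x) \<partial>N' \<omega>)"
        using sN by (intro emeasure_weighted_measure) auto
      also have "\<dots> = (\<integral>\<^sup>+x. f (fst x) * indicator B (snd x)
          + ennreal (h (fst x)) * indicator {s. 1 < h s} (fst x) * indicator B (snd x) \<partial>N' \<omega>)"
        by (intro nn_integral_cong) (auto simp: f_def split: split_indicator)
      also have "\<dots> = (\<integral>\<^sup>+x. f (fst x) * indicator B (snd x) \<partial>N' \<omega>)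
          + (\<integral>\<^sup>+x. ennreal (h (fst x)) * indicator {s. 1 < h s} (fst x) * indicator B (snd x) \<partial>N' \<omega>)"
        by (intro nn_integral_add) measurable
      also have "\<dots> < \<infinity>" using elim(1,2) by (simp add: less_top)
      finally show ?case by (simp add: B_def)
    qed
  qed
  then have "AE \<omega> in P. \<forall>k::nat. emeasure (weighted_measure h (N' \<omega>)) (ball undefined (real k)) < \<infinity>"
    by (simp add: AE_all_countable)
  then show ?thesis
    by (rule eventually_mono) (simp add: bf_measures_iff_ball[where c=undefined])
qed

text \<open>The map inside \<open>crm_law\<close>, with the same default, viewed as a function of
  the configuration. A function of the random measure thereby becomes a function of the
  configuration, to which \<open>mecke\<close> applies.\<close>

definition bf_weighted :: "('s \<times> 'y) measure \<Rightarrow> 'y measure" where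
  "bf_weighted m = (if weighted_measure h m \<in> space bf_measures then weighted_measure h m else null_measure borel)"

lemma null_measure_bf: "null_measure borel \<in> space (bf_measures :: 'y measure measure)"
  by (simp add: space_bf_measures)

lemma measurable_bf_weighted_comp:
  assumes K: "\<And>\<omega>. \<omega> \<in> space M \<Longrightarrow> sets (K \<omega>) = sets \<nu>"
    and m: "\<And>A. A \<in> sets \<nu> \<Longrightarrow> (\<lambda>\<omega>. emeasure (K \<omega>) A) \<in> borel_measurable M"
  shows "(\<lambda>\<omega>. bf_weighted (K \<omega>)) \<in> measurable M bf_measures"
proof (rule measurable_bfI)
  show "bf_weighted (K \<omega>) \<in> space bf_measures" for \<omega> using null_measure_bf by (auto simp: bf_weighted_def)
  have W [measurable]: "(\<lambda>\<omega>. emeasure (weighted_measure h (K \<omega>)) B) \<in> borel_measurable M" if [measurable]: "B \<in> sets borel" for B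
  proof -
    have "(\<lambda>\<omega>. \<integral>\<^sup>+x. ennreal (h (fst x)) * indicator B (snd x) \<partial>K \<omega>) \<in> borel_measurable M"
      by (rule measurable_nn_integral_const_integrand[where Z=\<nu>]) (use K m in \<open>simp_all\<close>)
    also have "?this \<longleftrightarrow> ?thesis"
      using K by (intro measurable_cong) (simp add: emeasure_weighted_measure)
    finally show ?thesis .
  qed
  have b [measurable]: "Measurable.pred M (\<lambda>\<omega>. weighted_measure h (K \<omega>) \<in> space bf_measures)"
    unfolding bf_measures_iff_ball[OF sets_weighted_measure, where c=undefined] by measurable
  fix B :: "'y set" assume [measurable]: "B \<in> sets borel"
  have "(\<lambda>\<omega>. if weighted_measure h (K \<omega>) \<in> space bf_measures then emeasure (weighted_measure h (K \<omega>)) B else 0) \<in> borel_measurable M"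
    by measurable
  then show "(\<lambda>\<omega>. emeasure (bf_weighted (K \<omega>)) B) \<in> borel_measurable M"
    unfolding bf_weighted_def by (simp add: if_distrib[of "\<lambda>m. emeasure m B"] cong: if_cong)
qed

lemma measurable_bf_weighted: "bf_weighted \<in> measurable config bf_measures"
  by (rule measurable_bf_weighted_comp) (auto simp: space_locally_finite_measures)

definition L :: "'y measure measure" where "L = crm_law P h N"

lemma L_eq: "L = distr P bf_measures (\<lambda>\<omega>. bf_weighted (N' \<omega>))"
proof -
  have "crm_law P h N = distr P bf_measures (\<lambda>\<omega>. bf_weighted (N \<omega>))" by (simp add: crm_law_def bf_weighted_def)
  also have "\<dots> = distr P bf_measures (\<lambda>\<omega>. bf_weighted (N' \<omega>))"
  proof (rule distr_cong_AE)
    show "AE \<omega> in P. bf_weighted (N \<omega>) = bf_weighted (N' \<omega>)" using AE_N' by (rule eventually_mono) simp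
    show "(\<lambda>\<omega>. bf_weighted (N \<omega>)) \<in> measurable P bf_measures"
      by (rule measurable_bf_weighted_comp[OF sets_N measurable_N])
    show "(\<lambda>\<omega>. bf_weighted (N' \<omega>)) \<in> measurable P bf_measures"
      by (rule measurable_compose[OF measurable_N' measurable_bf_weighted])
  qed simp_all
  finally show ?thesis by (simp add: L_def)
qed

lemma sets_L [simp, measurable_cong]: "sets L = sets bf_measures"
  by (simp add: L_eq)

lemma space_L: "space L = space bf_measures"
  by (rule sets_eq_imp_space_eq) simp

lemma prob_space_L: "prob_space L"
  unfolding L_eq by (rule P.prob_space_distr) (rule measurable_compose[OF measurable_N' measurable_bf_weighted])

lemma nn_integral_L:
  "f \<in> borel_measurable bf_measures \<Longrightarrow> (\<integral>\<^sup>+\<mu>. f \<mu> \<partial>L) = (\<integral>\<^sup>+\<omega>. f (bf_weighted (N' \<omega>)) \<partial>P)"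
  unfolding L_eq by (rule nn_integral_distr) (auto intro: measurable_compose[OF measurable_N' measurable_bf_weighted])

text \<open>Integrating against the random measure means integrating h(s) times the integrand over
  the points (s, y) of the configuration; \<open>mecke\<close> is applied to that product. The added
  point then acts on the random measure as an atom of mass h(s) at y.\<close>

lemma palm:
  assumes g [measurable]: "g \<in> borel_measurable (borel \<Otimes>\<^sub>M bf_measures)"
  shows "(\<integral>\<^sup>+\<mu>. (\<integral>\<^sup>+y. g (y, \<mu>) \<partial>\<mu>) \<partial>L)
    = (\<integral>\<^sup>+x. ennreal (h (fst x)) * (\<integral>\<^sup>+\<mu>. g (snd x, add_point \<mu> (ennreal (h (fst x))) (snd x)) \<partial>L) \<partial>\<nu>)"
proof -
  note [measurable] = measurable_bf_weighted
  have gs: "(\<lambda>p. g (snd p, fst p)) \<in> borel_measurable (bf_measures \<Otimes>\<^sub>M borel)" by measurable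
  have g1: "(\<lambda>y. g (y, \<mu>)) \<in> borel_measurable borel" if "\<mu> \<in> space bf_measures" for \<mu>
    using that by measurable
  have "(\<integral>\<^sup>+\<mu>. (\<integral>\<^sup>+y. g (y, \<mu>) \<partial>\<mu>) \<partial>L) = (\<integral>\<^sup>+\<omega>. (\<integral>\<^sup>+y. g (y, bf_weighted (N' \<omega>)) \<partial>bf_weighted (N' \<omega>)) \<partial>P)"
    using measurable_nn_integral_sf_kernel[OF sf_kernel_bf gs] by (intro nn_integral_L) simp
  also have "\<dots> = (\<integral>\<^sup>+\<omega>. (\<integral>\<^sup>+x. ennreal (h (fst x)) * g (snd x, bf_weighted (N' \<omega>)) \<partial>N' \<omega>) \<partial>P)"
  proof (rule nn_integral_cong_AE)
    show "AE \<omega> in P. (\<integral>\<^sup>+y. g (y, bf_weighted (N' \<omega>)) \<partial>bf_weighted (N' \<omega>)) = (\<integral>\<^sup>+x. ennreal (h (fst x)) * g (snd x, bf_weighted (N' \<omega>)) \<partial>N' \<omega>)"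
      using AE_weighted_measure_bf AE_space
    proof eventually_elim
      case (elim \<omega>)
      then have "bf_weighted (N' \<omega>) = weighted_measure h (N' \<omega>)" by (simp add: bf_weighted_def)
      then show ?case using nn_integral_weighted_measure[OF h g1[OF elim(1)], of "N' \<omega>"] sets_N'[OF elim(2)] by simp
    qed
  qed
  also have "\<dots> = (\<integral>\<^sup>+x. (\<integral>\<^sup>+\<omega>. ennreal (h (fst x)) * g (snd x, bf_weighted (add_point (N' \<omega>) 1 x)) \<partial>P) \<partial>\<nu>)"
  proof -
    have "(\<lambda>p. ennreal (h (fst (fst p))) * g (snd (fst p), bf_weighted (snd p))) \<in> borel_measurable (\<nu> \<Otimes>\<^sub>M config)"
      by measurable
    from mecke[OF this] show ?thesis by simp
  qed
  also have "\<dots> = (\<integral>\<^sup>+x. ennreal (h (fst x)) * (\<integral>\<^sup>+\<mu>. g (snd x, add_point \<mu> (ennreal (h (fst x))) (snd x)) \<partial>L) \<partial>\<nu>)"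
  proof (rule nn_integral_cong)
    fix x :: "'s \<times> 'y"
    have [measurable]: "(\<lambda>\<mu>. add_point \<mu> (ennreal (h (fst x))) (snd x)) \<in> measurable bf_measures bf_measures"
      by (rule measurable_add_point_bf) auto
    have "(\<integral>\<^sup>+\<omega>. ennreal (h (fst x)) * g (snd x, bf_weighted (add_point (N' \<omega>) 1 x)) \<partial>P)
      = (\<integral>\<^sup>+\<omega>. ennreal (h (fst x)) * g (snd x, add_point (bf_weighted (N' \<omega>)) (ennreal (h (fst x))) (snd x)) \<partial>P)"
    proof (rule nn_integral_cong_AE)
      \<comment> \<open>Almost surely \<open>bf_weighted\<close> takes its regular branch both
        before and after the addition, since an atom of finite mass preserves bounded
        finiteness.\<close>
      show "AE \<omega> in P. ennreal (h (fst x)) * g (snd x, bf_weighted (add_point (N' \<omega>) 1 x))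
        = ennreal (h (fst x)) * g (snd x, add_point (bf_weighted (N' \<omega>)) (ennreal (h (fst x))) (snd x))"
        using AE_weighted_measure_bf AE_space
      proof eventually_elim
        case (elim \<omega>)
        have "weighted_measure h (add_point (N' \<omega>) 1 x) = add_point (weighted_measure h (N' \<omega>)) (ennreal (h (fst x))) (snd x)"
          using sets_N'[OF elim(2)] by (intro weighted_measure_add_point) auto
        moreover have "\<dots> \<in> space bf_measures"
          using measurable_space[OF \<open>(\<lambda>\<mu>. add_point \<mu> _ _) \<in> _\<close> elim(1)] .
        ultimately show ?case using elim(1) by (simp add: bf_weighted_def)
      qed
    qed
    also have "\<dots> = ennreal (h (fst x)) * (\<integral>\<^sup>+\<omega>. g (snd x, add_point (bf_weighted (N' \<omega>)) (ennreal (h (fst x))) (snd x)) \<partial>P)"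
      by (intro nn_integral_cmult) measurable
    finally show "(\<integral>\<^sup>+\<omega>. ennreal (h (fst x)) * g (snd x, bf_weighted (add_point (N' \<omega>) 1 x)) \<partial>P)
      = ennreal (h (fst x)) * (\<integral>\<^sup>+\<mu>. g (snd x, add_point \<mu> (ennreal (h (fst x))) (snd x)) \<partial>L)"
      by (subst nn_integral_L) auto
  qed
  finally show ?thesis .
qed

end

section \<open>Moments as sums over set partitions\<close>

lemma partition_on_block_unique:
  "partition_on A p \<Longrightarrow> C \<in> p \<Longrightarrow> D \<in> p \<Longrightarrow> i \<in> C \<Longrightarrow> i \<in> D \<Longrightarrow> C = D"
  unfolding partition_on_def disjoint_def by blast

lemma partition_on_block_subset: "partition_on A p \<Longrightarrow> C \<in> p \<Longrightarrow> C \<subseteq> A"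
  unfolding partition_on_def by blast

lemma partition_on_add_singleton:
  "partition_on A p \<Longrightarrow> a \<notin> A \<Longrightarrow> partition_on (insert a A) (insert {a} p)"
  unfolding partition_on_def disjoint_def by auto

lemma partition_on_extend_block:
  assumes "partition_on A p" "a \<notin> A" "C \<in> p"
  shows "partition_on (insert a A) (insert (insert a C) (p - {C}))"
  unfolding partition_on_def disjoint_def
proof (intro conjI ballI impI)
  show "\<Union> (insert (insert a C) (p - {C})) = insert a A" using assms by (auto simp: partition_on_def)
  show "{} \<notin> insert (insert a C) (p - {C})" using assms by (auto simp: partition_on_def)
  fix D E assume "D \<in> insert (insert a C) (p - {C})" "E \<in> insert (insert a C) (p - {C})" "D \<noteq> E"
  moreover have "a \<notin> B" if "B \<in> p" for B using that assms by (auto simp: partition_on_def)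
  ultimately show "D \<inter> E = {}"
    using assms partition_on_block_unique[OF assms(1)] by auto
qed

text \<open>Every partition of the larger set arises in exactly one way from a partition of A:
  either a is put into a block of its own, or it joins one existing block. Two injective
  constructions with disjoint images are matched with the left-hand index set.\<close>

lemma sum_partition_on_insert:
  fixes f :: "'a set set \<Rightarrow> 'b::comm_monoid_add"
  assumes "finite A" "a \<notin> A"
  shows "(\<Sum>p | partition_on (insert a A) p. f p)
    = (\<Sum>p | partition_on A p. f (insert {a} p) + (\<Sum>C\<in>p. f (insert (insert a C) (p - {C}))))"
proof -
  let ?P = "{p. partition_on A p}" and ?S = "{p. partition_on (insert a A) p}"
  define \<phi> where "\<phi> = (\<lambda>(p, C). insert (insert a C) (p - {C}))"
  define S1 where "S1 = insert {a} ` ?P"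
  define S2 where "S2 = \<phi> ` Sigma ?P (\<lambda>p. p)"
  have fin: "finite ?P" using assms(1) by (rule finitely_many_partition_on)
  have finp: "\<forall>p\<in>?P. finite p" using assms(1) finite_elements by auto
  have na: "a \<notin> C" if "partition_on A p" "C \<in> p" for p C
    using partition_on_block_subset[OF that] assms(2) by blast
  have ne: "C \<noteq> {}" if "partition_on A p" "C \<in> p" for p C
    using that by (auto simp: partition_on_def)
  have inj1: "inj_on (insert {a}) ?P"
    by (rule inj_onI) (metis na insertI1 insert_ident mem_Collect_eq)
  have inj2: "inj_on \<phi> (Sigma ?P (\<lambda>p. p))"
  proof (rule inj_onI, clarsimp simp: \<phi>_def)
    fix p C p' C' assume *: "partition_on A p" "C \<in> p" "partition_on A p'" "C' \<in> p'"
      and eq: "insert (insert a C) (p - {C}) = insert (insert a C') (p' - {C'})"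
    \<comment> \<open>The enlarged block is the only one that contains a, so it can be recognised in
      the result; C and then the other blocks are recovered from it.\<close>
    have "insert a C \<in> insert (insert a C') (p' - {C'})" using eq by blast
    then have "insert a C = insert a C'" using na[OF *(3)] by auto
    then have C: "C = C'" using na[OF *(1,2)] na[OF *(3,4)] by (simp add: insert_ident)
    have "insert a C \<notin> p - {C}" "insert a C \<notin> p' - {C}" using na[OF *(1)] na[OF *(3)] by auto
    with eq C have "p - {C} = p' - {C}" by (metis insert_ident)
    then show "p = p' \<and> C = C'" using *(2,4) C by (metis insert_Diff)
  qed
  have "S1 \<inter> S2 = {}"
  proof -
    have False if "partition_on A p" "C \<in> p" "partition_on A p'" "insert {a} p' = insert (insert a C) (p - {C})" for p C p'
    proof -
      have "{a} \<in> insert (insert a C) (p - {C})" using that(4) by blast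
      then show False using na[OF that(1)] na[OF that(1,2)] ne[OF that(1,2)] by auto
    qed
    then show ?thesis unfolding S1_def S2_def \<phi>_def by fastforce
  qed
  moreover have "?S = S1 \<union> S2"
  proof (intro equalityI subsetI)
    fix q assume "q \<in> ?S"
    then have q: "partition_on (insert a A) q" by simp
    \<comment> \<open>The block of a decides the case: if it is just {a}, the partition comes from
      the first construction, otherwise \<open>B - {a}\<close> is the block that was
      enlarged.\<close>
    then obtain B where B: "B \<in> q" "a \<in> B" unfolding partition_on_def by blast
    have oB: "D \<inter> B = {}" if "D \<in> q" "D \<noteq> B" for D
      using q B(1) that unfolding partition_on_def disjoint_def by blast
    have UB: "\<Union>(q - {B}) = A - B"
    proof -
      have U: "\<Union>q = insert a A" using q by (simp add: partition_on_def)
      show ?thesis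
      proof (intro equalityI subsetI)
        fix x assume "x \<in> \<Union>(q - {B})"
        then obtain D where D: "D \<in> q" "D \<noteq> B" "x \<in> D" by blast
        have "x \<notin> B" using oB[OF D(1,2)] D(3) by blast
        moreover have "x \<in> insert a A" using U D by blast
        ultimately show "x \<in> A - B" using B(2) by blast
      next
        fix x assume x: "x \<in> A - B"
        then obtain D where "D \<in> q" "x \<in> D" using U by blast
        then show "x \<in> \<Union>(q - {B})" using x by blast
      qed
    qed
    have dq: "disjoint (q - {B})" "{} \<notin> q" using q by (auto simp: partition_on_def disjoint_def)
    show "q \<in> S1 \<union> S2"
    proof (cases "B = {a}")
      case True
      then have "partition_on A (q - {B})" using UB dq assms(2) by (auto simp: partition_on_def)
      moreover have "q = insert {a} (q - {B})" using True B by auto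
      ultimately show ?thesis unfolding S1_def by blast
    next
      case False
      define C where "C = B - {a}"
      have C: "C \<noteq> {}" "insert a C = B" "a \<notin> C" using False B by (auto simp: C_def)
      have Cq: "C \<notin> q - {B}" using oB[of C] C by auto
      have "B \<subseteq> insert a A" using q B by (auto simp: partition_on_def)
      then have "\<Union>(insert C (q - {B})) = A" using UB C B assms(2) by auto
      moreover have "disjoint (insert C (q - {B}))"
        using dq oB unfolding disjoint_def C_def by auto
      ultimately have "partition_on A (insert C (q - {B}))" using C dq by (auto simp: partition_on_def)
      moreover have "q = \<phi> (insert C (q - {B}), C)" using C Cq B by (auto simp: \<phi>_def)
      ultimately show ?thesis unfolding S2_def by (intro UnI2 image_eqI[where x="(insert C (q - {B}), C)"]) auto
    qed
  next
    fix q assume "q \<in> S1 \<union> S2"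
    then show "q \<in> ?S" using assms(2)
      by (auto simp: S1_def S2_def \<phi>_def intro: partition_on_add_singleton partition_on_extend_block)
  qed
  moreover have "finite S1" "finite S2" using fin finp by (auto simp: S1_def S2_def)
  ultimately have "(\<Sum>p\<in>?S. f p) = (\<Sum>p\<in>S1. f p) + (\<Sum>p\<in>S2. f p)" by (simp add: sum.union_disjoint)
  also have "(\<Sum>p\<in>S1. f p) = (\<Sum>p\<in>?P. f (insert {a} p))" unfolding S1_def by (simp add: sum.reindex[OF inj1])
  also have "(\<Sum>p\<in>S2. f p) = (\<Sum>(p, C)\<in>Sigma ?P (\<lambda>p. p). f (insert (insert a C) (p - {C})))"
    unfolding S2_def sum.reindex[OF inj2] by (simp add: \<phi>_def case_prod_beta)
  also have "\<dots> = (\<Sum>p\<in>?P. \<Sum>C\<in>p. f (insert (insert a C) (p - {C})))"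
    by (rule sum.Sigma[OF fin finp, symmetric])
  finally show ?thesis by (simp add: sum.distrib)
qed

section \<open>Tuples encoded by a partition and block values\<close>

lemma decode_block:
  assumes "partition_on {1..n} p" "C \<in> p" "i \<in> C"
  shows "decode n p y i = y C"
proof -
  have "(THE C. C \<in> p \<and> i \<in> C) = C"
    using assms partition_on_block_unique[OF assms(1)] by (intro the_equality) auto
  moreover have "i \<in> {1..n}" using partition_on_block_subset[OF assms(1,2)] assms(3) by blast
  ultimately show ?thesis by (simp add: decode_def)
qed

lemma partition_on_obtain_block:
  assumes "partition_on A p" "i \<in> A" obtains C where "C \<in> p" "i \<in> C"
  using assms unfolding partition_on_def by blast

lemma decode_undefined: "i \<notin> {1..n} \<Longrightarrow> decode n p y i = undefined"
  unfolding decode_def restrict_apply by (rule if_not_P)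

lemma decode_cong:
  assumes "partition_on {1..n} p" "\<And>C. C \<in> p \<Longrightarrow> y C = y' C"
  shows "decode n p y = decode n p y'"
proof
  fix i show "decode n p y i = decode n p y' i"
  proof (cases "i \<in> {1..n}")
    case True
    then obtain C where "C \<in> p" "i \<in> C" by (rule partition_on_obtain_block[OF assms(1)])
    then show ?thesis using assms by (simp add: decode_block)
  qed (simp add: decode_undefined)
qed

lemma atLeastAtMost_Suc: "{1..Suc n} = insert (Suc n) {1..n}" by auto

lemma decode_add_singleton:
  assumes "partition_on {1..n} p" "\<And>C. C \<in> p \<Longrightarrow> y' C = y C"
  shows "decode (Suc n) (insert {Suc n} p) y' = (decode n p y)(Suc n := y' {Suc n})"
proof
  have p': "partition_on {1..Suc n} (insert {Suc n} p)"
    unfolding atLeastAtMost_Suc by (rule partition_on_add_singleton[OF assms(1)]) simp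
  fix i consider "i \<in> {1..n}" | "i = Suc n" | "i \<notin> {1..Suc n}" by fastforce
  then show "decode (Suc n) (insert {Suc n} p) y' i = ((decode n p y)(Suc n := y' {Suc n})) i"
  proof cases
    case 1
    then obtain C where "C \<in> p" "i \<in> C" by (rule partition_on_obtain_block[OF assms(1)])
    then show ?thesis using 1 assms decode_block[OF p', of C i y'] by (simp add: decode_block)
  next
    case 2 then show ?thesis using decode_block[OF p', of "{Suc n}" i y'] by simp
  qed (auto simp: decode_undefined)
qed

text \<open>Blocks are their own labels, so enlarging C also renames it. The value stored at C must
  move to the label \<open>insert (Suc n) C\<close>, hence the two assignments y and y'.\<close>

lemma decode_extend_block:
  assumes "partition_on {1..n} p" "C \<in> p" "\<And>D. D \<in> p - {C} \<Longrightarrow> y' D = y D" "y' (insert (Suc n) C) = y C"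
  shows "decode (Suc n) (insert (insert (Suc n) C) (p - {C})) y' = (decode n p y)(Suc n := y C)"
proof
  let ?p = "insert (insert (Suc n) C) (p - {C})"
  have p': "partition_on {1..Suc n} ?p"
    unfolding atLeastAtMost_Suc by (rule partition_on_extend_block[OF assms(1) _ assms(2)]) simp
  fix i consider "i \<in> {1..n}" | "i = Suc n" | "i \<notin> {1..Suc n}" by fastforce
  then show "decode (Suc n) ?p y' i = ((decode n p y)(Suc n := y C)) i"
  proof cases
    case 1
    then obtain D where D: "D \<in> p" "i \<in> D" by (rule partition_on_obtain_block[OF assms(1)])
    show ?thesis
    proof (cases "D = C")
      case True
      then show ?thesis using 1 D assms decode_block[OF p', of "insert (Suc n) C" i y'] by (simp add: decode_block)
    next
      case False
      then show ?thesis using 1 D assms decode_block[OF p', of D i y'] by (simp add: decode_block)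
    qed
  next
    case 2 then show ?thesis using assms(4) decode_block[OF p', of "insert (Suc n) C" i y'] by simp
  qed (auto simp: decode_undefined)
qed

lemma measurable_decode:
  fixes b :: "'q \<Rightarrow> nat set \<Rightarrow> 'y::polish_space"
  assumes p: "partition_on {1..n} p" and b: "\<And>C. C \<in> p \<Longrightarrow> (\<lambda>q. b q C) \<in> borel_measurable Q"
  shows "(\<lambda>q. decode n p (b q)) \<in> measurable Q (tuples n)"
  unfolding decode_def
proof (rule measurable_restrict)
  fix i assume "i \<in> {1..n}"
  then obtain C where C: "C \<in> p" "i \<in> C" by (rule partition_on_obtain_block[OF p])
  have "(THE C. C \<in> p \<and> i \<in> C) = C"
    using C partition_on_block_unique[OF p] by (intro the_equality) auto
  then show "(\<lambda>q. b q (THE C. C \<in> p \<and> i \<in> C)) \<in> borel_measurable Q" using b[OF C(1)] by simp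
qed

section \<open>Adding finitely many atoms to a measure\<close>

lemma sets_add_atoms [simp]: "sets (add_atoms h p y \<mu> J) = sets borel"
  unfolding add_atoms_def space_borel[symmetric] by (rule sets.sets_measure_of_eq)

lemma space_add_atoms [simp]: "space (add_atoms h p y \<mu> J) = UNIV"
  using sets_eq_imp_space_eq[OF sets_add_atoms] by simp

lemma emeasure_add_atoms:
  assumes "sets \<mu> = sets borel" "B \<in> sets borel"
  shows "emeasure (add_atoms h p y \<mu> J) B = emeasure \<mu> B + (\<Sum>C\<in>p. ennreal (h (J C)) * indicator B (y C))"
proof -
  let ?m = "\<lambda>B. emeasure \<mu> B + (\<Sum>C\<in>p. ennreal (h (J C)) * emeasure (return borel (y C)) B)"
  have "emeasure (add_atoms h p y \<mu> J) B = ?m B"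
  proof (rule emeasure_measure_of[OF add_atoms_def])
    show "countably_additive (sets (add_atoms h p y \<mu> J)) ?m"
    proof (rule countably_additiveI)
      fix A :: "nat \<Rightarrow> _" assume "range A \<subseteq> sets (add_atoms h p y \<mu> J)" and d: "disjoint_family A"
      then have A: "range A \<subseteq> sets borel" by simp
      have "(\<Sum>i. ?m (A i)) = (\<Sum>i. emeasure \<mu> (A i)) + (\<Sum>i. \<Sum>C\<in>p. ennreal (h (J C)) * emeasure (return borel (y C)) (A i))"
        by (rule suminf_add[symmetric]) auto
      also have "(\<Sum>i. emeasure \<mu> (A i)) = emeasure \<mu> (\<Union>i. A i)"
        using A d assms(1) by (intro suminf_emeasure) auto
      also have "(\<Sum>i. \<Sum>C\<in>p. ennreal (h (J C)) * emeasure (return borel (y C)) (A i))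
        = (\<Sum>C\<in>p. \<Sum>i. ennreal (h (J C)) * emeasure (return borel (y C)) (A i))"
        by (rule suminf_sum) auto
      also have "\<dots> = (\<Sum>C\<in>p. ennreal (h (J C)) * emeasure (return borel (y C)) (\<Union>i. A i))"
        using A by (simp add: suminf_indicator[OF d])
      finally show "(\<Sum>i. ?m (A i)) = ?m (\<Union>i. A i)" .
    qed
  qed (use assms in \<open>auto simp: positive_def\<close>)
  then show ?thesis using assms(2) by simp
qed

lemma add_atoms_empty:
  assumes "sets \<mu> = sets borel" shows "add_atoms h {} y \<mu> J = \<mu>"
  using assms by (intro measure_eqI) (simp_all add: emeasure_add_atoms)

lemma add_atoms_insert:
  assumes "finite p" "D \<notin> p" "sets \<mu> = sets borel"
  shows "add_atoms h (insert D p) y \<mu> J = add_point (add_atoms h p y \<mu> J) (ennreal (h (J D))) (y D)"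
proof (rule measure_eqI)
  fix B assume "B \<in> sets (add_atoms h (insert D p) y \<mu> J)"
  then have B: "B \<in> sets borel" by simp
  show "emeasure (add_atoms h (insert D p) y \<mu> J) B
    = emeasure (add_point (add_atoms h p y \<mu> J) (ennreal (h (J D))) (y D)) B"
    using B by (simp only: emeasure_add_atoms[OF assms(3)] emeasure_add_point sets_add_atoms sum.insert[OF assms(1,2)] add_ac)
qed simp

lemma add_atoms_cong:
  assumes "\<And>C. C \<in> p \<Longrightarrow> y C = y' C" "\<And>C. C \<in> p \<Longrightarrow> J C = J' C"
  shows "add_atoms h p y \<mu> J = add_atoms h p y' \<mu> J'"
  unfolding add_atoms_def using assms by (simp cong: sum.cong)

lemma add_atoms_add_point:
  assumes "sets \<mu> = sets borel"
  shows "add_atoms h p y (add_point \<mu> c a) J = add_point (add_atoms h p y \<mu> J) c a"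
  using assms by (intro measure_eqI) (simp_all add: emeasure_add_atoms emeasure_add_point add_ac)

lemma nn_integral_add_atoms:
  assumes "finite p" "sets \<mu> = sets borel" and f: "f \<in> borel_measurable borel"
  shows "(\<integral>\<^sup>+z. f z \<partial>add_atoms h p y \<mu> J) = (\<integral>\<^sup>+z. f z \<partial>\<mu>) + (\<Sum>C\<in>p. ennreal (h (J C)) * f (y C))"
  using assms(1)
proof induction
  case empty show ?case by (simp add: add_atoms_empty assms(2))
next
  case (insert D p)
  have "f \<in> borel_measurable (add_atoms h p y \<mu> J)"
    by (simp add: measurable_cong_sets[OF sets_add_atoms refl] f)
  then show ?case using insert by (simp add: add_atoms_insert assms(2) nn_integral_add_point add_ac)
qed

lemma measurable_add_atoms:
  fixes b :: "'q \<Rightarrow> nat set \<Rightarrow> 'y::polish_space"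
  assumes "finite p" and a: "a \<in> measurable Q bf_measures"
    and "\<And>C. C \<in> p \<Longrightarrow> (\<lambda>q. b q C) \<in> borel_measurable Q"
    and "\<And>C. C \<in> p \<Longrightarrow> (\<lambda>q. h (J q C)) \<in> borel_measurable Q"
  shows "(\<lambda>q. add_atoms h p (b q) (a q) (J q)) \<in> measurable Q bf_measures"
  using assms(1,3,4)
proof induction
  have sa: "sets (a q) = sets borel" if "q \<in> space Q" for q
    using measurable_space[OF a that] by (simp add: space_bf_measures)
  {
    case empty
    show ?case using a by (simp add: sa add_atoms_empty cong: measurable_cong)
  next
    case (insert D p)
    have "(\<lambda>q. add_point (add_atoms h p (b q) (a q) (J q)) (ennreal (h (J q D))) (b q D)) \<in> measurable Q bf_measures"
      using insert by (intro measurable_add_point_bf) auto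
    then show ?case using insert by (simp add: sa add_atoms_insert cong: measurable_cong)
  }
qed

section \<open>Palm expansion over partitions\<close>

context crm
begin

text \<open>The weight h(s)^k \<open>\<rho>\<close>(ds|y) \<open>\<eta>\<close>(dy) of a marked
  point whose block has k indices, still unnormalised and with jump and location kept
  together.\<close>

definition \<nu>_pow :: "nat \<Rightarrow> ('s \<times> 'y) measure" where
  "\<nu>_pow k = density \<nu> (\<lambda>x. ennreal (h (fst x) ^ k))"

lemma sets_\<nu>_pow [simp, measurable_cong]: "sets (\<nu>_pow k) = sets (borel \<Otimes>\<^sub>M borel)"
  by (simp add: \<nu>_pow_def)

lemma sigma_finite_\<nu>_pow: "sigma_finite_measure (\<nu>_pow k)"
proof -
  have "(\<lambda>x. ennreal (h (fst x) ^ k)) \<in> borel_measurable \<nu>" by measurable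
  then show ?thesis unfolding \<nu>_pow_def
    by (subst sigma_finite_measure.sigma_finite_iff_density_finite[OF sigma_finite_intensity]) auto
qed

lemma nn_integral_\<nu>_pow:
  assumes f [measurable]: "f \<in> borel_measurable (borel \<Otimes>\<^sub>M borel)"
  shows "(\<integral>\<^sup>+x. f x \<partial>\<nu>_pow k) = (\<integral>\<^sup>+x. ennreal (h (fst x) ^ k) * f x \<partial>\<nu>)"
  unfolding \<nu>_pow_def by (rule nn_integral_density) measurable

text \<open>Applied when a block gains an index: the mass h(s) of the atom that is hit is absorbed
  into the weight of its block.\<close>

lemma nn_integral_\<nu>_pow_Suc:
  assumes f [measurable]: "f \<in> borel_measurable (borel \<Otimes>\<^sub>M borel)"
  shows "(\<integral>\<^sup>+x. f x \<partial>\<nu>_pow (Suc k)) = (\<integral>\<^sup>+x. ennreal (h (fst x)) * f x \<partial>\<nu>_pow k)"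
proof -
  have "ennreal (h (fst x) ^ Suc k) = ennreal (h (fst x) ^ k) * ennreal (h (fst x))" for x :: "'s \<times> 'y"
    using h_pos[of "fst x"] by (simp add: ennreal_mult mult.commute less_imp_le)
  then show ?thesis by (simp add: nn_integral_\<nu>_pow mult.assoc)
qed

definition atoms :: "nat set set \<Rightarrow> (nat set \<Rightarrow> 's \<times> 'y) \<Rightarrow> 'y measure \<Rightarrow> 'y measure" where
  "atoms p x \<mu> = add_atoms h p (\<lambda>C. snd (x C)) \<mu> (\<lambda>C. fst (x C))"

abbreviation pts :: "nat set set \<Rightarrow> (nat set \<Rightarrow> 's \<times> 'y) measure" where
  "pts p \<equiv> PiM p (\<lambda>C. \<nu>_pow (card C))"

definition mixed_palm :: "nat \<Rightarrow> nat set set \<Rightarrow> ((nat \<Rightarrow> 'y) \<times> 'y measure \<Rightarrow> ennreal) \<Rightarrow> ennreal" where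
  "mixed_palm n p g = (\<integral>\<^sup>+x. (\<integral>\<^sup>+\<mu>. g (decode n p (\<lambda>C. snd (x C)), atoms p x \<mu>) \<partial>L) \<partial>pts p)"

lemma measurable_pts_component:
  "C \<in> p \<Longrightarrow> (\<lambda>x. snd (x C)) \<in> borel_measurable (pts p)"
  "C \<in> p \<Longrightarrow> (\<lambda>x. fst (x C)) \<in> borel_measurable (pts p)"
proof -
  assume C: "C \<in> p"
  have [measurable]: "(\<lambda>x. x C) \<in> measurable (pts p) (borel \<Otimes>\<^sub>M borel)"
    using measurable_component_singleton[OF C, of "\<lambda>C. \<nu>_pow (card C)"]
    by (simp add: measurable_cong_sets[OF refl sets_\<nu>_pow])
  show "(\<lambda>x. snd (x C)) \<in> borel_measurable (pts p)" "(\<lambda>x. fst (x C)) \<in> borel_measurable (pts p)"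
    by measurable
qed

lemma measurable_atoms:
  assumes "finite p" "b \<in> measurable Q (pts p)" "a \<in> measurable Q bf_measures"
  shows "(\<lambda>q. atoms p (b q) (a q)) \<in> measurable Q bf_measures"
  unfolding atoms_def
  using assms by (intro measurable_add_atoms measurable_compose[OF assms(2) measurable_pts_component(1)]
      measurable_compose[OF measurable_compose[OF assms(2) measurable_pts_component(2)] h])

lemma measurable_decode_pts:
  assumes "partition_on {1..n} p" "b \<in> measurable Q (pts p)"
  shows "(\<lambda>q. decode n p (\<lambda>C. snd (b q C))) \<in> measurable Q (tuples n)"
  using assms by (intro measurable_decode measurable_compose[OF assms(2) measurable_pts_component(1)])

lemma measurable_mixed_palm_inner:
  assumes p: "partition_on {1..n} p" and g: "g \<in> borel_measurable (tuples n \<Otimes>\<^sub>M bf_measures)"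
    and b: "b \<in> measurable Q (pts p)"
  shows "(\<lambda>q. \<integral>\<^sup>+\<mu>. g (decode n p (\<lambda>C. snd (b q C)), atoms p (b q) \<mu>) \<partial>L) \<in> borel_measurable Q"
proof -
  have "finite p" using p finite_elements by blast
  interpret L: prob_space L by (rule prob_space_L)
  have "(\<lambda>(q, \<mu>). g (decode n p (\<lambda>C. snd (b q C)), atoms p (b q) \<mu>)) \<in> borel_measurable (Q \<Otimes>\<^sub>M L)"
    unfolding case_prod_beta
    by (intro measurable_compose[OF _ g] measurable_Pair measurable_decode_pts[OF p] measurable_atoms[OF \<open>finite p\<close>]
        measurable_compose[OF measurable_fst b]) measurable
  from L.borel_measurable_nn_integral[OF this] show ?thesis .
qed

lemma sf_kernel_PiM_bf: "sf_kernel bf_measures (tuples n) (\<lambda>\<mu>::'y measure. PiM {1..n} (\<lambda>_. \<mu>))"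
  by (intro sf_kernel_PiM sf_kernel_bf) auto

text \<open>
  The factor \<open>\<mu>(dz)\<close> charges either the original random measure, where \<open>palm\<close> turns it into a
  new atom, or the atom of one of the blocks.
\<close>

lemma mixed_palm_step:
  assumes p: "partition_on {1..n} p" and g [measurable]: "g \<in> borel_measurable (tuples (Suc n) \<Otimes>\<^sub>M bf_measures)"
  shows "mixed_palm n p (\<lambda>(Y, \<mu>). \<integral>\<^sup>+z. g (Y(Suc n := z), \<mu>) \<partial>\<mu>)
    = mixed_palm (Suc n) (insert {Suc n} p) g
      + (\<Sum>C\<in>p. mixed_palm (Suc n) (insert (insert (Suc n) C) (p - {C})) g)"
proof -
  have fin: "finite p" using p finite_elements by blast
  interpret L: prob_space L by (rule prob_space_L)
  have nSuc: "Suc n \<notin> C" if "C \<in> p" for C using partition_on_block_subset[OF p that] by auto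
  define Yx where "Yx x = decode n p (\<lambda>C. snd (x C))" for x :: "nat set \<Rightarrow> 's \<times> 'y"
  have G: "(\<lambda>q. g ((Yx (b q))(Suc n := c q), atoms p (b q) (a q))) \<in> borel_measurable Q"
    if "b \<in> measurable Q (pts p)" "c \<in> borel_measurable Q" "a \<in> measurable Q bf_measures" for a b c and Q :: "'q measure"
    unfolding Yx_def
    by (intro measurable_compose[OF _ g] measurable_Pair measurable_atoms[OF fin that(1,3)]
        measurable_fun_upd[where J="{1..n}"] measurable_decode_pts[OF p that(1)] that) auto
  have GL: "(\<lambda>q. \<integral>\<^sup>+\<mu>. g ((Yx (b q))(Suc n := c q), atoms p (b q) \<mu>) \<partial>L) \<in> borel_measurable Q"
    if b: "b \<in> measurable Q (pts p)" and c [measurable]: "c \<in> borel_measurable Q" for b c and Q :: "'q measure"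
  proof -
    have "(\<lambda>(q, \<mu>). g ((Yx (b q))(Suc n := c q), atoms p (b q) \<mu>)) \<in> borel_measurable (Q \<Otimes>\<^sub>M L)"
      unfolding case_prod_beta by (intro G measurable_compose[OF measurable_fst b]) measurable
    from L.borel_measurable_nn_integral[OF this] show ?thesis .
  qed
  \<comment> \<open>\<open>T0\<close> is the share of the original random measure, already rewritten
    by \<open>palm\<close>; \<open>T C\<close> is the share of the atom of block C, whose mass is
    \<open>h (fst (x C))\<close>.\<close>
  define T0 where "T0 x = (\<integral>\<^sup>+z. ennreal (h (fst z)) * (\<integral>\<^sup>+\<mu>. g ((Yx x)(Suc n := snd z), atoms p x (add_point \<mu> (ennreal (h (fst z))) (snd z))) \<partial>L) \<partial>\<nu>)" for x
  define T where "T C x = ennreal (h (fst (x C))) * (\<integral>\<^sup>+\<mu>. g ((Yx x)(Suc n := snd (x C)), atoms p x \<mu>) \<partial>L)" for C x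
  have c0: "(\<lambda>_. x) \<in> measurable Q (pts p)" if "x \<in> space (pts p)" for x and Q :: "'q measure" using that by simp
  have expand: "(\<integral>\<^sup>+\<mu>. (\<integral>\<^sup>+z. g ((Yx x)(Suc n := z), atoms p x \<mu>) \<partial>atoms p x \<mu>) \<partial>L) = T0 x + (\<Sum>C\<in>p. T C x)"
    if x: "x \<in> space (pts p)" for x
  proof -
    have Gx [measurable]: "(\<lambda>\<mu>. g ((Yx x)(Suc n := snd (x C)), atoms p x \<mu>)) \<in> borel_measurable L" for C
      unfolding measurable_cong_sets[OF sets_L refl] by (intro G[of "\<lambda>_. x"] c0 x) auto
    have "(\<integral>\<^sup>+\<mu>. (\<integral>\<^sup>+z. g ((Yx x)(Suc n := z), atoms p x \<mu>) \<partial>atoms p x \<mu>) \<partial>L)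
      = (\<integral>\<^sup>+\<mu>. (\<integral>\<^sup>+z. g ((Yx x)(Suc n := z), atoms p x \<mu>) \<partial>\<mu>)
          + (\<Sum>C\<in>p. ennreal (h (fst (x C))) * g ((Yx x)(Suc n := snd (x C)), atoms p x \<mu>)) \<partial>L)"
    proof (rule nn_integral_cong)
      fix \<mu> assume "\<mu> \<in> space L"
      then have \<mu>: "\<mu> \<in> space bf_measures" "sets \<mu> = sets borel" by (auto simp: space_L space_bf_measures)
      have m: "(\<lambda>z. g ((Yx x)(Suc n := z), atoms p x \<mu>)) \<in> borel_measurable borel"
        using \<mu> by (intro G[of "\<lambda>_. x"] c0 x) auto
      show "(\<integral>\<^sup>+z. g ((Yx x)(Suc n := z), atoms p x \<mu>) \<partial>atoms p x \<mu>)
        = (\<integral>\<^sup>+z. g ((Yx x)(Suc n := z), atoms p x \<mu>) \<partial>\<mu>)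
          + (\<Sum>C\<in>p. ennreal (h (fst (x C))) * g ((Yx x)(Suc n := snd (x C)), atoms p x \<mu>))"
        using nn_integral_add_atoms[OF fin \<mu>(2) m, of h "\<lambda>C. snd (x C)" "\<lambda>C. fst (x C)"]
        unfolding atoms_def[symmetric] .
    qed
    also have "\<dots> = (\<integral>\<^sup>+\<mu>. (\<integral>\<^sup>+z. g ((Yx x)(Suc n := z), atoms p x \<mu>) \<partial>\<mu>) \<partial>L)
      + (\<integral>\<^sup>+\<mu>. (\<Sum>C\<in>p. ennreal (h (fst (x C))) * g ((Yx x)(Suc n := snd (x C)), atoms p x \<mu>)) \<partial>L)"
    proof (rule nn_integral_add)
      have "(\<lambda>q. g ((Yx x)(Suc n := snd q), atoms p x (fst q))) \<in> borel_measurable (bf_measures \<Otimes>\<^sub>M borel)"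
        by (intro G[of "\<lambda>_. x"] c0 x) auto
      from measurable_nn_integral_sf_kernel[OF sf_kernel_bf this]
      show "(\<lambda>\<mu>. \<integral>\<^sup>+z. g ((Yx x)(Suc n := z), atoms p x \<mu>) \<partial>\<mu>) \<in> borel_measurable L"
        by (simp add: measurable_cong_sets[OF sets_L refl])
      show "(\<lambda>\<mu>. \<Sum>C\<in>p. ennreal (h (fst (x C))) * g ((Yx x)(Suc n := snd (x C)), atoms p x \<mu>)) \<in> borel_measurable L"
        by (intro borel_measurable_sum borel_measurable_times measurable_const Gx) auto
    qed
    also have "(\<integral>\<^sup>+\<mu>. (\<Sum>C\<in>p. ennreal (h (fst (x C))) * g ((Yx x)(Suc n := snd (x C)), atoms p x \<mu>)) \<partial>L)
      = (\<Sum>C\<in>p. \<integral>\<^sup>+\<mu>. ennreal (h (fst (x C))) * g ((Yx x)(Suc n := snd (x C)), atoms p x \<mu>) \<partial>L)"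
      by (intro nn_integral_sum) measurable
    also have "\<dots> = (\<Sum>C\<in>p. T C x)"
      unfolding T_def
      by (intro sum.cong refl nn_integral_cmult Gx)
    also have "(\<integral>\<^sup>+\<mu>. (\<integral>\<^sup>+z. g ((Yx x)(Suc n := z), atoms p x \<mu>) \<partial>\<mu>) \<partial>L) = T0 x"
    proof -
      have "(\<lambda>q. g ((Yx x)(Suc n := fst q), atoms p x (snd q))) \<in> borel_measurable (borel \<Otimes>\<^sub>M bf_measures)"
        by (intro G[of "\<lambda>_. x"] c0 x) auto
      from palm[OF this] show ?thesis by (simp add: T0_def)
    qed
    finally show ?thesis .
  qed
  have T0m: "T0 \<in> borel_measurable (pts p)"
  proof -
    have "(\<lambda>((x, z), \<mu>). g ((Yx x)(Suc n := snd z), atoms p x (add_point \<mu> (ennreal (h (fst z))) (snd z))))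
        \<in> borel_measurable ((pts p \<Otimes>\<^sub>M \<nu>) \<Otimes>\<^sub>M L)"
      unfolding case_prod_beta by (intro G measurable_add_point_bf) auto
    from L.borel_measurable_nn_integral_fst[OF this]
    have [measurable]: "(\<lambda>q. \<integral>\<^sup>+\<mu>. g ((Yx (fst q))(Suc n := snd (snd q)),
        atoms p (fst q) (add_point \<mu> (ennreal (h (fst (snd q)))) (snd (snd q)))) \<partial>L) \<in> borel_measurable (pts p \<Otimes>\<^sub>M \<nu>)"
      by (simp add: case_prod_beta)
    have "(\<lambda>(x, z). ennreal (h (fst z)) * (\<integral>\<^sup>+\<mu>. g ((Yx x)(Suc n := snd z), atoms p x (add_point \<mu> (ennreal (h (fst z))) (snd z))) \<partial>L))
        \<in> borel_measurable (pts p \<Otimes>\<^sub>M \<nu>)"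
      unfolding case_prod_beta by measurable
    from sigma_finite_measure.borel_measurable_nn_integral[OF sigma_finite_intensity this]
    show ?thesis unfolding T0_def .
  qed
  have Tm: "T C \<in> borel_measurable (pts p)" if "C \<in> p" for C
  proof -
    have [measurable]: "(\<lambda>x. \<integral>\<^sup>+\<mu>. g ((Yx x)(Suc n := snd (x C)), atoms p x \<mu>) \<partial>L) \<in> borel_measurable (pts p)"
      by (intro GL measurable_pts_component that) auto
    note [measurable] = measurable_pts_component(2)[OF that]
    show ?thesis unfolding T_def by measurable
  qed
  have "mixed_palm n p (\<lambda>(Y, \<mu>). \<integral>\<^sup>+z. g (Y(Suc n := z), \<mu>) \<partial>\<mu>) = (\<integral>\<^sup>+x. T0 x + (\<Sum>C\<in>p. T C x) \<partial>pts p)"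
    unfolding mixed_palm_def using expand by (intro nn_integral_cong) (simp add: Yx_def)
  also have "\<dots> = (\<integral>\<^sup>+x. T0 x \<partial>pts p) + (\<Sum>C\<in>p. \<integral>\<^sup>+x. T C x \<partial>pts p)"
    using T0m Tm by (subst nn_integral_add) (auto simp: nn_integral_sum)
  also have "(\<integral>\<^sup>+x. T0 x \<partial>pts p) = mixed_palm (Suc n) (insert {Suc n} p) g"
  proof -
    let ?p = "insert {Suc n} p"
    have new: "{Suc n} \<notin> p" using nSuc by blast
    have p': "partition_on {1..Suc n} ?p"
      unfolding atLeastAtMost_Suc by (rule partition_on_add_singleton[OF p]) simp
    have "mixed_palm (Suc n) ?p g = (\<integral>\<^sup>+x. (\<integral>\<^sup>+z. (\<integral>\<^sup>+\<mu>. g (decode (Suc n) ?p (\<lambda>C. snd ((x({Suc n} := z)) C)),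
        atoms ?p (x({Suc n} := z)) \<mu>) \<partial>L) \<partial>\<nu>_pow (card {Suc n})) \<partial>pts p)"
      unfolding mixed_palm_def using fin new sigma_finite_\<nu>_pow
      by (intro nn_integral_PiM_insert measurable_mixed_palm_inner[OF p' g]) auto
    also have "\<dots> = (\<integral>\<^sup>+x. T0 x \<partial>pts p)"
    proof (rule nn_integral_cong)
      fix x assume x: "x \<in> space (pts p)"
      have "(\<integral>\<^sup>+\<mu>. g (decode (Suc n) ?p (\<lambda>C. snd ((x({Suc n} := z)) C)), atoms ?p (x({Suc n} := z)) \<mu>) \<partial>L)
        = (\<integral>\<^sup>+\<mu>. g ((Yx x)(Suc n := snd z), atoms p x (add_point \<mu> (ennreal (h (fst z))) (snd z))) \<partial>L)" for z
      proof (rule nn_integral_cong)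
        fix \<mu> assume "\<mu> \<in> space L"
        then have \<mu>: "sets \<mu> = sets borel" by (auto simp: space_L space_bf_measures)
        have "decode (Suc n) ?p (\<lambda>C. snd ((x({Suc n} := z)) C)) = (Yx x)(Suc n := snd z)"
          unfolding Yx_def using new by (subst decode_add_singleton[OF p, where y="\<lambda>C. snd (x C)"]) auto
        moreover have "atoms ?p (x({Suc n} := z)) \<mu> = add_point (atoms p (x({Suc n} := z)) \<mu>) (ennreal (h (fst z))) (snd z)"
          unfolding atoms_def using fin new \<mu> by (simp add: add_atoms_insert)
        moreover have "atoms p (x({Suc n} := z)) \<mu> = atoms p x \<mu>"
          unfolding atoms_def using new by (intro add_atoms_cong) auto
        moreover have "add_point (atoms p x \<mu>) (ennreal (h (fst z))) (snd z) = atoms p x (add_point \<mu> (ennreal (h (fst z))) (snd z))"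
          unfolding atoms_def by (rule add_atoms_add_point[OF \<mu>, symmetric])
        ultimately show "g (decode (Suc n) ?p (\<lambda>C. snd ((x({Suc n} := z)) C)), atoms ?p (x({Suc n} := z)) \<mu>)
          = g ((Yx x)(Suc n := snd z), atoms p x (add_point \<mu> (ennreal (h (fst z))) (snd z)))" by simp
      qed
      moreover have "(\<lambda>z. \<integral>\<^sup>+\<mu>. g ((Yx x)(Suc n := snd z), atoms p x (add_point \<mu> (ennreal (h (fst z))) (snd z))) \<partial>L)
          \<in> borel_measurable (borel \<Otimes>\<^sub>M borel)"
      proof -
        have "(\<lambda>(z, \<mu>). g ((Yx x)(Suc n := snd z), atoms p x (add_point \<mu> (ennreal (h (fst z))) (snd z))))
            \<in> borel_measurable ((borel \<Otimes>\<^sub>M borel) \<Otimes>\<^sub>M L)"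
          unfolding case_prod_beta by (intro G[of "\<lambda>_. x"] c0 x measurable_add_point_bf) auto
        from L.borel_measurable_nn_integral[OF this] show ?thesis .
      qed
      ultimately show "(\<integral>\<^sup>+z. (\<integral>\<^sup>+\<mu>. g (decode (Suc n) ?p (\<lambda>C. snd ((x({Suc n} := z)) C)),
        atoms ?p (x({Suc n} := z)) \<mu>) \<partial>L) \<partial>\<nu>_pow (card {Suc n})) = T0 x"
        by (simp add: T0_def nn_integral_\<nu>_pow)
    qed
    finally show ?thesis ..
  qed
  also have "(\<Sum>C\<in>p. \<integral>\<^sup>+x. T C x \<partial>pts p) = (\<Sum>C\<in>p. mixed_palm (Suc n) (insert (insert (Suc n) C) (p - {C})) g)"
  proof (rule sum.cong[OF refl])
    fix C assume C: "C \<in> p"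
    let ?r = "p - {C}" and ?C = "insert (Suc n) C"
    let ?p = "insert ?C ?r"
    have p': "partition_on {1..Suc n} ?p"
      unfolding atLeastAtMost_Suc by (rule partition_on_extend_block[OF p _ C]) simp
    have new: "?C \<notin> ?r" using nSuc by blast
    have pC: "insert C ?r = p" "C \<notin> ?r" "finite ?r" using C fin by auto
    have cardC: "card ?C = Suc (card C)"
      using nSuc[OF C] partition_on_block_subset[OF p C] finite_subset by (subst card_insert_disjoint) auto
    have "(\<integral>\<^sup>+x. T C x \<partial>pts p) = (\<integral>\<^sup>+x. (\<integral>\<^sup>+z. T C (x(C := z)) \<partial>\<nu>_pow (card C)) \<partial>pts ?r)"
      using nn_integral_PiM_insert[of ?r C "\<lambda>C. \<nu>_pow (card C)" "T C"] pC Tm[OF C] sigma_finite_\<nu>_pow by simp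
    also have "\<dots> = (\<integral>\<^sup>+x. (\<integral>\<^sup>+z. (\<integral>\<^sup>+\<mu>. g (decode (Suc n) ?p (\<lambda>D. snd ((x(?C := z)) D)),
        atoms ?p (x(?C := z)) \<mu>) \<partial>L) \<partial>\<nu>_pow (card ?C)) \<partial>pts ?r)"
    proof (rule nn_integral_cong)
      fix x assume x: "x \<in> space (pts ?r)"
      \<comment> \<open>The remaining integral with the marked point z placed in block C. It has the
        same value when z is placed in the enlarged block, so the two sides differ only by the
        factor h, that is, by the exponent of \<open>\<nu>_pow\<close>.\<close>
      define q where "q z = (\<integral>\<^sup>+\<mu>. g ((Yx (x(C := z)))(Suc n := snd z), atoms p (x(C := z)) \<mu>) \<partial>L)" for z
      have updm: "(\<lambda>z. x(C := z)) \<in> measurable (borel \<Otimes>\<^sub>M borel) (pts p)"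
        using x C by (intro measurable_fun_upd[where J="?r"]) (auto simp: measurable_cong_sets[OF refl sets_\<nu>_pow])
      have q: "q \<in> borel_measurable (borel \<Otimes>\<^sub>M borel)"
        unfolding q_def by (intro GL updm) measurable
      have eq: "(\<integral>\<^sup>+\<mu>. g (decode (Suc n) ?p (\<lambda>D. snd ((x(?C := z)) D)), atoms ?p (x(?C := z)) \<mu>) \<partial>L) = q z" for z
        unfolding q_def
      proof (rule nn_integral_cong)
        fix \<mu> assume "\<mu> \<in> space L"
        then have \<mu>: "sets \<mu> = sets borel" by (auto simp: space_L space_bf_measures)
        have "decode (Suc n) ?p (\<lambda>D. snd ((x(?C := z)) D)) = (Yx (x(C := z)))(Suc n := snd z)"
          unfolding Yx_def using new
          by (subst decode_extend_block[OF p C, where y="\<lambda>D. snd ((x(C := z)) D)"]) auto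
        moreover have "atoms ?p (x(?C := z)) \<mu> = add_point (atoms ?r (x(?C := z)) \<mu>) (ennreal (h (fst z))) (snd z)"
          unfolding atoms_def using pC new \<mu> by (simp add: add_atoms_insert)
        moreover have "atoms p (x(C := z)) \<mu> = add_point (atoms ?r (x(C := z)) \<mu>) (ennreal (h (fst z))) (snd z)"
          using add_atoms_insert[OF pC(3,2) \<mu>, of h "\<lambda>D. snd ((x(C := z)) D)" "\<lambda>D. fst ((x(C := z)) D)"]
          unfolding pC(1) atoms_def by simp
        moreover have "atoms ?r (x(?C := z)) \<mu> = atoms ?r (x(C := z)) \<mu>"
          unfolding atoms_def using new by (intro add_atoms_cong) auto
        ultimately show "g (decode (Suc n) ?p (\<lambda>D. snd ((x(?C := z)) D)), atoms ?p (x(?C := z)) \<mu>)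
          = g ((Yx (x(C := z)))(Suc n := snd z), atoms p (x(C := z)) \<mu>)" by simp
      qed
      have Tq: "T C (x(C := z)) = ennreal (h (fst z)) * q z" for z by (simp add: T_def q_def)
      show "(\<integral>\<^sup>+z. T C (x(C := z)) \<partial>\<nu>_pow (card C)) = (\<integral>\<^sup>+z. (\<integral>\<^sup>+\<mu>. g (decode (Suc n) ?p (\<lambda>D. snd ((x(?C := z)) D)),
        atoms ?p (x(?C := z)) \<mu>) \<partial>L) \<partial>\<nu>_pow (card ?C))"
        unfolding cardC eq Tq by (rule nn_integral_\<nu>_pow_Suc[OF q, symmetric])
    qed
    also have "\<dots> = mixed_palm (Suc n) ?p g"
      unfolding mixed_palm_def using pC new sigma_finite_\<nu>_pow
      by (intro nn_integral_PiM_insert[symmetric] measurable_mixed_palm_inner[OF p' g]) auto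
    finally show "(\<integral>\<^sup>+x. T C x \<partial>pts p) = mixed_palm (Suc n) ?p g" .
  qed
  finally show ?thesis .
qed

text \<open>Induction on n with the last factor integrated first. The result depends again on both Y
  and the random measure, which is why g has to involve the measure even when only plain moments are
  wanted.\<close>

theorem nn_integral_moment:
  assumes "g \<in> borel_measurable (tuples n \<Otimes>\<^sub>M bf_measures)"
  shows "(\<integral>\<^sup>+\<mu>. (\<integral>\<^sup>+Y. g (Y, \<mu>) \<partial>PiM {1..n} (\<lambda>_. \<mu>)) \<partial>L) = (\<Sum>p | partition_on {1..n} p. mixed_palm n p g)"
  using assms
proof (induction n arbitrary: g)
  case 0
  \<comment> \<open>For n = 0 there is just the empty partition, and the empty product measure is
    the unit mass at the function that is undefined everywhere.\<close>
  have "{p. partition_on {1..0::nat} p} = {{}}" by (auto simp: partition_on_empty)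
  moreover have "(\<integral>\<^sup>+Y. g (Y, \<mu>) \<partial>PiM {1..0::nat} (\<lambda>_. \<mu>)) = g (\<lambda>_. undefined, \<mu>)" for \<mu>
    by (simp add: PiM_empty nn_integral_count_space_finite)
  moreover have "mixed_palm 0 {} g = (\<integral>\<^sup>+\<mu>. g (\<lambda>_. undefined, \<mu>) \<partial>L)"
  proof -
    have "mixed_palm 0 {} g = (\<integral>\<^sup>+\<mu>. g (\<lambda>_. undefined, atoms {} (\<lambda>_. undefined) \<mu>) \<partial>L)"
      by (simp add: mixed_palm_def PiM_empty nn_integral_count_space_finite decode_def restrict_def)
    also have "\<dots> = (\<integral>\<^sup>+\<mu>. g (\<lambda>_. undefined, \<mu>) \<partial>L)"
      by (intro nn_integral_cong) (simp add: atoms_def add_atoms_empty space_L space_bf_measures)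
    finally show ?thesis .
  qed
  ultimately show ?case by simp
next
  case (Suc n)
  note g [measurable] = Suc.prems
  define g' where "g' = (\<lambda>(Y, \<mu>). \<integral>\<^sup>+z. g (Y(Suc n := z), \<mu>) \<partial>\<mu>)"
  have g': "g' \<in> borel_measurable (tuples n \<Otimes>\<^sub>M bf_measures)"
  proof -
    have "(\<lambda>q. g ((fst (fst q))(Suc n := snd q), snd (fst q))) \<in> borel_measurable ((tuples n \<Otimes>\<^sub>M bf_measures) \<Otimes>\<^sub>M borel)"
      by (intro measurable_compose[OF _ g] measurable_Pair measurable_fun_upd[where J="{1..n}"]) auto
    from measurable_nn_integral_sf_kernel[OF sf_kernel_comp[OF sf_kernel_bf measurable_snd] this]
    show ?thesis by (simp add: g'_def case_prod_beta)
  qed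
  have "(\<integral>\<^sup>+\<mu>. (\<integral>\<^sup>+Y. g (Y, \<mu>) \<partial>PiM {1..Suc n} (\<lambda>_. \<mu>)) \<partial>L) = (\<integral>\<^sup>+\<mu>. (\<integral>\<^sup>+Y. g' (Y, \<mu>) \<partial>PiM {1..n} (\<lambda>_. \<mu>)) \<partial>L)"
  proof (rule nn_integral_cong)
    fix \<mu> assume "\<mu> \<in> space L"
    then have \<mu>: "\<mu> \<in> space bf_measures" "sets \<mu> = sets borel" by (auto simp: space_L space_bf_measures)
    have "(\<lambda>Y. g (Y, \<mu>)) \<in> borel_measurable (tuples (Suc n))" using \<mu> by measurable
    then have m: "(\<lambda>Y. g (Y, \<mu>)) \<in> borel_measurable (PiM (insert (Suc n) {1..n}) (\<lambda>_. \<mu>))"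
      unfolding atLeastAtMost_Suc using sets_PiM_cong[of "insert (Suc n) {1..n}" _ "\<lambda>_. \<mu>" "\<lambda>_. borel"] \<mu>
      by (simp cong: measurable_cong_sets)
    show "(\<integral>\<^sup>+Y. g (Y, \<mu>) \<partial>PiM {1..Suc n} (\<lambda>_. \<mu>)) = (\<integral>\<^sup>+Y. g' (Y, \<mu>) \<partial>PiM {1..n} (\<lambda>_. \<mu>))"
      unfolding atLeastAtMost_Suc g'_def case_prod_conv
      by (rule nn_integral_PiM_insert[OF _ _ _ m]) (use sf_kernel_sigma_finite[OF sf_kernel_bf \<mu>(1)] in auto)
  qed
  also have "\<dots> = (\<Sum>p | partition_on {1..n} p. mixed_palm n p g')" by (rule Suc.IH[OF g'])
  also have "\<dots> = (\<Sum>p | partition_on {1..n} p. mixed_palm (Suc n) (insert {Suc n} p) g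
      + (\<Sum>C\<in>p. mixed_palm (Suc n) (insert (insert (Suc n) C) (p - {C})) g))"
    unfolding g'_def by (intro sum.cong refl mixed_palm_step g) simp
  also have "\<dots> = (\<Sum>p | partition_on {1..Suc n} p. mixed_palm (Suc n) p g)"
    unfolding atLeastAtMost_Suc by (rule sum_partition_on_insert[symmetric]) auto
  finally show ?case .
qed

end

section \<open>The conditional law\<close>

text \<open>Otherwise the simplifier rewrites \<open>{1..n}\<close> to \<open>{Suc 0..n}\<close>.\<close>

declare One_nat_def [simp del]

text \<open>A subset of a singleton is empty or all of it, so no measurable part can have mass
  strictly in between.\<close>

lemma non_atomic_singleton:
  assumes "non_atomic M" "{x} \<in> sets M" shows "emeasure M {x} = 0"
proof (rule ccontr)
  assume "emeasure M {x} \<noteq> 0"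
  then have "0 < emeasure M {x}" by (simp add: zero_less_iff_neq_zero)
  then obtain B where "B \<subseteq> {x}" "0 < emeasure M B" "emeasure M B < emeasure M {x}"
    using assms unfolding non_atomic_def by blast
  moreover from this have "B = {} \<or> B = {x}" by blast
  ultimately show False by auto
qed

lemma partition_on_tie: "partition_on {1..n} (tie_partition n Y)"
  unfolding partition_on_def disjoint_def tie_partition_def by auto

text \<open>Turns an equation between set systems into a finite Boolean combination of the
  conditions \<open>Y i = Y j\<close>, which exhibits it as a measurable event.\<close>

lemma tie_partition_eq_iff:
  assumes "partition_on {1..n} p"
  shows "tie_partition n Y = p \<longleftrightarrow> (\<forall>i\<in>{1..n}. \<forall>j\<in>{1..n}. Y i = Y j \<longleftrightarrow> (\<exists>C\<in>p. i \<in> C \<and> j \<in> C))"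
proof
  assume "tie_partition n Y = p"
  then have p: "p = (\<lambda>i. {j\<in>{1..n}. Y j = Y i}) ` {1..n}" by (simp add: tie_partition_def)
  show "\<forall>i\<in>{1..n}. \<forall>j\<in>{1..n}. Y i = Y j \<longleftrightarrow> (\<exists>C\<in>p. i \<in> C \<and> j \<in> C)"
  proof (intro ballI iffI)
    fix i j assume ij: "i \<in> {1..n}" "j \<in> {1..n}" and "Y i = Y j"
    then have "i \<in> {l\<in>{1..n}. Y l = Y i} \<and> j \<in> {l\<in>{1..n}. Y l = Y i}" by simp
    then show "\<exists>C\<in>p. i \<in> C \<and> j \<in> C" unfolding p using ij(1) by (rule bexI[OF _ imageI])
  next
    fix i j assume "\<exists>C\<in>p. i \<in> C \<and> j \<in> C"
    then obtain k where "i \<in> {l\<in>{1..n}. Y l = Y k}" "j \<in> {l\<in>{1..n}. Y l = Y k}" unfolding p by blast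
    then show "Y i = Y j" by simp
  qed
next
  assume *: "\<forall>i\<in>{1..n}. \<forall>j\<in>{1..n}. Y i = Y j \<longleftrightarrow> (\<exists>C\<in>p. i \<in> C \<and> j \<in> C)"
  have block: "{j\<in>{1..n}. Y j = Y i} = C" if "C \<in> p" "i \<in> C" for C i
  proof -
    have C: "C \<subseteq> {1..n}" using partition_on_block_subset[OF assms that(1)] .
    then have i: "i \<in> {1..n}" using that by blast
    have "Y j = Y i \<longleftrightarrow> j \<in> C" if j: "j \<in> {1..n}" for j
      using * i j \<open>C \<in> p\<close> \<open>i \<in> C\<close> partition_on_block_unique[OF assms] by blast
    then show ?thesis using C by blast
  qed
  show "tie_partition n Y = p"
  proof (intro equalityI subsetI)
    fix D assume "D \<in> tie_partition n Y"
    then obtain i where i: "i \<in> {1..n}" "D = {j\<in>{1..n}. Y j = Y i}" unfolding tie_partition_def by blast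
    obtain C where C: "C \<in> p" "i \<in> C" using partition_on_obtain_block[OF assms i(1)] by blast
    then show "D \<in> p" using block[OF C] i(2) by simp
  next
    fix C assume C: "C \<in> p"
    then have "C \<noteq> {}" using assms unfolding partition_on_def by blast
    then obtain i where i: "i \<in> C" by blast
    then have "i \<in> {1..n}" using partition_on_block_subset[OF assms C] by blast
    then show "C \<in> tie_partition n Y" using block[OF C i] unfolding tie_partition_def by blast
  qed
qed

text \<open>Injectivity prevents two blocks from merging: equal values in different blocks would
  make the tie partition coarser than p.\<close>

lemma tie_partition_decode:
  assumes p: "partition_on {1..n} p" and inj: "inj_on y p"
  shows "tie_partition n (decode n p y) = p"
  unfolding tie_partition_eq_iff[OF p]
proof (intro ballI)
  fix i j assume "i \<in> {1..n}" "j \<in> {1..n}"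
  obtain C D where C: "C \<in> p" "i \<in> C" and D: "D \<in> p" "j \<in> D"
    using partition_on_obtain_block[OF p] \<open>i \<in> {1..n}\<close> \<open>j \<in> {1..n}\<close> by metis
  have "decode n p y i = decode n p y j \<longleftrightarrow> C = D"
    using decode_block[OF p C, of y] decode_block[OF p D, of y] inj C D by (auto simp: inj_on_def)
  also have "\<dots> \<longleftrightarrow> (\<exists>E\<in>p. i \<in> E \<and> j \<in> E)"
    using C D partition_on_block_unique[OF p] by blast
  finally show "decode n p y i = decode n p y j \<longleftrightarrow> (\<exists>E\<in>p. i \<in> E \<and> j \<in> E)" .
qed

lemma block_value_eqI:
  assumes "i \<in> C" "\<And>j. j \<in> C \<Longrightarrow> Y j = Y i" shows "block_value Y C = Y i"
proof -
  have "Y ` C = {Y i}" using assms by blast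
  then show ?thesis by (simp add: block_value_def)
qed

lemma block_value_decode:
  assumes p: "partition_on {1..n} p" and C: "C \<in> p"
  shows "block_value (decode n p y) C = y C"
proof -
  have "C \<noteq> {}" using p C unfolding partition_on_def by blast
  then obtain i where i: "i \<in> C" by blast
  have "block_value (decode n p y) C = decode n p y i"
    using decode_block[OF p C, of _ y] i by (intro block_value_eqI) auto
  then show ?thesis using decode_block[OF p C i, of y] by simp
qed

text \<open>Reading the value at the least index of the block replaces \<open>the_elem\<close> by a
  coordinate projection, whose measurability is immediate.\<close>

lemma block_value_Min:
  assumes "C \<in> tie_partition n Y" shows "block_value Y C = Y (Min C)" "Min C \<in> {1..n}"
proof -
  obtain i where i: "i \<in> {1..n}" "C = {j\<in>{1..n}. Y j = Y i}" using assms unfolding tie_partition_def by blast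
  then have M: "Min C \<in> C" by (intro Min_in) auto
  then show "Min C \<in> {1..n}" using i by blast
  have "Y j = Y (Min C)" if "j \<in> C" for j using that M i(2) by auto
  then show "block_value Y C = Y (Min C)" by (rule block_value_eqI[OF M])
qed

text \<open>All exponents that occur are at least 1, the range in which \<open>kappa\<close> is
  finite.\<close>

lemma partition_on_card_pos:
  "partition_on {1..n::nat} p \<Longrightarrow> C \<in> p \<Longrightarrow> 1 \<le> card C"
  using partition_on_block_subset[of "{1..n}" p C] finite_subset[of C "{1..n}"]
  by (auto simp: partition_on_def One_nat_def Suc_le_eq card_gt_0_iff)

lemma pred_tie_partition:
  assumes p: "partition_on {1..n} p"
  shows "Measurable.pred (tuples n) (\<lambda>Y :: nat \<Rightarrow> 'y::polish_space. tie_partition n Y = p)"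
proof -
  have [measurable]: "Measurable.pred (tuples n) (\<lambda>Y :: nat \<Rightarrow> 'y. Y i = Y j)" if "i \<in> {1..n}" "j \<in> {1..n}" for i j
    unfolding pred_def using that by (intro measurable_equality_set measurable_component_singleton) auto
  show ?thesis unfolding tie_partition_eq_iff[OF p] by measurable
qed

section \<open>Separating the jumps from the locations\<close>

context crm
begin

lemma measurable_kappa [measurable]: "kappa h \<rho> k \<in> borel_measurable borel"
  using measurable_nn_integral_sf_kernel[OF sf_kernel_\<rho>, of "\<lambda>p. ennreal (h (snd p) ^ k)"]
  by (simp add: kappa_def[abs_def])

text \<open>The location marginal of \<open>\<nu>_pow k\<close>, and the factor of
  \<open>block_measure\<close> for a block with k elements.\<close>

definition \<alpha> :: "nat \<Rightarrow> 'y measure" where "\<alpha> k = density \<eta> (kappa h \<rho> k)"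

lemma sets_\<alpha> [simp, measurable_cong]: "sets (\<alpha> k) = sets borel"
  by (simp add: \<alpha>_def)

lemma measurable_\<eta>_eq [simp]: "measurable \<eta> M = measurable borel M"
  by (rule measurable_cong_sets) simp_all

lemma sigma_finite_\<alpha>: "1 \<le> k \<Longrightarrow> sigma_finite_measure (\<alpha> k)"
  unfolding \<alpha>_def using kappa_finite[of k]
  by (subst sigma_finite_measure.sigma_finite_iff_density_finite[OF sigma_finite_\<eta>]) (auto simp: less_top)

lemma nn_integral_\<alpha>:
  assumes [measurable]: "f \<in> borel_measurable borel"
  shows "(\<integral>\<^sup>+y. f y \<partial>\<alpha> k) = (\<integral>\<^sup>+y. kappa h \<rho> k y * f y \<partial>\<eta>)"
  unfolding \<alpha>_def by (rule nn_integral_density) auto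

lemma emeasure_\<alpha>_singleton: "emeasure (\<alpha> k) {y} = 0"
proof -
  have "emeasure \<eta> {y} = 0" by (rule non_atomic_singleton[OF non_atomic]) simp
  then have "AE x in \<eta>. x \<notin> {y}" by (intro AE_not_in) auto
  have "emeasure (\<alpha> k) {y} = (\<integral>\<^sup>+x. kappa h \<rho> k x * indicator {y} x \<partial>\<eta>)"
    unfolding \<alpha>_def by (rule emeasure_density) auto
  also have "\<dots> = (\<integral>\<^sup>+x. 0 \<partial>\<eta>)"
    using \<open>AE x in \<eta>. x \<notin> {y}\<close> by (intro nn_integral_cong_AE) (auto elim!: eventually_mono)
  finally show ?thesis by simp
qed

text \<open>A density is positive almost everywhere for the measure that it defines, so the
  degenerate case of \<open>jump_law\<close> is negligible.\<close>

lemma AE_\<alpha>_kappa_pos: "AE y in \<alpha> k. 0 < kappa h \<rho> k y"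
  unfolding \<alpha>_def by (subst AE_density) auto

lemma sets_jump_law [simp, measurable_cong]: "sets (jump_law h \<rho> k y) = sets borel"
  by (simp add: jump_law_def)

lemma space_jump_law [simp]: "space (jump_law h \<rho> k y) = UNIV"
  using sets_eq_imp_space_eq[OF sets_jump_law] by simp

lemma nn_integral_jump_law:
  assumes [measurable]: "f \<in> borel_measurable borel"
  shows "(\<integral>\<^sup>+s. f s \<partial>jump_law h \<rho> k y) = (\<integral>\<^sup>+s. ennreal (h s ^ k) * f s \<partial>\<rho> y) / kappa h \<rho> k y"
proof -
  have "(\<integral>\<^sup>+s. f s \<partial>jump_law h \<rho> k y) = (\<integral>\<^sup>+s. (ennreal (h s ^ k) / kappa h \<rho> k y) * f s \<partial>\<rho> y)"
    unfolding jump_law_def by (rule nn_integral_density) measurable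
  also have "\<dots> = (\<integral>\<^sup>+s. ennreal (h s ^ k) * f s / kappa h \<rho> k y \<partial>\<rho> y)"
    by (intro nn_integral_cong) (simp add: ennreal_divide_times ennreal_times_divide)
  also have "\<dots> = (\<integral>\<^sup>+s. ennreal (h s ^ k) * f s \<partial>\<rho> y) / kappa h \<rho> k y"
    by (rule nn_integral_divide) measurable
  finally show ?thesis .
qed

text \<open>The quotient is kept because it covers both cases: 1 where \<open>kappa\<close> is
  positive and finite, and 0/0 = 0 where it vanishes and the jump law is the zero measure.\<close>

lemma emeasure_jump_law_space: "emeasure (jump_law h \<rho> k y) UNIV = kappa h \<rho> k y / kappa h \<rho> k y"
  using nn_integral_jump_law[of "indicator UNIV" k y] by (simp add: kappa_def)

lemma sf_kernel_jump_law:
  assumes k: "1 \<le> k" shows "sf_kernel borel borel (jump_law h \<rho> k)"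
proof (rule sf_kernelI[where F="\<lambda>_. UNIV"])
  fix A :: "'s set" assume A [measurable]: "A \<in> sets borel"
  have "(\<lambda>y. \<integral>\<^sup>+s. ennreal (h s ^ k) * indicator A s \<partial>\<rho> y) \<in> borel_measurable borel"
    using measurable_nn_integral_sf_kernel[OF sf_kernel_\<rho>, of "\<lambda>p. ennreal (h (snd p) ^ k) * indicator A (snd p)"] by simp
  then have "(\<lambda>y. (\<integral>\<^sup>+s. ennreal (h s ^ k) * indicator A s \<partial>\<rho> y) / kappa h \<rho> k y) \<in> borel_measurable borel"
    by measurable
  then show "(\<lambda>y. emeasure (jump_law h \<rho> k y) A) \<in> borel_measurable borel"
    using nn_integral_jump_law[of "indicator A" k] by simp
next
  fix y show "emeasure (jump_law h \<rho> k y) UNIV < \<infinity>"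
    unfolding emeasure_jump_law_space using kappa_finite[OF k, of y]
    by (cases "kappa h \<rho> k y = 0") (simp_all add: ennreal_divide_eq_top_iff less_top[symmetric] ennreal_divide_self)
qed (auto simp: incseq_def)

lemma disintegrate_\<nu>_pow:
  assumes k: "1 \<le> k" and f [measurable]: "f \<in> borel_measurable (borel \<Otimes>\<^sub>M borel)"
  shows "(\<integral>\<^sup>+x. f x \<partial>\<nu>_pow k) = (\<integral>\<^sup>+a. (\<integral>\<^sup>+s. f (s, a) \<partial>jump_law h \<rho> k a) \<partial>\<alpha> k)"
proof -
  have "(\<integral>\<^sup>+x. f x \<partial>\<nu>_pow k) = (\<integral>\<^sup>+a. (\<integral>\<^sup>+s. ennreal (h s ^ k) * f (s, a) \<partial>\<rho> a) \<partial>\<eta>)"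
    by (simp add: nn_integral_\<nu>_pow nn_integral_\<nu>)
  also have "\<dots> = (\<integral>\<^sup>+a. kappa h \<rho> k a * (\<integral>\<^sup>+s. f (s, a) \<partial>jump_law h \<rho> k a) \<partial>\<eta>)"
  proof (rule nn_integral_cong)
    fix a
    have [measurable]: "(\<lambda>s. f (s, a)) \<in> borel_measurable borel" by measurable
    show "(\<integral>\<^sup>+s. ennreal (h s ^ k) * f (s, a) \<partial>\<rho> a) = kappa h \<rho> k a * (\<integral>\<^sup>+s. f (s, a) \<partial>jump_law h \<rho> k a)"
    \<comment> \<open>Where \<open>kappa\<close> vanishes, multiplying by it cannot undo the
      division. There h^k is zero almost everywhere under \<open>\<rho> a\<close>, so both sides are
      0.\<close>
    proof (cases "kappa h \<rho> k a = 0")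
      case True
      then have "AE s in \<rho> a. ennreal (h s ^ k) = 0"
        unfolding kappa_def by (subst (asm) nn_integral_0_iff_AE) auto
      then have "(\<integral>\<^sup>+s. ennreal (h s ^ k) * f (s, a) \<partial>\<rho> a) = (\<integral>\<^sup>+s. 0 \<partial>\<rho> a)"
        by (intro nn_integral_cong_AE) (auto elim!: eventually_mono)
      then show ?thesis using True by simp
    next
      case False
      have top: "kappa h \<rho> k a \<noteq> \<top>" using kappa_finite[OF k, of a] by simp
      have "kappa h \<rho> k a * (X / kappa h \<rho> k a) = X" for X
        by (simp only: ennreal_times_divide mult.commute[of "kappa h \<rho> k a"] ennreal_mult_divide_eq[OF False top])
      then show ?thesis by (simp add: nn_integral_jump_law)
    qed
  qed
  also have "\<dots> = (\<integral>\<^sup>+a. (\<integral>\<^sup>+s. f (s, a) \<partial>jump_law h \<rho> k a) \<partial>\<alpha> k)"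
  proof (rule nn_integral_\<alpha>[symmetric])
    have "(\<lambda>p. f (snd p, fst p)) \<in> borel_measurable (borel \<Otimes>\<^sub>M borel)" by measurable
    from measurable_nn_integral_sf_kernel[OF sf_kernel_jump_law[OF k] this]
    show "(\<lambda>a. \<integral>\<^sup>+s. f (s, a) \<partial>jump_law h \<rho> k a) \<in> borel_measurable borel" by simp
  qed
  finally show ?thesis .
qed

lemma block_measure_eq: "block_measure h \<rho> \<eta> p = PiM p (\<lambda>C. \<alpha> (card C))"
  by (simp add: block_measure_def \<alpha>_def)

lemma sets_block_measure: "sets (block_measure h \<rho> \<eta> p) = sets (PiM p (\<lambda>_. borel))"
  unfolding block_measure_eq by (intro sets_PiM_cong) auto

abbreviation jumps :: "nat set set \<Rightarrow> (nat set \<Rightarrow> 'y) \<Rightarrow> (nat set \<Rightarrow> 's) measure" where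
  "jumps p y \<equiv> PiM p (\<lambda>C. jump_law h \<rho> (card C) (y C))"

lemma sets_jumps [measurable_cong]: "sets (jumps p y) = sets (PiM p (\<lambda>_. borel))"
  by (intro sets_PiM_cong) auto

lemma sigma_finite_jumps:
  assumes p: "partition_on {1..n} p" shows "sigma_finite_measure (jumps p y)"
  using p finite_elements partition_on_card_pos[OF p]
  by (intro sigma_finite_PiM_finite sf_kernel_sigma_finite[OF sf_kernel_jump_law]) auto

lemma sf_kernel_jumps:
  assumes p: "partition_on {1..n} p" and b: "\<And>C. C \<in> p \<Longrightarrow> (\<lambda>q. b q C) \<in> borel_measurable Q"
  shows "sf_kernel Q (PiM p (\<lambda>_. borel)) (\<lambda>q. jumps p (b q))"
proof (rule sf_kernel_PiM)
  show "finite p" using p finite_elements by blast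
  show "sf_kernel Q borel (\<lambda>q. jump_law h \<rho> (card C) (b q C))" if "C \<in> p" for C
    using sf_kernel_comp[OF sf_kernel_jump_law[OF partition_on_card_pos[OF p that]] b[OF that]] .
qed

lemma measurable_add_atoms_jumps:
  assumes "finite p" "a \<in> measurable Q bf_measures" "\<And>C. C \<in> p \<Longrightarrow> (\<lambda>q. b q C) \<in> borel_measurable Q"
    and "J \<in> measurable Q (PiM p (\<lambda>_. borel))"
  shows "(\<lambda>q. add_atoms h p (b q) (a q) (J q)) \<in> measurable Q bf_measures"
  using assms by (intro measurable_add_atoms measurable_compose[OF measurable_compose[OF assms(4) measurable_component_singleton] h])

lemma emeasure_jumps_space:
  assumes p: "partition_on {1..n} p"
  shows "emeasure (jumps p y) (space (jumps p y)) = (\<Prod>C\<in>p. kappa h \<rho> (card C) (y C) / kappa h \<rho> (card C) (y C))"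
proof -
  have "space (jumps p y) = (\<Pi>\<^sub>E C\<in>p. UNIV)"
    using sets_eq_imp_space_eq[OF sets_jumps[of p y]] by (simp add: space_PiM)
  then have "emeasure (jumps p y) (space (jumps p y)) = (\<Prod>C\<in>p. emeasure (jump_law h \<rho> (card C) (y C)) UNIV)"
    using p finite_elements partition_on_card_pos[OF p]
    by (simp only:) (intro emeasure_PiM_PiE sf_kernel_sigma_finite[OF sf_kernel_jump_law], auto)
  then show ?thesis by (simp add: emeasure_jump_law_space)
qed

lemma emeasure_jumps_space_le: "partition_on {1..n} p \<Longrightarrow> emeasure (jumps p y) (space (jumps p y)) \<le> 1"
  unfolding emeasure_jumps_space
proof (rule prod_le_1, intro conjI)
  fix C assume p: "partition_on {1..n} p" and C: "C \<in> p"
  show "kappa h \<rho> (card C) (y C) / kappa h \<rho> (card C) (y C) \<le> 1"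
    using kappa_finite[OF partition_on_card_pos[OF p C], of "y C"]
    by (cases "kappa h \<rho> (card C) (y C) = 0") (simp_all add: ennreal_divide_self)
qed simp

text \<open>The exceptional set is a finite union of null sets: for two blocks, coincidence of their
  locations, which are drawn from measures without point masses, and for one block, a location where
  \<open>kappa\<close> is zero.\<close>

lemma AE_block_measure:
  assumes p: "partition_on {1..n} p"
  shows "AE y in block_measure h \<rho> \<eta> p. inj_on y p \<and> (\<forall>C\<in>p. 0 < kappa h \<rho> (card C) (y C))"
proof -
  have fin: "finite p" using p finite_elements by blast
  have sf: "sigma_finite_measure (\<alpha> (card C))" if "C \<in> p" for C
    by (rule sigma_finite_\<alpha>[OF partition_on_card_pos[OF p that]])
  have neq: "AE y in PiM p (\<lambda>C. \<alpha> (card C)). \<forall>C\<in>p. \<forall>D\<in>p. C \<noteq> D \<longrightarrow> y C \<noteq> y D"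
  proof (intro AE_finite_allI fin)
    fix C D assume CD: "C \<in> p" "D \<in> p"
    show "AE y in PiM p (\<lambda>C. \<alpha> (card C)). C \<noteq> D \<longrightarrow> y C \<noteq> y D"
    proof (cases "C = D")
      case False
      have "AE y in PiM p (\<lambda>C. \<alpha> (card C)). y C \<noteq> y D"
        by (rule AE_PiM_coordinates_neq[OF fin sf _ CD False]) (simp_all add: emeasure_\<alpha>_singleton)
      then show ?thesis by (rule eventually_mono) simp
    qed simp
  qed
  have "AE y in PiM p (\<lambda>C. \<alpha> (card C)). \<forall>C\<in>p. 0 < kappa h \<rho> (card C) (y C)"
    by (intro AE_finite_allI fin AE_PiM_coordinate[OF fin sf] AE_\<alpha>_kappa_pos)
  with neq show ?thesis unfolding block_measure_eq
    by eventually_elim (auto simp: inj_on_def)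
qed

text \<open>Each weight \<open>\<nu>_pow\<close> splits into a location law and a jump law, and the
  product disintegration performs this for all blocks at once. Decoding and adding atoms consult
  only the labels in p, so restricting the two components to p changes nothing.\<close>

lemma mixed_palm_eq:
  assumes p: "partition_on {1..n} p" and g: "g \<in> borel_measurable (tuples n \<Otimes>\<^sub>M bf_measures)"
  shows "mixed_palm n p g = (\<integral>\<^sup>+y. (\<integral>\<^sup>+J. (\<integral>\<^sup>+\<mu>. g (decode n p y, add_atoms h p y \<mu> J) \<partial>L) \<partial>jumps p y) \<partial>block_measure h \<rho> \<eta> p)"
proof -
  have fin: "finite p" using p finite_elements by blast
  interpret L: prob_space L by (rule prob_space_L)
  define f where "f q = (\<integral>\<^sup>+\<mu>. g (decode n p (snd q), add_atoms h p (snd q) \<mu> (fst q)) \<partial>L)" for q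
  have f: "f \<in> borel_measurable (PiM p (\<lambda>_. borel) \<Otimes>\<^sub>M PiM p (\<lambda>_. borel))"
  proof -
    have "(\<lambda>(q, \<mu>). g (decode n p (snd q), add_atoms h p (snd q) \<mu> (fst q)))
        \<in> borel_measurable ((PiM p (\<lambda>_. borel) \<Otimes>\<^sub>M PiM p (\<lambda>_. borel)) \<Otimes>\<^sub>M L)"
      unfolding case_prod_beta
      by (intro measurable_compose[OF _ g] measurable_Pair measurable_decode[OF p] measurable_add_atoms_jumps[OF fin]) auto
    from L.borel_measurable_nn_integral[OF this] show ?thesis unfolding f_def .
  qed
  have "mixed_palm n p g = (\<integral>\<^sup>+x. f (\<lambda>C\<in>p. fst (x C), \<lambda>C\<in>p. snd (x C)) \<partial>pts p)"
    unfolding mixed_palm_def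
  proof (rule nn_integral_cong)
    fix x :: "nat set \<Rightarrow> 's \<times> 'y"
    have "decode n p (\<lambda>C\<in>p. snd (x C)) = decode n p (\<lambda>C. snd (x C))" by (rule decode_cong[OF p]) simp
    moreover have "add_atoms h p (\<lambda>C\<in>p. snd (x C)) \<mu> (\<lambda>C\<in>p. fst (x C)) = atoms p x \<mu>" for \<mu>
      unfolding atoms_def by (rule add_atoms_cong) simp_all
    ultimately show "(\<integral>\<^sup>+\<mu>. g (decode n p (\<lambda>C. snd (x C)), atoms p x \<mu>) \<partial>L) = f (\<lambda>C\<in>p. fst (x C), \<lambda>C\<in>p. snd (x C))"
      by (simp add: f_def)
  qed
  also have "\<dots> = (\<integral>\<^sup>+y. (\<integral>\<^sup>+J. f (J, y) \<partial>jumps p y) \<partial>PiM p (\<lambda>C. \<alpha> (card C)))"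
  proof (rule nn_integral_PiM_disintegrate[where Y=borel and Z=borel])
    fix C assume C: "C \<in> p"
    note k = partition_on_card_pos[OF p C]
    show "sigma_finite_measure (\<alpha> (card C))" by (rule sigma_finite_\<alpha>[OF k])
    show "sf_kernel borel borel (jump_law h \<rho> (card C))" by (rule sf_kernel_jump_law[OF k])
    show "sigma_finite_measure (\<nu>_pow (card C))" by (rule sigma_finite_\<nu>_pow)
    fix f :: "'s \<times> 'y \<Rightarrow> ennreal" assume "f \<in> borel_measurable (borel \<Otimes>\<^sub>M borel)"
    then show "(\<integral>\<^sup>+x. f x \<partial>\<nu>_pow (card C)) = (\<integral>\<^sup>+a. (\<integral>\<^sup>+s. f (s, a) \<partial>jump_law h \<rho> (card C) a) \<partial>\<alpha> (card C))"
      by (rule disintegrate_\<nu>_pow[OF k])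
  qed (use fin f in auto)
  finally show ?thesis by (simp add: f_def block_measure_eq)
qed

section \<open>The conditional law as a kernel\<close>

lemma sets_cond_law [simp, measurable_cong]: "sets (cond_law h \<rho> L n Y) = sets bf_measures"
  by (simp add: cond_law_def)

lemma nn_integral_cond_law:
  assumes f [measurable]: "f \<in> borel_measurable bf_measures"
  shows "(\<integral>\<^sup>+\<mu>. f \<mu> \<partial>cond_law h \<rho> L n Y)
    = (\<integral>\<^sup>+\<mu>. (\<integral>\<^sup>+J. f (add_atoms h (tie_partition n Y) (block_value Y) \<mu> J) \<partial>jumps (tie_partition n Y) (block_value Y)) \<partial>L)"
proof -
  let ?p = "tie_partition n Y"
  have p: "partition_on {1..n} ?p" by (rule partition_on_tie)
  have fin: "finite ?p" using p finite_elements by blast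
  interpret J: sigma_finite_measure "jumps ?p (block_value Y)" by (rule sigma_finite_jumps[OF p])
  have m: "(\<lambda>(\<mu>, J). add_atoms h ?p (block_value Y) \<mu> J) \<in> measurable (L \<Otimes>\<^sub>M jumps ?p (block_value Y)) bf_measures"
    unfolding case_prod_beta by (intro measurable_add_atoms_jumps[OF fin]) measurable
  show ?thesis unfolding cond_law_def
    using J.nn_integral_fst[OF measurable_compose[OF m f]] by (subst nn_integral_distr[OF m]) simp_all
qed

text \<open>For distinct block values the decoded tuple returns p and y, so the conditional law can
  be written without reference to ties. Fubini then brings its two integrals into the order used in
  \<open>mixed_palm_eq\<close>.\<close>

lemma nn_integral_cond_law_decode:
  assumes p: "partition_on {1..n} p" and inj: "inj_on y p" and f [measurable]: "f \<in> borel_measurable bf_measures"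
  shows "(\<integral>\<^sup>+\<mu>. f \<mu> \<partial>cond_law h \<rho> L n (decode n p y))
    = (\<integral>\<^sup>+J. (\<integral>\<^sup>+\<mu>. f (add_atoms h p y \<mu> J) \<partial>L) \<partial>jumps p y)"
proof -
  have fin: "finite p" using p finite_elements by blast
  let ?y = "block_value (decode n p y)"
  have y: "?y C = y C" if "C \<in> p" for C by (rule block_value_decode[OF p that])
  have "jumps p ?y = jumps p y" using y by (intro PiM_cong) auto
  moreover have "add_atoms h p ?y \<mu> J = add_atoms h p y \<mu> J" for \<mu> J using y by (rule add_atoms_cong) simp_all
  ultimately have "(\<integral>\<^sup>+\<mu>. f \<mu> \<partial>cond_law h \<rho> L n (decode n p y))
    = (\<integral>\<^sup>+\<mu>. (\<integral>\<^sup>+J. f (add_atoms h p y \<mu> J) \<partial>jumps p y) \<partial>L)"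
    by (simp add: nn_integral_cond_law[OF f] tie_partition_decode[OF p inj])
  also have "\<dots> = (\<integral>\<^sup>+J. (\<integral>\<^sup>+\<mu>. f (add_atoms h p y \<mu> J) \<partial>L) \<partial>jumps p y)"
  proof -
    interpret L: prob_space L by (rule prob_space_L)
    interpret pair_sigma_finite L "jumps p y"
      by (rule pair_sigma_finiteI[OF L.sigma_finite_measure_axioms sigma_finite_jumps[OF p]])
    have "(\<lambda>(\<mu>, J). f (add_atoms h p y \<mu> J)) \<in> borel_measurable (L \<Otimes>\<^sub>M jumps p y)"
      unfolding case_prod_beta
      by (intro measurable_compose[OF _ f] measurable_add_atoms_jumps[OF fin]) measurable
    from Fubini'[OF this] show ?thesis by simp
  qed
  finally show ?thesis .
qed

text \<open>The index set of the jumps varies with Y, but it takes only finitely many values. On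
  each event of a fixed tie partition the law is given by one measurable formula. The total mass is
  at most 1, so a constant exhaustion is enough.\<close>

lemma sf_kernel_cond_law: "sf_kernel (tuples n) bf_measures (cond_law h \<rho> L n)"
proof (rule sf_kernelI[where F="\<lambda>_. space bf_measures"])
  interpret L: prob_space L by (rule prob_space_L)
  fix Y :: "nat \<Rightarrow> 'y"
  let ?p = "tie_partition n Y"
  have "emeasure (cond_law h \<rho> L n Y) (space bf_measures) = (\<integral>\<^sup>+\<mu>. 1 \<partial>cond_law h \<rho> L n Y)"
    using sets_eq_imp_space_eq[OF sets_cond_law[of n Y]] by simp
  also have "\<dots> = (\<integral>\<^sup>+\<mu>. (\<integral>\<^sup>+J. 1 \<partial>jumps ?p (block_value Y)) \<partial>L)"
    by (rule nn_integral_cond_law) simp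
  also have "\<dots> \<le> (\<integral>\<^sup>+\<mu>. 1 \<partial>L)"
    using emeasure_jumps_space_le[OF partition_on_tie, of n Y] by (intro nn_integral_mono) simp
  also have "\<dots> = 1" by (simp add: L.emeasure_space_1)
  finally show "emeasure (cond_law h \<rho> L n Y) (space bf_measures) < \<infinity>"
    by (auto simp: less_top[symmetric] top_unique)
next
  fix D :: "'y measure set" assume D [measurable]: "D \<in> sets bf_measures"
  interpret L: prob_space L by (rule prob_space_L)
  \<comment> \<open>The formula for a fixed p, defined for all Y: reading each block at its least
    index makes sense even where the ties of Y do not form p.\<close>
  define \<Psi> where "\<Psi> p Y = (\<integral>\<^sup>+\<mu>. (\<integral>\<^sup>+J. indicator D (add_atoms h p (\<lambda>C. Y (Min C)) \<mu> J) \<partial>jumps p (\<lambda>C. Y (Min C))) \<partial>L)"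
    for p and Y :: "nat \<Rightarrow> 'y"
  have \<Psi> [measurable]: "\<Psi> p \<in> borel_measurable (tuples n)" if p: "partition_on {1..n} p" for p
  proof -
    have fin: "finite p" using p finite_elements by blast
    have Min: "Min C \<in> {1..n}" if "C \<in> p" for C
    proof -
      have "C \<subseteq> {1..n}" "C \<noteq> {}" using p that by (auto simp: partition_on_def)
      then show ?thesis using Min_in[of C] finite_subset[of C "{1..n}"] by blast
    qed
    have c: "(\<lambda>q. fst q (Min C)) \<in> borel_measurable (tuples n \<Otimes>\<^sub>M L)" if "C \<in> p" for C
      using Min[OF that] by measurable
    have c': "(\<lambda>q. fst (fst q) (Min C)) \<in> borel_measurable ((tuples n \<Otimes>\<^sub>M L) \<Otimes>\<^sub>M PiM p (\<lambda>_. borel))" if "C \<in> p" for C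
      using Min[OF that] by measurable
    have "(\<lambda>r. indicator D (add_atoms h p (\<lambda>C. fst (fst r) (Min C)) (snd (fst r)) (snd r)) :: ennreal)
        \<in> borel_measurable ((tuples n \<Otimes>\<^sub>M L) \<Otimes>\<^sub>M PiM p (\<lambda>_. borel))"
      by (intro measurable_compose[OF _ borel_measurable_indicator[OF D]] measurable_add_atoms_jumps[OF fin] c') auto
    from measurable_nn_integral_sf_kernel[OF sf_kernel_jumps[OF p c] this]
    have "(\<lambda>(Y, \<mu>). \<integral>\<^sup>+J. indicator D (add_atoms h p (\<lambda>C. Y (Min C)) \<mu> J) \<partial>jumps p (\<lambda>C. Y (Min C)))
        \<in> borel_measurable (tuples n \<Otimes>\<^sub>M L)"
      by (simp add: case_prod_beta)
    from L.borel_measurable_nn_integral[OF this] show ?thesis unfolding \<Psi>_def .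
  qed
  have "(\<lambda>Y. \<Sum>p | partition_on {1..n} p. (if tie_partition n Y = p then 1 else 0) * \<Psi> p Y) \<in> borel_measurable (tuples n)"
    using pred_tie_partition[measurable] by measurable
  also have "(\<lambda>Y. \<Sum>p | partition_on {1..n} p. (if tie_partition n Y = p then 1 else 0) * \<Psi> p Y) = (\<lambda>Y. emeasure (cond_law h \<rho> L n Y) D)"
  proof
    fix Y :: "nat \<Rightarrow> 'y"
    let ?p = "tie_partition n Y"
    have "(\<Sum>p | partition_on {1..n} p. (if ?p = p then 1 else 0) * \<Psi> p Y) = (\<Sum>p | partition_on {1..n} p. if p = ?p then \<Psi> p Y else 0)"
      by (intro sum.cong) auto
    also have "\<dots> = \<Psi> ?p Y"
      using partition_on_tie[of n Y] by (simp add: sum.delta finitely_many_partition_on)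
    also have "\<dots> = (\<integral>\<^sup>+\<mu>. (\<integral>\<^sup>+J. indicator D (add_atoms h ?p (block_value Y) \<mu> J) \<partial>jumps ?p (block_value Y)) \<partial>L)"
    proof -
      have "jumps ?p (\<lambda>C. Y (Min C)) = jumps ?p (block_value Y)"
        by (intro PiM_cong) (auto simp: block_value_Min)
      moreover have "add_atoms h ?p (\<lambda>C. Y (Min C)) \<mu> J = add_atoms h ?p (block_value Y) \<mu> J" for \<mu> J
        by (rule add_atoms_cong) (auto simp: block_value_Min)
      ultimately show ?thesis by (simp add: \<Psi>_def)
    qed
    also have "\<dots> = emeasure (cond_law h \<rho> L n Y) D"
      using D by (subst nn_integral_cond_law[symmetric]) auto
    finally show "(\<Sum>p | partition_on {1..n} p. (if ?p = p then 1 else 0) * \<Psi> p Y) = emeasure (cond_law h \<rho> L n Y) D" .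
  qed
  finally show "(\<lambda>Y. emeasure (cond_law h \<rho> L n Y) D) \<in> borel_measurable (tuples n)" .
qed (auto simp: incseq_def)

section \<open>The moment measure and the two joint measures\<close>

lemma sf_kernel_L_PiM: "sf_kernel L (tuples n) (\<lambda>\<mu>. PiM {1..n} (\<lambda>_. \<mu>))"
  using sf_kernel_PiM_bf by (simp add: sf_kernel_cong_sets[OF sets_L])

lemma sets_moment_joint [simp, measurable_cong]: "sets (moment_joint n L) = sets (bf_measures \<Otimes>\<^sub>M tuples n)"
  unfolding moment_joint_def by (simp cong: sets_pair_measure_cong)

lemma nn_integral_moment_joint:
  assumes g [measurable]: "g \<in> borel_measurable (tuples n \<Otimes>\<^sub>M bf_measures)"
  shows "(\<integral>\<^sup>+(\<mu>, Y). g (Y, \<mu>) \<partial>moment_joint n L) = (\<Sum>p | partition_on {1..n} p. mixed_palm n p g)"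
proof -
  have "(\<lambda>(\<mu>, Y). g (Y, \<mu>)) \<in> borel_measurable (L \<Otimes>\<^sub>M tuples n)" by measurable
  from nn_integral_semidirect[OF sf_kernel_L_PiM this]
  show ?thesis unfolding moment_joint_def by (simp add: nn_integral_moment[OF g])
qed

text \<open>The equality of the inner integrals is claimed only for almost every y: at coinciding
  block values the conditional law would work with a coarser partition.\<close>

lemma mixed_palm_cond_law:
  assumes p: "partition_on {1..n} p" and g: "g \<in> borel_measurable (tuples n \<Otimes>\<^sub>M bf_measures)"
  shows "mixed_palm n p g
    = (\<integral>\<^sup>+y. (\<integral>\<^sup>+\<mu>. g (decode n p y, \<mu>) \<partial>cond_law h \<rho> L n (decode n p y)) \<partial>block_measure h \<rho> \<eta> p)"
  unfolding mixed_palm_eq[OF p g]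
proof (rule nn_integral_cong_AE)
  show "AE y in block_measure h \<rho> \<eta> p. (\<integral>\<^sup>+J. (\<integral>\<^sup>+\<mu>. g (decode n p y, add_atoms h p y \<mu> J) \<partial>L) \<partial>jumps p y)
    = (\<integral>\<^sup>+\<mu>. g (decode n p y, \<mu>) \<partial>cond_law h \<rho> L n (decode n p y))"
    using AE_block_measure[OF p] AE_space
  proof eventually_elim
    case (elim y)
    have "decode n p y \<in> space (tuples n)" by (auto simp: space_PiM decode_def)
    then have "(\<lambda>\<mu>. g (decode n p y, \<mu>)) \<in> borel_measurable bf_measures"
      using g by measurable
    from nn_integral_cond_law_decode[OF p _ this] elim show ?case by simp
  qed
qed

text \<open>Identifies the defining set function as a marginal of \<open>moment_joint\<close>, which
  shows that it is countably additive and hence the actual measure.\<close>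

lemma moment_measure_eq_distr: "moment_measure n L = distr (moment_joint n L) (tuples n) snd"
  unfolding moment_measure_def distr_def
proof (rule measure_of_eq[OF sets.space_closed])
  fix A :: "(nat \<Rightarrow> 'y) set" assume "A \<in> sigma_sets (space (tuples n)) (sets (tuples n))"
  then have A: "A \<in> sets (tuples n)" by (simp add: sets.sigma_sets_eq)
  have sp: "space (moment_joint n L) = space bf_measures \<times> space (tuples n)"
    using sets_eq_imp_space_eq[OF sets_moment_joint[of n]] by (simp add: space_pair_measure)
  have pre: "snd -` A \<inter> space (moment_joint n L) = space bf_measures \<times> A"
    using sets.sets_into_space[OF A] unfolding sp by auto
  have "emeasure (moment_joint n L) (space bf_measures \<times> A)
    = (\<integral>\<^sup>+\<mu>. emeasure (PiM {1..n} (\<lambda>_. \<mu>)) (Pair \<mu> -` (space bf_measures \<times> A)) \<partial>L)"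
    unfolding moment_joint_def using A
    by (intro emeasure_semidirect[OF sf_kernel_L_PiM] pair_measureI) simp_all
  also have "\<dots> = (\<integral>\<^sup>+\<mu>. emeasure (PiM {1..n} (\<lambda>_. \<mu>)) A \<partial>L)"
    by (intro nn_integral_cong arg_cong2[where f=emeasure]) (auto simp: space_L)
  finally show "(\<integral>\<^sup>+\<mu>. emeasure (PiM {1..n} (\<lambda>_. \<mu>)) A \<partial>L) = emeasure (moment_joint n L) (snd -` A \<inter> space (moment_joint n L))"
    by (simp add: pre)
qed

lemma sets_moment_measure [simp, measurable_cong]: "sets (moment_measure n L) = sets (tuples n)"
  by (simp add: moment_measure_eq_distr)

text \<open>For an integrand that ignores the random measure, the added atoms integrate out:
  \<open>L\<close> has mass 1, and so have the jump laws at almost every location, because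
  \<open>kappa\<close> is positive there.\<close>

lemma nn_integral_moment_measure:
  assumes f [measurable]: "f \<in> borel_measurable (tuples n)"
  shows "(\<integral>\<^sup>+Y. f Y \<partial>moment_measure n L)
    = (\<Sum>p | partition_on {1..n} p. \<integral>\<^sup>+y. f (decode n p y) \<partial>block_measure h \<rho> \<eta> p)"
proof -
  interpret L: prob_space L by (rule prob_space_L)
  have g: "(\<lambda>q. f (fst q)) \<in> borel_measurable (tuples n \<Otimes>\<^sub>M bf_measures)" by measurable
  have "(\<integral>\<^sup>+Y. f Y \<partial>moment_measure n L) = (\<integral>\<^sup>+(\<mu>, Y). f Y \<partial>moment_joint n L)"
    unfolding moment_measure_eq_distr by (subst nn_integral_distr) (auto simp: case_prod_unfold)
  also have "\<dots> = (\<Sum>p | partition_on {1..n} p. mixed_palm n p (\<lambda>q. f (fst q)))"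
    using nn_integral_moment_joint[OF g] by simp
  also have "\<dots> = (\<Sum>p | partition_on {1..n} p. \<integral>\<^sup>+y. f (decode n p y) \<partial>block_measure h \<rho> \<eta> p)"
  proof (rule sum.cong[OF refl])
    fix p assume "p \<in> {p. partition_on {1..n} p}"
    then have p: "partition_on {1..n} p" by simp
    show "mixed_palm n p (\<lambda>q. f (fst q)) = (\<integral>\<^sup>+y. f (decode n p y) \<partial>block_measure h \<rho> \<eta> p)"
      unfolding mixed_palm_eq[OF p g]
    proof (rule nn_integral_cong_AE)
      show "AE y in block_measure h \<rho> \<eta> p.
        (\<integral>\<^sup>+J. (\<integral>\<^sup>+\<mu>. f (fst (decode n p y, add_atoms h p y \<mu> J)) \<partial>L) \<partial>jumps p y) = f (decode n p y)"
        using AE_block_measure[OF p]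
      proof eventually_elim
        case (elim y)
        have "kappa h \<rho> (card C) (y C) / kappa h \<rho> (card C) (y C) = 1" if "C \<in> p" for C
          using elim that kappa_finite[OF partition_on_card_pos[OF p that], of "y C"]
          by (intro ennreal_divide_self) auto
        then have "emeasure (jumps p y) (space (jumps p y)) = 1"
          unfolding emeasure_jumps_space[OF p] by (intro prod.neutral) auto
        then show ?case by (simp add: L.emeasure_space_1)
      qed
    qed
  qed
  finally show ?thesis .
qed

lemma sf_kernel_moment_cond_law: "sf_kernel (moment_measure n L) bf_measures (cond_law h \<rho> L n)"
  using sf_kernel_cond_law by (simp add: sf_kernel_cong_sets[OF sets_moment_measure])

lemma sets_disintegrated_joint [simp, measurable_cong]:
  "sets (disintegrated_joint h \<rho> L n) = sets (tuples n \<Otimes>\<^sub>M bf_measures)"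
  unfolding disintegrated_joint_def by (simp cong: sets_pair_measure_cong)

text \<open>The two joint measures are never compared directly; each is evaluated to the same sum
  over partitions.\<close>

lemma nn_integral_disintegrated_joint:
  assumes g: "g \<in> borel_measurable (tuples n \<Otimes>\<^sub>M bf_measures)"
  shows "(\<integral>\<^sup>+q. g q \<partial>disintegrated_joint h \<rho> L n) = (\<Sum>p | partition_on {1..n} p. mixed_palm n p g)"
proof -
  have g': "g \<in> borel_measurable (moment_measure n L \<Otimes>\<^sub>M bf_measures)"
    using g by (simp cong: measurable_cong_sets sets_pair_measure_cong)
  have "(\<integral>\<^sup>+q. g q \<partial>disintegrated_joint h \<rho> L n)
      = (\<integral>\<^sup>+Y. (\<integral>\<^sup>+\<mu>. g (Y, \<mu>) \<partial>cond_law h \<rho> L n Y) \<partial>moment_measure n L)"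
    unfolding disintegrated_joint_def by (rule nn_integral_semidirect[OF sf_kernel_moment_cond_law g'])
  also have "\<dots> = (\<Sum>p | partition_on {1..n} p. \<integral>\<^sup>+y. (\<integral>\<^sup>+\<mu>. g (decode n p y, \<mu>) \<partial>cond_law h \<rho> L n (decode n p y)) \<partial>block_measure h \<rho> \<eta> p)"
    by (rule nn_integral_moment_measure[OF measurable_nn_integral_sf_kernel[OF sf_kernel_cond_law g]])
  also have "\<dots> = (\<Sum>p | partition_on {1..n} p. mixed_palm n p g)"
    using mixed_palm_cond_law[OF _ g] by (intro sum.cong) auto
  finally show ?thesis .
qed

lemma measurable_swap_moment: "(\<lambda>(\<mu>, Y). (Y, \<mu>)) \<in> measurable (moment_joint n L) (tuples n \<Otimes>\<^sub>M bf_measures)"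
  by measurable

text \<open>Equality as measures, up to swapping the components, transfers integrability and Bochner
  integrals without splitting the integrand into its positive and negative parts.\<close>

lemma disintegrated_joint_eq_distr:
  "disintegrated_joint h \<rho> L n = distr (moment_joint n L) (tuples n \<Otimes>\<^sub>M bf_measures) (\<lambda>(\<mu>, Y). (Y, \<mu>))"
proof (rule measure_eqI)
  fix A assume "A \<in> sets (disintegrated_joint h \<rho> L n)"
  then have A: "A \<in> sets (tuples n \<Otimes>\<^sub>M bf_measures)" by simp
  then have ind: "indicator A \<in> borel_measurable (tuples n \<Otimes>\<^sub>M (bf_measures :: 'y measure measure))" by simp
  have "emeasure (disintegrated_joint h \<rho> L n) A = (\<Sum>p | partition_on {1..n} p. mixed_palm n p (indicator A))"
    using A nn_integral_disintegrated_joint[OF ind] by simp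
  also have "\<dots> = (\<integral>\<^sup>+(\<mu>, Y). indicator A (Y, \<mu>) \<partial>moment_joint n L)"
    by (rule nn_integral_moment_joint[OF ind, symmetric])
  also have "\<dots> = (\<integral>\<^sup>+q. indicator A q \<partial>distr (moment_joint n L) (tuples n \<Otimes>\<^sub>M bf_measures) (\<lambda>(\<mu>, Y). (Y, \<mu>)))"
    using ind by (subst nn_integral_distr[OF measurable_swap_moment]) (auto simp: case_prod_unfold)
  finally show "emeasure (disintegrated_joint h \<rho> L n) A
    = emeasure (distr (moment_joint n L) (tuples n \<Otimes>\<^sub>M bf_measures) (\<lambda>(\<mu>, Y). (Y, \<mu>))) A"
    using A by simp
qed simp

text \<open>Among all partitions q in the expansion of the moment measure only q = p survives, since
  tuples decoded from q have tie partition q almost everywhere. This gives the product formula for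
  the moment measure on each set of tuples with given ties.\<close>

lemma emeasure_moment_tie:
  assumes p: "partition_on {1..n} p" and A: "A \<in> sets (tuples n)"
  shows "emeasure (moment_measure n L) {Y\<in>A. tie_partition n Y = p}
    = emeasure (block_measure h \<rho> \<eta> p) {y\<in>space (block_measure h \<rho> \<eta> p). decode n p y \<in> A}"
proof -
  let ?B = "{Y\<in>A. tie_partition n Y = p}"
  have "?B = A \<inter> {Y\<in>space (tuples n). tie_partition n Y = p}" using sets.sets_into_space[OF A] by auto
  moreover have "A \<inter> {Y\<in>space (tuples n). tie_partition n Y = p} \<in> sets (tuples n)"
    using pred_tie_partition[OF p] by (intro sets.Int[OF A]) (simp only: pred_def)
  ultimately have B: "?B \<in> sets (tuples n)" by (simp only:)
  have dec: "(\<lambda>y. decode n p y) \<in> measurable (block_measure h \<rho> \<eta> p) (tuples n)"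
    unfolding measurable_cong_sets[OF sets_block_measure refl]
    by (intro measurable_decode[OF p] measurable_component_singleton)
  have "emeasure (moment_measure n L) ?B = (\<integral>\<^sup>+Y. indicator ?B Y \<partial>moment_measure n L)" using B by simp
  also have "\<dots> = (\<Sum>q | partition_on {1..n} q. \<integral>\<^sup>+y. indicator ?B (decode n q y) \<partial>block_measure h \<rho> \<eta> q)"
    using B by (intro nn_integral_moment_measure) simp
  also have "\<dots> = (\<Sum>q | partition_on {1..n} q. if q = p then \<integral>\<^sup>+y. indicator A (decode n p y) \<partial>block_measure h \<rho> \<eta> p else 0)"
  proof (rule sum.cong[OF refl])
    fix q assume "q \<in> {p. partition_on {1..n} p}"
    then have q: "partition_on {1..n} q" by simp
    have "(\<integral>\<^sup>+y. indicator ?B (decode n q y) \<partial>block_measure h \<rho> \<eta> q)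
      = (\<integral>\<^sup>+y. (if q = p then indicator A (decode n q y) else 0) \<partial>block_measure h \<rho> \<eta> q)"
    proof (rule nn_integral_cong_AE)
      show "AE y in block_measure h \<rho> \<eta> q. indicator ?B (decode n q y) = (if q = p then indicator A (decode n q y) else 0 :: ennreal)"
        using AE_block_measure[OF q]
      proof eventually_elim
        case (elim y)
        then have "tie_partition n (decode n q y) = q" by (intro tie_partition_decode[OF q]) simp
        then show ?case by (auto split: split_indicator)
      qed
    qed
    then show "(\<integral>\<^sup>+y. indicator ?B (decode n q y) \<partial>block_measure h \<rho> \<eta> q)
      = (if q = p then \<integral>\<^sup>+y. indicator A (decode n p y) \<partial>block_measure h \<rho> \<eta> p else 0)"
      by (cases "q = p") auto
  qed
  also have "\<dots> = (\<integral>\<^sup>+y. indicator A (decode n p y) \<partial>block_measure h \<rho> \<eta> p)"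
    using p by (simp add: sum.delta' finitely_many_partition_on)
  also have "\<dots> = (\<integral>\<^sup>+y. indicator {y\<in>space (block_measure h \<rho> \<eta> p). decode n p y \<in> A} y \<partial>block_measure h \<rho> \<eta> p)"
    by (intro nn_integral_cong) (auto split: split_indicator)
  also have "\<dots> = emeasure (block_measure h \<rho> \<eta> p) {y\<in>space (block_measure h \<rho> \<eta> p). decode n p y \<in> A}"
    using measurable_sets[OF dec A] by (intro nn_integral_indicator) (simp add: vimage_def Int_def conj_commute)
  finally show ?thesis .
qed

text \<open>The norm of g has a finite integral, hence each summand of its expansion is finite. This
  makes g integrable for every partition separately, and the nonnegative formula for the positive
  and negative parts yields the values.\<close>

lemma integral_moment_joint:
  fixes g :: "(nat \<Rightarrow> 'y) \<times> 'y measure \<Rightarrow> real"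
  assumes g [measurable]: "g \<in> borel_measurable (tuples n \<Otimes>\<^sub>M bf_measures)"
    and int: "integrable (moment_joint n L) (\<lambda>(\<mu>, Y). g (Y, \<mu>))"
  shows "\<And>p. partition_on {1..n} p \<Longrightarrow> AE y in block_measure h \<rho> \<eta> p.
        integrable (cond_law h \<rho> L n (decode n p y)) (\<lambda>\<mu>. g (decode n p y, \<mu>))" (is "\<And>p. _ \<Longrightarrow> ?ae p")
    and "\<And>p. partition_on {1..n} p \<Longrightarrow> integrable (block_measure h \<rho> \<eta> p)
        (\<lambda>y. \<integral>\<mu>. g (decode n p y, \<mu>) \<partial>cond_law h \<rho> L n (decode n p y))" (is "\<And>p. _ \<Longrightarrow> ?int p")
    and "(\<integral>(\<mu>, Y). g (Y, \<mu>) \<partial>moment_joint n L) = (\<Sum>p | partition_on {1..n} p.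
        \<integral>y. (\<integral>\<mu>. g (decode n p y, \<mu>) \<partial>cond_law h \<rho> L n (decode n p y)) \<partial>block_measure h \<rho> \<eta> p)"
proof -
  \<comment> \<open>Realises the summand of p as an integral over one measure, so that Fubini for
    kernels supplies both integrability claims.\<close>
  define D where "D p = semidirect (block_measure h \<rho> \<eta> p) bf_measures (\<lambda>y. cond_law h \<rho> L n (decode n p y))" for p
  define G where "G p q = g (decode n p (fst q), snd q)" for p and q :: "(nat set \<Rightarrow> 'y) \<times> 'y measure"
  have dec: "decode n p \<in> measurable (block_measure h \<rho> \<eta> p) (tuples n)" if p: "partition_on {1..n} p" for p
    unfolding measurable_cong_sets[OF sets_block_measure refl]
    by (intro measurable_decode[OF p] measurable_component_singleton)
  have K: "sf_kernel (block_measure h \<rho> \<eta> p) bf_measures (\<lambda>y. cond_law h \<rho> L n (decode n p y))"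
    if p: "partition_on {1..n} p" for p
    by (rule sf_kernel_comp[OF sf_kernel_cond_law dec[OF p]])
  have decm: "(\<lambda>q. (decode n p (fst q), snd q)) \<in> measurable (block_measure h \<rho> \<eta> p \<Otimes>\<^sub>M bf_measures) (tuples n \<Otimes>\<^sub>M bf_measures)"
    if p: "partition_on {1..n} p" for p
    using dec[OF p] by measurable
  have D: "(\<integral>\<^sup>+q. f (decode n p (fst q), snd q) \<partial>D p) = mixed_palm n p f"
    if p: "partition_on {1..n} p" and f: "f \<in> borel_measurable (tuples n \<Otimes>\<^sub>M bf_measures)" for p f
    unfolding D_def mixed_palm_cond_law[OF p f]
    using nn_integral_semidirect[OF K[OF p] measurable_compose[OF decm[OF p] f]] by simp
  have fm: "(\<lambda>q. ennreal (norm (g q))) \<in> borel_measurable (tuples n \<Otimes>\<^sub>M bf_measures)"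
    "(\<lambda>q. ennreal (g q)) \<in> borel_measurable (tuples n \<Otimes>\<^sub>M bf_measures)"
    "(\<lambda>q. ennreal (- g q)) \<in> borel_measurable (tuples n \<Otimes>\<^sub>M bf_measures)" by measurable
  have fin: "finite {p. partition_on {1..n} p}" by (rule finitely_many_partition_on) simp
  have tot: "(\<Sum>p | partition_on {1..n} p. mixed_palm n p (\<lambda>q. ennreal (norm (g q)))) < \<infinity>"
    using int nn_integral_moment_joint[OF fm(1)] by (simp add: integrable_iff_bounded case_prod_unfold)
  have part: "mixed_palm n p (\<lambda>q. ennreal (norm (g q))) < \<infinity>" if p: "partition_on {1..n} p" for p
    using tot fin p by (simp add: less_top[symmetric])
  have intG: "integrable (D p) (G p)" if p: "partition_on {1..n} p" for p
  proof (rule integrableI_bounded)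
    show "G p \<in> borel_measurable (D p)"
      unfolding D_def G_def measurable_cong_sets[OF sets_semidirect refl]
      by (rule measurable_compose[OF decm[OF p] g])
    show "(\<integral>\<^sup>+q. ennreal (norm (G p q)) \<partial>D p) < \<infinity>"
      using part[OF p] D[OF p fm(1)] by (simp add: G_def)
  qed
  note sd = integral_semidirect[OF K intG[unfolded D_def]]
  show "?ae p" if p: "partition_on {1..n} p" for p
    using sd(1)[OF p p] by (simp add: G_def)
  show "?int p" if p: "partition_on {1..n} p" for p
    using sd(2)[OF p p] by (simp add: G_def)
  have val: "(\<integral>y. (\<integral>\<mu>. g (decode n p y, \<mu>) \<partial>cond_law h \<rho> L n (decode n p y)) \<partial>block_measure h \<rho> \<eta> p)
    = enn2real (mixed_palm n p (\<lambda>q. ennreal (g q))) - enn2real (mixed_palm n p (\<lambda>q. ennreal (- g q)))"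
    if p: "partition_on {1..n} p" for p
  proof -
    have "(\<integral>y. (\<integral>\<mu>. g (decode n p y, \<mu>) \<partial>cond_law h \<rho> L n (decode n p y)) \<partial>block_measure h \<rho> \<eta> p) = (\<integral>q. G p q \<partial>D p)"
      using sd(3)[OF p p] by (simp add: G_def D_def)
    also have "\<dots> = enn2real (mixed_palm n p (\<lambda>q. ennreal (g q))) - enn2real (mixed_palm n p (\<lambda>q. ennreal (- g q)))"
      unfolding real_lebesgue_integral_def[OF intG[OF p]] using D[OF p fm(2)] D[OF p fm(3)] by (simp add: G_def)
    finally show ?thesis .
  qed
  have le: "mixed_palm n p f < \<top>" if p: "partition_on {1..n} p" and "\<And>q. f q \<le> ennreal (norm (g q))" for p f
  proof -
    have "mixed_palm n p f \<le> mixed_palm n p (\<lambda>q. ennreal (norm (g q)))"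
      unfolding mixed_palm_def using that(2) by (intro nn_integral_mono)
    then show ?thesis using part[OF p] by (auto intro: le_less_trans)
  qed
  have le2: "ennreal (g q) \<le> ennreal (norm (g q))" "ennreal (- g q) \<le> ennreal (norm (g q))" for q
    by (auto intro!: ennreal_leI)
  have "(\<integral>(\<mu>, Y). g (Y, \<mu>) \<partial>moment_joint n L)
    = enn2real (\<integral>\<^sup>+(\<mu>, Y). ennreal (g (Y, \<mu>)) \<partial>moment_joint n L) - enn2real (\<integral>\<^sup>+(\<mu>, Y). ennreal (- g (Y, \<mu>)) \<partial>moment_joint n L)"
    using real_lebesgue_integral_def[OF int] by (simp add: case_prod_unfold)
  also have "\<dots> = enn2real (\<Sum>p | partition_on {1..n} p. mixed_palm n p (\<lambda>q. ennreal (g q)))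
      - enn2real (\<Sum>p | partition_on {1..n} p. mixed_palm n p (\<lambda>q. ennreal (- g q)))"
    by (simp only: nn_integral_moment_joint[OF fm(2)] nn_integral_moment_joint[OF fm(3)])
  \<comment> \<open>\<open>enn2real\<close> is additive only over finite terms; both parts are
    dominated by the norm, whose summands are finite.\<close>
  also have "\<dots> = (\<Sum>p | partition_on {1..n} p. enn2real (mixed_palm n p (\<lambda>q. ennreal (g q))) - enn2real (mixed_palm n p (\<lambda>q. ennreal (- g q))))"
    using le le2 by (subst (1 2) enn2real_sum) (auto simp: sum_subtractf)
  finally show "(\<integral>(\<mu>, Y). g (Y, \<mu>) \<partial>moment_joint n L) = (\<Sum>p | partition_on {1..n} p.
        \<integral>y. (\<integral>\<mu>. g (decode n p y, \<mu>) \<partial>cond_law h \<rho> L n (decode n p y)) \<partial>block_measure h \<rho> \<eta> p)"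
    using val by simp
qed

end

theorem theorem3p1:
  fixes \<eta> :: "'y::polish_space measure"
    and \<rho> :: "'y \<Rightarrow> 's::polish_space measure"
    and h :: "'s \<Rightarrow> real"
    and P :: "'w measure"
    and N :: "'w \<Rightarrow> ('s \<times> 'y) measure"
    and L :: "'y measure measure"
    and n :: nat
  assumes "sets \<eta> = sets borel" and "sigma_finite_measure \<eta>" and "non_atomic \<eta>"
    and "measurable_kernel \<rho>" and "\<And>y. sigma_finite_measure (\<rho> y)"
    and "h \<in> borel_measurable borel" and "\<And>s. 0 < h s"
    and "\<And>B. B \<in> sets borel \<Longrightarrow> bounded B \<Longrightarrow>
      (\<integral>\<^sup>+y\<in>B. (\<integral>\<^sup>+s. ennreal (min (h s) 1) \<partial>\<rho> y) \<partial>\<eta>) < \<infinity>"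
    and "poisson_random_measure P (intensity \<rho> \<eta>) N"
    and "L = crm_law P h N"
    and "\<And>k y. 1 \<le> k \<Longrightarrow> kappa h \<rho> k y < \<infinity>"
    and "1 \<le> n"
  shows
    "(\<forall>g :: (nat \<Rightarrow> 'y) \<times> 'y measure \<Rightarrow> ennreal.
        g \<in> borel_measurable (tuples n \<Otimes>\<^sub>M bf_measures) \<longrightarrow>
        (\<integral>\<^sup>+(\<mu>, Y). g (Y, \<mu>) \<partial>moment_joint n L)
          = (\<integral>\<^sup>+(Y, \<mu>). g (Y, \<mu>) \<partial>disintegrated_joint h \<rho> L n) \<and>
        (\<integral>\<^sup>+(\<mu>, Y). g (Y, \<mu>) \<partial>moment_joint n L)
          = (\<Sum>p | partition_on {1..n} p.
              \<integral>\<^sup>+y. (\<integral>\<^sup>+\<mu>. g (decode n p y, \<mu>) \<partial>cond_law h \<rho> L n (decode n p y))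
                \<partial>block_measure h \<rho> \<eta> p))
     \<and>
     (\<forall>g :: (nat \<Rightarrow> 'y) \<times> 'y measure \<Rightarrow> real.
        g \<in> borel_measurable (tuples n \<Otimes>\<^sub>M bf_measures) \<and>
        integrable (moment_joint n L) (\<lambda>(\<mu>, Y). g (Y, \<mu>)) \<longrightarrow>
        integrable (disintegrated_joint h \<rho> L n) (\<lambda>(Y, \<mu>). g (Y, \<mu>)) \<and>
        (\<forall>p. partition_on {1..n} p \<longrightarrow>
          (AE y in block_measure h \<rho> \<eta> p.
             integrable (cond_law h \<rho> L n (decode n p y)) (\<lambda>\<mu>. g (decode n p y, \<mu>))) \<and>
          integrable (block_measure h \<rho> \<eta> p)
            (\<lambda>y. \<integral>\<mu>. g (decode n p y, \<mu>) \<partial>cond_law h \<rho> L n (decode n p y))) \<and>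
        (\<integral>(\<mu>, Y). g (Y, \<mu>) \<partial>moment_joint n L)
          = (\<integral>(Y, \<mu>). g (Y, \<mu>) \<partial>disintegrated_joint h \<rho> L n) \<and>
        (\<integral>(\<mu>, Y). g (Y, \<mu>) \<partial>moment_joint n L)
          = (\<Sum>p | partition_on {1..n} p.
              \<integral>y. (\<integral>\<mu>. g (decode n p y, \<mu>) \<partial>cond_law h \<rho> L n (decode n p y))
                \<partial>block_measure h \<rho> \<eta> p))
     \<and>
     (\<forall>p A. partition_on {1..n} p \<and> A \<in> sets (tuples n) \<longrightarrow>
        emeasure (moment_measure n L) {Y\<in>A. tie_partition n Y = p}
          = emeasure (block_measure h \<rho> \<eta> p) {y\<in>space (block_measure h \<rho> \<eta> p). decode n p y \<in> A})"
proof -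
  interpret c: crm \<eta> \<rho> h P N by (rule crm.intro[OF assms(1-4,6-9,11)])
  have L: "L = c.L" using assms(10) by (simp add: c.L_def)
  show ?thesis unfolding L
  proof (intro conjI allI impI; (elim conjE)?)
    fix g :: "(nat \<Rightarrow> 'y) \<times> 'y measure \<Rightarrow> ennreal"
    assume g: "g \<in> borel_measurable (tuples n \<Otimes>\<^sub>M bf_measures)"
    show "(\<integral>\<^sup>+(\<mu>, Y). g (Y, \<mu>) \<partial>moment_joint n c.L) = (\<integral>\<^sup>+(Y, \<mu>). g (Y, \<mu>) \<partial>disintegrated_joint h \<rho> c.L n)"
      using c.nn_integral_moment_joint[OF g] c.nn_integral_disintegrated_joint[OF g] by simp
    show "(\<integral>\<^sup>+(\<mu>, Y). g (Y, \<mu>) \<partial>moment_joint n c.L) = (\<Sum>p | partition_on {1..n} p.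
        \<integral>\<^sup>+y. (\<integral>\<^sup>+\<mu>. g (decode n p y, \<mu>) \<partial>cond_law h \<rho> c.L n (decode n p y)) \<partial>block_measure h \<rho> \<eta> p)"
      unfolding c.nn_integral_moment_joint[OF g] using c.mixed_palm_cond_law[OF _ g] by (intro sum.cong) auto
  next
    fix g :: "(nat \<Rightarrow> 'y) \<times> 'y measure \<Rightarrow> real"
    assume g: "g \<in> borel_measurable (tuples n \<Otimes>\<^sub>M bf_measures)"
      and int: "integrable (moment_joint n c.L) (\<lambda>(\<mu>, Y). g (Y, \<mu>))"
    show "integrable (disintegrated_joint h \<rho> c.L n) (\<lambda>(Y, \<mu>). g (Y, \<mu>))"
      using int integrable_distr_eq[OF c.measurable_swap_moment g] unfolding c.disintegrated_joint_eq_distr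
      by (simp add: case_prod_unfold)
    show "(\<integral>(\<mu>, Y). g (Y, \<mu>) \<partial>moment_joint n c.L) = (\<integral>(Y, \<mu>). g (Y, \<mu>) \<partial>disintegrated_joint h \<rho> c.L n)"
      using integral_distr[OF c.measurable_swap_moment g] unfolding c.disintegrated_joint_eq_distr
      by (simp add: case_prod_unfold)
    show "(\<integral>(\<mu>, Y). g (Y, \<mu>) \<partial>moment_joint n c.L) = (\<Sum>p | partition_on {1..n} p.
        \<integral>y. (\<integral>\<mu>. g (decode n p y, \<mu>) \<partial>cond_law h \<rho> c.L n (decode n p y)) \<partial>block_measure h \<rho> \<eta> p)"
      by (rule c.integral_moment_joint(3)[OF g int])
    fix p assume p: "partition_on {1..n} p"
    show "AE y in block_measure h \<rho> \<eta> p. integrable (cond_law h \<rho> c.L n (decode n p y)) (\<lambda>\<mu>. g (decode n p y, \<mu>))"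
      by (rule c.integral_moment_joint(1)[OF g int p])
    show "integrable (block_measure h \<rho> \<eta> p) (\<lambda>y. \<integral>\<mu>. g (decode n p y, \<mu>) \<partial>cond_law h \<rho> c.L n (decode n p y))"
      by (rule c.integral_moment_joint(2)[OF g int p])
  next
    fix p and A :: "(nat \<Rightarrow> 'y) set"
    assume "partition_on {1..n} p" "A \<in> sets (tuples n)"
    then show "emeasure (moment_measure n c.L) {Y\<in>A. tie_partition n Y = p}
      = emeasure (block_measure h \<rho> \<eta> p) {y\<in>space (block_measure h \<rho> \<eta> p). decode n p y \<in> A}"
      by (rule c.emeasure_moment_tie)
  qed
qed

end
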